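(* Let $d=1$, $f\in\mathcal{S}(\mathbb{R})$, and let $(\xi_x)_{x\in\mathbb{Z}}$ be i.i.d. real random variables whose characteristic function $\varphi(t)=\mathbb{E}[e^{2\pi\mathbf{i}t\xi_0}]$ satisfies $1-\varphi(x)\sim c|x|$ as $|x|\to0$, for some $c>0$. Let $T_r^0=\sum_{x\in\mathbb{Z}} f((x+\xi_x)/r)$. Then: \begin{enumerate} \item $T_r^0 - r\int_{\mathbb{R}} f(x)\,dx$ converges in distribution as $r\to\infty$ toward a random variable whose distribution is characterized by its moments. \item If $f(x)=e^{-x^2}$, then this limit distribution is not Gaussian. \end{enumerate}
   Context: $\mathcal{S}(\mathbb{R})$ denotes the Schwartz space of infinitely differentiable functions all of whose derivatives decay faster than any polynomial. *)

theory Defs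
  imports "HOL-Probability.Probability" "HOL-Library.Landau_Symbols"
begin

definition schwartz :: "(real \<Rightarrow> real) \<Rightarrow> bool" where
  "schwartz f \<longleftrightarrow>
     (\<forall>n x. ((deriv ^^ n) f) differentiable (at x)) \<and>
     (\<forall>n k. bounded (range (\<lambda>x. \<bar>x\<bar> ^ k * \<bar>(deriv ^^ n) f x\<bar>)))"

definition weak_conv_filter :: "('i \<Rightarrow> real measure) \<Rightarrow> real measure \<Rightarrow> 'i filter \<Rightarrow> bool" where
  "weak_conv_filter \<mu>s \<mu> F \<longleftrightarrow>
     (\<forall>g :: real \<Rightarrow> real. continuous_on UNIV g \<and> bounded (range g) \<longrightarrow>
        ((\<lambda>i. integral\<^sup>L (\<mu>s i) g) \<longlongrightarrow> integral\<^sup>L \<mu> g) F)"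

definition determined_by_moments :: "real measure \<Rightarrow> bool" where
  "determined_by_moments \<mu> \<longleftrightarrow>
     prob_space \<mu> \<and> sets \<mu> = sets borel \<and>
     (\<forall>k::nat. integrable \<mu> (\<lambda>x. x ^ k)) \<and>
     (\<forall>\<nu>. prob_space \<nu> \<and> sets \<nu> = sets borel \<and>
          (\<forall>k::nat. integrable \<nu> (\<lambda>x. x ^ k) \<and>
                   integral\<^sup>L \<nu> (\<lambda>x. x ^ k) = integral\<^sup>L \<mu> (\<lambda>x. x ^ k))
          \<longrightarrow> \<nu> = \<mu>)"

definition gaussian :: "real measure \<Rightarrow> bool" where
  "gaussian \<mu> \<longleftrightarrow>
     (\<exists>m. \<mu> = return borel m) \<or>
     (\<exists>m \<sigma>. \<sigma> > 0 \<and> \<mu> = density lborel (normal_density m \<sigma>))"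

end

theory Submission
  imports Defs
begin

text \<open>
  By independence, the characteristic function of the centered sum at \<open>s\<close> is, up to the factor
  coming from the Riemann sum of \<open>f\<close>, the product over the sites \<open>x\<close> of \<open>1 + b x\<close>, where
  \<open>b x\<close> is the expectation of \<open>exp (i s (f ((x + \<xi>) / r) - f (x / r))) - 1\<close>. Each \<open>b x\<close> is small
  and the sum of the squares tends to 0, so the product behaves like the exponential of the sum of
  the \<open>b x\<close>. This sum is a Riemann sum: it is close to \<open>r\<close> times the expectation of \<open>H (\<xi> / r)\<close>,
  where \<open>H y\<close> is the integral of \<open>exp (i s (f (u + y) - f u)) - 1\<close> over \<open>u\<close>, and \<open>H y\<close> is of order
  \<open>y\<^sup>2\<close> at 0. The hypothesis on the characteristic function of \<open>\<xi>\<close> says that \<open>r\<close> times the law of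
  \<open>\<xi> / r\<close> converges to a multiple of \<open>dy / y\<^sup>2\<close>. So the limit is infinitely divisible, with Levy
  measure the image of a multiple of \<open>du dy / y\<^sup>2\<close> under \<open>f (u + y) - f u\<close>. Its jumps are bounded,
  hence all exponential moments are finite and the moments determine the distribution; it has no
  Gaussian part, hence it is Gaussian only if all increments of \<open>f\<close> vanish.
\<close>

section \<open>Riemann sums over the integers\<close>

text \<open>The hypothesis forces the first absolute moment of the noise to be infinite, so nothing
  can be expanded in powers of \<open>\<xi>\<close>; the estimates use the truncated displacement
  \<open>kap (\<xi> / r)\<close> instead. Its second moment is at most of order
  \<open>1 / r\<close>, and the sharper fact that its first moment is of smaller order than
  \<open>1 / sqrt r\<close> is what makes the sum of the squares vanish. The exponent
  \<open>z\<close> is an arbitrary complex number: \<open>z = \<i> * of_real s\<close> gives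
  characteristic functions and real \<open>z\<close> gives exponential moments, with the same bounds
  on \<open>b\<close> and the same limit \<open>\<Lambda> z\<close>. The weight
  \<open>y\<^sup>2 / (1 + y\<^sup>2)\<close> that tames the infinite measure
  \<open>dy / y\<^sup>2\<close> is an average of \<open>1 - iexp (w * y)\<close> over a Laplace
  density in \<open>w\<close>. Tilted characteristic functions are therefore averages of increments
  of the given one, and the hypothesis at 0 applies to them directly. The limit law is not built
  from its Levy measure: tightness produces it as a subsequential limit.\<close>

definition C1L1 :: "(real \<Rightarrow> 'b::euclidean_space) \<Rightarrow> (real \<Rightarrow> 'b) \<Rightarrow> bool" where
  "C1L1 g g' \<longleftrightarrow> (\<forall>x. (g has_vector_derivative g' x) (at x)) \<and> continuous_on UNIV g' \<and>
     integrable lborel g \<and> integrable lborel g'"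

lemma C1L1_D:
  assumes "C1L1 g g'"
  shows "(g has_vector_derivative g' x) (at x)" "continuous_on UNIV g'"
    "integrable lborel g" "integrable lborel g'"
  using assms unfolding C1L1_def by blast+

lemma C1L1_cont: "C1L1 g g' \<Longrightarrow> continuous_on S g"
  unfolding C1L1_def
  by (meson continuous_at_imp_continuous_on has_vector_derivative_continuous)

lemma C1L1_meas:
  assumes "C1L1 g g'"
  shows "g \<in> borel_measurable borel" "g' \<in> borel_measurable borel"
  using assms C1L1_cont[OF assms] by (auto simp: C1L1_def intro!: borel_measurable_continuous_onI)

text \<open>The fundamental theorem of calculus, with nonnegative integrals and a superset
  \<open>A\<close> of the interval: if \<open>A\<close> has simple sections in both variables,
  integrals over the base point can be swapped without any integrability check.\<close>

lemma C1L1_diff_le: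
  assumes g: "C1L1 g g'" and ab: "a \<le> b" and sub: "{a..b} \<subseteq> A"
  shows "ennreal (norm (g b - g a)) \<le> (\<integral>\<^sup>+v. indicator A v * ennreal (norm (g' v)) \<partial>lborel)"
proof -
  note [measurable] = C1L1_meas[OF g]
  have "g b - g a = integral\<^sup>L lborel (\<lambda>x. indicator {a..b} x *\<^sub>R g' x)"
    using g continuous_on_subset[of UNIV g' "{a..b}"]
    by (intro integral_FTC_atLeastAtMost[symmetric, OF ab])
      (simp_all add: C1L1_def has_vector_derivative_at_within)
  also have "ennreal (norm \<dots>) \<le> (\<integral>\<^sup>+x. ennreal (norm (indicator {a..b} x *\<^sub>R g' x)) \<partial>lborel)"
    by (intro integral_norm_bound_ennreal integrable_mult_indicator[unfolded real_scaleR_def])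
       (use g in \<open>auto simp: C1L1_def\<close>)
  also have "\<dots> \<le> (\<integral>\<^sup>+v. indicator A v * ennreal (norm (g' v)) \<partial>lborel)"
    using sub by (intro nn_integral_mono) (auto simp: indicator_def)
  finally show ?thesis .
qed

text \<open>Sums over the integers become Lebesgue integrals of functions of the integer part.\<close>

lemma distr_lborel_floor:
  "distr lborel (count_space UNIV) (floor :: real \<Rightarrow> int) = count_space UNIV"
proof (rule measure_eqI_countable[of _ UNIV])
  fix a :: int
  have "emeasure (distr lborel (count_space UNIV) (floor :: real \<Rightarrow> int)) {a} =
        emeasure lborel (floor -` {a} :: real set)"
    by (subst emeasure_distr) auto
  also have "(floor -` {a} :: real set) = {of_int a..<of_int a + 1}"
    by (auto simp: floor_eq_iff)
  finally show "emeasure (distr lborel (count_space UNIV) (floor :: real \<Rightarrow> int)) {a} =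
      emeasure (count_space UNIV) {a}"
    by simp
qed auto

lemma nn_integral_lborel_floor:
  "(\<integral>\<^sup>+u. F \<lfloor>u::real\<rfloor> \<partial>lborel) = (\<integral>\<^sup>+x. F x \<partial>count_space UNIV)"
  by (subst distr_lborel_floor[symmetric], subst nn_integral_distr) auto

lemma integral_lborel_floor:
  fixes F :: "int \<Rightarrow> 'b::{banach, second_countable_topology}"
  shows "integral\<^sup>L (count_space UNIV) F = (\<integral>u. F \<lfloor>u::real\<rfloor> \<partial>lborel)"
    and "integrable (count_space UNIV) F \<longleftrightarrow> integrable lborel (\<lambda>u::real. F \<lfloor>u\<rfloor>)"
proof -
  have [measurable]: "(floor :: real \<Rightarrow> int) \<in> measurable lborel (count_space UNIV)" by simp
  have [measurable]: "F \<in> borel_measurable (count_space UNIV)" by simp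
  show "integral\<^sup>L (count_space UNIV) F = (\<integral>u. F \<lfloor>u::real\<rfloor> \<partial>lborel)"
    using integral_distr[of "floor :: real \<Rightarrow> int" lborel "count_space UNIV" F]
    unfolding distr_lborel_floor by simp
  show "integrable (count_space UNIV) F \<longleftrightarrow> integrable lborel (\<lambda>u::real. F \<lfloor>u\<rfloor>)"
    using integrable_distr_eq[of "floor :: real \<Rightarrow> int" lborel "count_space UNIV" F]
    unfolding distr_lborel_floor by simp
qed

text \<open>A point and its integer part lie in the same unit cell. Sharing a cell is a symmetric
  relation, so after swapping the integrals every \<open>v\<close> is weighted by the length 1 of
  its own cell.\<close>

lemma nn_integral_floor_diff_le:
  assumes g: "C1L1 g g'"
  shows "(\<integral>\<^sup>+u. ennreal (norm (g (of_int \<lfloor>u\<rfloor>) - g u)) \<partial>lborel) \<le> (\<integral>\<^sup>+v. norm (g' v) \<partial>lborel)"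
proof -
  note [measurable] = C1L1_meas[OF g]
  define A :: "real \<Rightarrow> real set" where "A u = {of_int \<lfloor>u\<rfloor>..<of_int \<lfloor>u\<rfloor> + 1}" for u
  have A: "v \<in> A u \<longleftrightarrow> u \<in> A v" for u v
    using floor_eq_iff[of v "\<lfloor>u\<rfloor>"] floor_eq_iff[of u "\<lfloor>v\<rfloor>"] by (auto simp: A_def)
  have "(\<integral>\<^sup>+u. ennreal (norm (g (of_int \<lfloor>u\<rfloor>) - g u)) \<partial>lborel) \<le>
    (\<integral>\<^sup>+u. (\<integral>\<^sup>+v. indicator (A u) v * ennreal (norm (g' v)) \<partial>lborel) \<partial>lborel)"
  proof (rule nn_integral_mono)
    fix u :: real
    have "{of_int \<lfloor>u\<rfloor>..u} \<subseteq> A u" by (auto simp: A_def) linarith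
    from C1L1_diff_le[OF g _ this]
    show "ennreal (norm (g (of_int \<lfloor>u\<rfloor>) - g u)) \<le> (\<integral>\<^sup>+v. indicator (A u) v * ennreal (norm (g' v)) \<partial>lborel)"
      by (simp add: norm_minus_commute)
  qed
  also have "\<dots> = (\<integral>\<^sup>+v. (\<integral>\<^sup>+u. indicator (A u) v * ennreal (norm (g' v)) \<partial>lborel) \<partial>lborel)"
    by (rule lborel_pair.Fubini') (simp add: indicator_def A_def)
  also have "\<dots> = (\<integral>\<^sup>+v. norm (g' v) \<partial>lborel)"
  proof (rule nn_integral_cong)
    fix v :: real
    have "(\<integral>\<^sup>+u. indicator (A u) v * ennreal (norm (g' v)) \<partial>lborel) =
       (\<integral>\<^sup>+u. ennreal (norm (g' v)) * indicator (A v) u \<partial>lborel)"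
      using A by (intro nn_integral_cong) (auto simp: indicator_def)
    then show "(\<integral>\<^sup>+u. indicator (A u) v * ennreal (norm (g' v)) \<partial>lborel) = ennreal (norm (g' v))"
      by (simp add: nn_integral_cmult A_def)
  qed
  finally show ?thesis .
qed

lemma nn_integral_norm_eq:
  "integrable M g \<Longrightarrow> (\<integral>\<^sup>+x. ennreal (norm (g x)) \<partial>M) = ennreal (\<integral>x. norm (g x) \<partial>M)"
  for g :: "_ \<Rightarrow> 'b::{banach, second_countable_topology}"
  by (rule nn_integral_eq_integral) auto

lemma integrable_normI:
  fixes g :: "_ \<Rightarrow> 'b::{banach, second_countable_topology}"
  assumes "g \<in> borel_measurable M" "(\<integral>\<^sup>+x. ennreal (norm (g x)) \<partial>M) \<le> ennreal c" "c \<ge> 0"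
  shows "integrable M g" "(\<integral>x. norm (g x) \<partial>M) \<le> c"
proof -
  show *: "integrable M g"
    by (intro integrableI_bounded assms(1) le_less_trans[OF assms(2)]) simp
  show "(\<integral>x. norm (g x) \<partial>M) \<le> c"
    using assms(2,3) by (simp add: nn_integral_norm_eq[OF *])
qed

lemma sum_int_approx:
  assumes g: "C1L1 g g'"
  shows "integrable (count_space UNIV) (\<lambda>x::int. g (of_int x))"
    and "norm ((\<integral>x. g (of_int (x::int)) \<partial>count_space UNIV) - integral\<^sup>L lborel g) \<le>
      (\<integral>v. norm (g' v) \<partial>lborel)"
proof -
  note [measurable] = C1L1_meas[OF g]
  have gi: "integrable lborel g" "integrable lborel g'" using g by (auto simp: C1L1_def)
  have m: "(\<lambda>u::real. g (of_int \<lfloor>u\<rfloor>) - g u) \<in> borel_measurable lborel" by simp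
  have le: "(\<integral>\<^sup>+u. ennreal (norm (g (of_int \<lfloor>u\<rfloor>) - g u)) \<partial>lborel) \<le> ennreal (\<integral>v. norm (g' v) \<partial>lborel)"
    using nn_integral_floor_diff_le[OF g] unfolding nn_integral_norm_eq[OF gi(2)] .
  note d = integrable_normI[OF m le integral_nonneg_AE[OF AE_I2[OF norm_ge_zero]]]
  have i: "integrable lborel (\<lambda>u. g (of_int \<lfloor>u::real\<rfloor>))"
    using Bochner_Integration.integrable_add[OF d(1) gi(1)] by simp
  then show "integrable (count_space UNIV) (\<lambda>x::int. g (of_int x))"
    using integral_lborel_floor(2)[of "\<lambda>x. g (of_int x)"] by blast
  have "(\<integral>x. g (of_int (x::int)) \<partial>count_space UNIV) - integral\<^sup>L lborel g =
     (\<integral>u. g (of_int \<lfloor>u\<rfloor>) - g u \<partial>lborel)"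
    using i gi unfolding integral_lborel_floor(1) by simp
  also have "norm \<dots> \<le> (\<integral>u. norm (g (of_int \<lfloor>u\<rfloor>) - g u) \<partial>lborel)"
    by (rule integral_norm_bound)
  also note d(2)
  finally show "norm ((\<integral>x. g (of_int (x::int)) \<partial>count_space UNIV) - integral\<^sup>L lborel g) \<le>
      (\<integral>v. norm (g' v) \<partial>lborel)" .
qed

lemma C1L1_norm_sum:
  assumes g: "C1L1 g g'"
  shows "(\<integral>x. norm (g (of_int (x::int))) \<partial>count_space UNIV) \<le>
      (\<integral>v. norm (g v) \<partial>lborel) + (\<integral>v. norm (g' v) \<partial>lborel)"
proof -
  note [measurable] = C1L1_meas[OF g]
  have gi: "integrable lborel g" "integrable lborel g'" using g by (auto simp: C1L1_def)
  have "(\<integral>\<^sup>+x. ennreal (norm (g (of_int (x::int)))) \<partial>count_space UNIV) =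
    (\<integral>\<^sup>+u. ennreal (norm (g (of_int \<lfloor>u::real\<rfloor>))) \<partial>lborel)"
    by (subst nn_integral_lborel_floor[symmetric]) simp
  also have "\<dots> \<le> (\<integral>\<^sup>+u. ennreal (norm (g (of_int \<lfloor>u\<rfloor>) - g u)) + ennreal (norm (g u)) \<partial>lborel)"
    by (intro nn_integral_mono)
       (simp flip: ennreal_plus, metis add.commute norm_triangle_sub)
  also have "\<dots> = (\<integral>\<^sup>+u. ennreal (norm (g (of_int \<lfloor>u\<rfloor>) - g u)) \<partial>lborel) + (\<integral>\<^sup>+u. ennreal (norm (g u)) \<partial>lborel)"
    by (rule nn_integral_add) auto
  also have "\<dots> \<le> ennreal ((\<integral>v. norm (g v) \<partial>lborel) + (\<integral>v. norm (g' v) \<partial>lborel))"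
    using nn_integral_floor_diff_le[OF g]
    by (simp add: nn_integral_norm_eq[OF gi(2)] nn_integral_norm_eq[OF gi(1)] ennreal_plus add.commute)
  finally show ?thesis
    by (intro integrable_normI(2)) auto
qed

lemma lborel_integral_shift:
  fixes h :: "real \<Rightarrow> 'c::{banach, second_countable_topology}"
  shows "integral\<^sup>L lborel (\<lambda>u. h (u + y)) = integral\<^sup>L lborel h"
  using lborel_integral_real_affine[of 1 h y] by (simp add: add.commute)

lemma C1L1_shift:
  assumes g: "C1L1 g g'"
  shows "C1L1 (\<lambda>u. g (u + y)) (\<lambda>u. g' (u + y))"
proof -
  have d: "((\<lambda>u. u + y) has_vector_derivative 1) (at x)" for x
    unfolding has_real_derivative_iff_has_vector_derivative[symmetric]
    by (auto intro!: derivative_eq_intros)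
  have 1: "((\<lambda>u. g (u + y)) has_vector_derivative g' (x + y)) (at x)" for x
    using vector_diff_chain_at[OF d C1L1_D(1)[OF g]] unfolding o_def scaleR_one .
  have 2: "continuous_on UNIV (\<lambda>u. g' (u + y))"
    by (rule continuous_on_compose2[OF C1L1_D(2)[OF g]]) (auto intro!: continuous_intros)
  have eq: "y + 1 * u = u + y" for u by simp
  have 3: "integrable lborel (\<lambda>u. g (u + y))" "integrable lborel (\<lambda>u. g' (u + y))"
    using lborel_integrable_real_affine[OF C1L1_D(3)[OF g] one_neq_zero, of y]
      lborel_integrable_real_affine[OF C1L1_D(4)[OF g] one_neq_zero, of y] unfolding eq .
  show "C1L1 (\<lambda>u. g (u + y)) (\<lambda>u. g' (u + y))"
    unfolding C1L1_def using 1 2 3 by blast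
qed

lemma C1L1_diff: "C1L1 g g' \<Longrightarrow> C1L1 h h' \<Longrightarrow> C1L1 (\<lambda>u. g u - h u) (\<lambda>u. g' u - h' u)"
  unfolding C1L1_def by (auto intro!: derivative_intros continuous_intros)

text \<open>Dilation by \<open>r\<close> multiplies the L1 norm by \<open>r\<close> but preserves
  the L1 norm of the derivative. Hence the error of a Riemann sum with mesh \<open>1 / r\<close>
  stays bounded while the main term grows like \<open>r\<close>.\<close>

lemma C1L1_scale:
  assumes g: "C1L1 g g'" and r: "r > 0"
  shows "C1L1 (\<lambda>u. g (u / r)) (\<lambda>u. (1 / r) *\<^sub>R g' (u / r))"
    "integral\<^sup>L lborel (\<lambda>u. g (u / r)) = r *\<^sub>R integral\<^sup>L lborel g"
    "(\<integral>u. norm (g (u / r)) \<partial>lborel) = r * (\<integral>u. norm (g u) \<partial>lborel)"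
    "(\<integral>u. norm ((1 / r) *\<^sub>R g' (u / r)) \<partial>lborel) = (\<integral>u. norm (g' u) \<partial>lborel)"
proof -
  have d: "((\<lambda>u. u / r) has_vector_derivative 1 / r) (at x)" for x
    unfolding has_real_derivative_iff_has_vector_derivative[symmetric]
    by (rule DERIV_cdivide[OF DERIV_ident])
  have 1: "((\<lambda>u. g (u / r)) has_vector_derivative (1 / r) *\<^sub>R g' (x / r)) (at x)" for x
    using vector_diff_chain_at[OF d C1L1_D(1)[OF g]] unfolding o_def .
  have "continuous_on UNIV (\<lambda>u. g' (u / r))"
    by (rule continuous_on_compose2[OF C1L1_D(2)[OF g]]) (use r in \<open>auto intro!: continuous_intros\<close>)
  then have 2: "continuous_on UNIV (\<lambda>u. (1 / r) *\<^sub>R g' (u / r))"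
    by (intro continuous_on_scaleR continuous_on_const)
  have eq: "0 + 1 / r * u = u / r" for u by simp
  have r': "1 / r \<noteq> 0" using r by simp
  have 3: "integrable lborel (\<lambda>u. g (u / r))" "integrable lborel (\<lambda>u. g' (u / r))"
    using lborel_integrable_real_affine[OF C1L1_D(3)[OF g] r', of 0]
      lborel_integrable_real_affine[OF C1L1_D(4)[OF g] r', of 0] unfolding eq .
  show "C1L1 (\<lambda>u. g (u / r)) (\<lambda>u. (1 / r) *\<^sub>R g' (u / r))"
    unfolding C1L1_def using 1 2 3(1) integrable_scaleR_right[OF 3(2)] by blast
  have 4: "integral\<^sup>L lborel (\<lambda>u. h (u / r)) = r *\<^sub>R integral\<^sup>L lborel h"
    for h :: "real \<Rightarrow> 'c::{banach, second_countable_topology}"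
    unfolding lborel_integral_real_affine[OF r', of h 0] eq using r by simp
  show "integral\<^sup>L lborel (\<lambda>u. g (u / r)) = r *\<^sub>R integral\<^sup>L lborel g"
    "(\<integral>u. norm (g (u / r)) \<partial>lborel) = r * (\<integral>u. norm (g u) \<partial>lborel)"
    using 4[of g] 4[of "\<lambda>u. norm (g u)"] by simp_all
  have "(\<integral>u. norm ((1 / r) *\<^sub>R g' (u / r)) \<partial>lborel) = (1 / r) * (\<integral>u. norm (g' (u / r)) \<partial>lborel)"
    using r by simp
  also have "\<dots> = (\<integral>u. norm (g' u) \<partial>lborel)"
    unfolding 4[of "\<lambda>u. norm (g' u)"] using r by simp
  finally show "(\<integral>u. norm ((1 / r) *\<^sub>R g' (u / r)) \<partial>lborel) = (\<integral>u. norm (g' u) \<partial>lborel)" .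
qed

lemma riemann_sum:
  assumes g: "C1L1 g g'" and r: "r > 0"
  shows "integrable (count_space UNIV) (\<lambda>x::int. g (of_int x / r))"
    and "norm ((\<integral>x. g (of_int (x::int) / r) \<partial>count_space UNIV) - r *\<^sub>R integral\<^sup>L lborel g) \<le>
      (\<integral>v. norm (g' v) \<partial>lborel)"
    and "(\<integral>x. norm (g (of_int (x::int) / r)) \<partial>count_space UNIV) \<le>
      r * (\<integral>v. norm (g v) \<partial>lborel) + (\<integral>v. norm (g' v) \<partial>lborel)"
  using sum_int_approx[OF C1L1_scale(1)[OF g r]] C1L1_norm_sum[OF C1L1_scale(1)[OF g r]]
  unfolding C1L1_scale(2-)[OF g r] by blast+

text \<open>A point \<open>v\<close> lies between \<open>u\<close> and \<open>u + y\<close> exactly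
  when \<open>u\<close> lies between \<open>v - y\<close> and \<open>v\<close>, a segment of length
  \<open>\<bar>y\<bar>\<close>; swapping integrals gives the first bound. It serves for small
  \<open>y\<close>, the second one for large \<open>y\<close>.\<close>

lemma L1_modulus:
  assumes g: "C1L1 g g'"
  shows "(\<integral>u. norm (g (u + y) - g u) \<partial>lborel) \<le> \<bar>y\<bar> * (\<integral>v. norm (g' v) \<partial>lborel)"
    and "(\<integral>u. norm (g (u + y) - g u) \<partial>lborel) \<le> 2 * (\<integral>v. norm (g v) \<partial>lborel)"
proof -
  note [measurable] = C1L1_meas[OF g]
  have gi: "integrable lborel g" "integrable lborel g'" using g by (auto simp: C1L1_def)
  define A where "A u = {min u (u+y)..max u (u+y)}" for u
  have "(\<integral>\<^sup>+u. ennreal (norm (g (u + y) - g u)) \<partial>lborel) \<le>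
    (\<integral>\<^sup>+u. (\<integral>\<^sup>+v. indicator (A u) v * ennreal (norm (g' v)) \<partial>lborel) \<partial>lborel)"
  proof (rule nn_integral_mono)
    fix u :: real
    show "ennreal (norm (g (u + y) - g u)) \<le> (\<integral>\<^sup>+v. indicator (A u) v * ennreal (norm (g' v)) \<partial>lborel)"
    proof (cases "y \<ge> 0")
      case True
      then show ?thesis using C1L1_diff_le[OF g, of u "u + y" "A u"] by (auto simp: A_def)
    next
      case False
      then show ?thesis using C1L1_diff_le[OF g, of "u + y" u "A u"]
        by (auto simp: A_def norm_minus_commute)
    qed
  qed
  also have "\<dots> = (\<integral>\<^sup>+v. (\<integral>\<^sup>+u. indicator (A u) v * ennreal (norm (g' v)) \<partial>lborel) \<partial>lborel)"
    by (rule lborel_pair.Fubini') (simp add: indicator_def A_def)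
  also have "\<dots> = (\<integral>\<^sup>+v. ennreal \<bar>y\<bar> * norm (g' v) \<partial>lborel)"
  proof (rule nn_integral_cong)
    fix v :: real
    have "(\<integral>\<^sup>+u. indicator (A u) v * ennreal (norm (g' v)) \<partial>lborel) =
       (\<integral>\<^sup>+u. ennreal (norm (g' v)) * indicator {min v (v-y)..max v (v-y)} u \<partial>lborel)"
      by (intro nn_integral_cong) (auto simp: indicator_def A_def)
    also have "\<dots> = ennreal (norm (g' v)) * ennreal (max v (v - y) - min v (v-y))"
      by (simp add: nn_integral_cmult)
    also have "max v (v - y) - min v (v-y) = \<bar>y\<bar>" by auto
    finally show "(\<integral>\<^sup>+u. indicator (A u) v * ennreal (norm (g' v)) \<partial>lborel) = ennreal \<bar>y\<bar> * norm (g' v)"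
      by (simp add: mult.commute)
  qed
  also have "\<dots> = ennreal (\<bar>y\<bar> * (\<integral>v. norm (g' v) \<partial>lborel))"
    by (simp add: nn_integral_cmult nn_integral_norm_eq[OF gi(2)] ennreal_mult'')
  finally show "(\<integral>u. norm (g (u + y) - g u) \<partial>lborel) \<le> \<bar>y\<bar> * (\<integral>v. norm (g' v) \<partial>lborel)"
    by (intro integrable_normI(2)) auto
  have i2: "integrable lborel (\<lambda>u. g (u + y))" using C1L1_shift[OF g] by (auto simp: C1L1_def)
  have "(\<integral>u. norm (g (u + y) - g u) \<partial>lborel) \<le> (\<integral>u. norm (g (u + y)) + norm (g u) \<partial>lborel)"
    using i2 gi by (intro integral_mono) (auto intro: norm_triangle_ineq4)
  also have "\<dots> = 2 * (\<integral>v. norm (g v) \<partial>lborel)"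
    using i2 gi lborel_integral_shift[of "\<lambda>u. norm (g u)" y] by simp
  finally show "(\<integral>u. norm (g (u + y) - g u) \<partial>lborel) \<le> 2 * (\<integral>v. norm (g v) \<partial>lborel)" .
qed

section \<open>The trapezoidal rule\<close>

definition unit_cell :: "real \<Rightarrow> real set" where
  "unit_cell u = {of_int \<lfloor>u\<rfloor>..<of_int \<lfloor>u\<rfloor> + 1}"

lemma unit_cell_sym: "v \<in> unit_cell u \<longleftrightarrow> u \<in> unit_cell v"
  using floor_eq_iff[of v "\<lfloor>u\<rfloor>"] floor_eq_iff[of u "\<lfloor>v\<rfloor>"] by (auto simp: unit_cell_def)

lemma unit_cell_sets [measurable]: "unit_cell u \<in> sets borel"
  by (simp add: unit_cell_def)

text \<open>The kernel of cell membership is symmetric and has mass 1 in each variable, so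
  integrating over cells first preserves the integral. This adds up estimates made on single
  cells.\<close>

lemma integral_unit_cells:
  fixes h :: "real \<Rightarrow> 'b::{banach, second_countable_topology}"
  assumes h: "integrable lborel h"
  shows "integrable lborel (\<lambda>u. \<integral>v. indicator (unit_cell u) v *\<^sub>R h v \<partial>lborel)"
    and "(\<integral>u. (\<integral>v. indicator (unit_cell u) v *\<^sub>R h v \<partial>lborel) \<partial>lborel) = integral\<^sup>L lborel h"
proof -
  have [measurable]: "h \<in> borel_measurable borel" using borel_measurable_integrable[OF h] by simp
  have m: "(\<lambda>(u, v). indicator (unit_cell u) v *\<^sub>R h v) \<in> borel_measurable (lborel \<Otimes>\<^sub>M lborel)"
    by (simp add: indicator_def unit_cell_def)
  have swap: "indicator (unit_cell u) v = (indicator (unit_cell v) u :: real)" for u v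
    using unit_cell_sym[of u v] by (auto simp: indicator_def)
  have 1: "(\<integral>u. indicator (unit_cell v) u *\<^sub>R x \<partial>lborel) = x" for v and x :: "'c::{banach, second_countable_topology}"
    by (subst integral_scaleR_left) (auto simp: unit_cell_def)
  have "integrable (lborel \<Otimes>\<^sub>M lborel) (\<lambda>(v, u). indicator (unit_cell u) v *\<^sub>R h v)"
  proof (rule lborel_pair.Fubini_integrable)
    show "(\<lambda>(v, u). indicator (unit_cell u) v *\<^sub>R h v) \<in> borel_measurable (lborel \<Otimes>\<^sub>M lborel)"
      by (simp add: indicator_def unit_cell_def)
    have "(\<integral>u. norm (indicator (unit_cell u) v *\<^sub>R h v) \<partial>lborel) = norm (h v)" for v
      using 1[of v "norm (h v)"] unfolding swap[of _ v] by (simp only: norm_scaleR) simp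
    then show "integrable lborel (\<lambda>v. \<integral>u. norm (case (v, u) of (v, u) \<Rightarrow> indicator (unit_cell u) v *\<^sub>R h v) \<partial>lborel)"
      using integrable_norm[OF h] by (simp only: prod.case)
    show "AE v in lborel. integrable lborel (\<lambda>u. case (v, u) of (v, u) \<Rightarrow> indicator (unit_cell u) v *\<^sub>R h v)"
    proof (rule AE_I2)
      fix v
      have "(\<lambda>u. case (v, u) of (v, u) \<Rightarrow> indicator (unit_cell u) v *\<^sub>R h v) = (\<lambda>u. indicator (unit_cell v) u *\<^sub>R h v)"
        using swap by auto
      then show "integrable lborel (\<lambda>u. case (v, u) of (v, u) \<Rightarrow> indicator (unit_cell u) v *\<^sub>R h v)"
        by (auto simp: unit_cell_def intro!: integrable_scaleR_left)
    qed
  qed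
  note i = lborel_pair.integrable_product_swap[OF this]
  show "integrable lborel (\<lambda>u. \<integral>v. indicator (unit_cell u) v *\<^sub>R h v \<partial>lborel)"
    using lborel_pair.integrable_fst'[OF i] by simp
  have "(\<integral>u. (\<integral>v. indicator (unit_cell u) v *\<^sub>R h v \<partial>lborel) \<partial>lborel) =
    (\<integral>v. (\<integral>u. indicator (unit_cell u) v *\<^sub>R h v \<partial>lborel) \<partial>lborel)"
    using lborel_pair.Fubini_integral[of "\<lambda>u v. indicator (unit_cell u) v *\<^sub>R h v"] i by simp
  also have "\<dots> = integral\<^sup>L lborel h"
    by (simp add: swap 1)
  finally show "(\<integral>u. (\<integral>v. indicator (unit_cell u) v *\<^sub>R h v \<partial>lborel) \<partial>lborel) = integral\<^sup>L lborel h" .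
qed

text \<open>The bound of \<open>riemann_sum\<close> leaves an error of order 1 in the centering of the linear statistic; the trapezoidal rule improves it to order \<open>1 / r\<close>.\<close>

lemma trapezoid_cell:
  fixes g g' g'' :: "real \<Rightarrow> real"
  assumes g: "C1L1 g g'" and g': "C1L1 g' g''"
  shows "\<bar>(g (of_int \<lfloor>u\<rfloor>) + g (of_int \<lfloor>u\<rfloor> + 1)) / 2 - (\<integral>v. indicator (unit_cell u) v *\<^sub>R g v \<partial>lborel)\<bar>
    \<le> (\<integral>v. indicator (unit_cell u) v *\<^sub>R \<bar>g'' v\<bar> \<partial>lborel)"
proof -
  note [measurable] = C1L1_meas[OF g] C1L1_meas[OF g']
  define x where "x = real_of_int \<lfloor>u\<rfloor>"
  define E where "E = (\<integral>v. indicator (unit_cell u) v *\<^sub>R \<bar>g'' v\<bar> \<partial>lborel)"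
  have cell: "unit_cell u = {x..<x+1}" by (simp add: unit_cell_def x_def)
  have cl: "(\<integral>v. indicator {x..<x+1} v *\<^sub>R h v \<partial>lborel) = (\<integral>v. indicator {x..x+1} v *\<^sub>R h v \<partial>lborel)"
    if [measurable]: "h \<in> borel_measurable borel" for h :: "real \<Rightarrow> real"
  proof (rule integral_cong_AE)
    show "AE v in lborel. indicator {x..<x+1} v *\<^sub>R h v = indicator {x..x+1} v *\<^sub>R h v"
      using AE_lborel_singleton[of "x+1"] by eventually_elim (auto simp: indicator_def)
  qed measurable
  have c0: "continuous_on S g" "continuous_on S g'" for S using C1L1_cont[OF g] C1L1_cont[OF g'] by auto
  have dg: "(g has_real_derivative g' v) (at v)" for v
    using C1L1_D(1)[OF g] by (simp add: has_real_derivative_iff_has_vector_derivative)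
  have i: "integrable lborel (\<lambda>v. indicator {x..x+1} v *\<^sub>R h v)" if "continuous_on {x..x+1} h" for h :: "real \<Rightarrow> real"
    using borel_integrable_atLeastAtMost'[OF that] by (simp add: set_integrable_def)
  \<comment> \<open>The primitive \<open>(v - x - 1/2) * g v\<close> equals \<open>- g x / 2\<close>
    and \<open>g (x + 1) / 2\<close> at the two ends. So the trapezoid minus the integral of
    \<open>g\<close> is the integral of \<open>(v - x - 1/2) * g' v\<close>.\<close>
  have 1: "(\<integral>v. indicator {x..x+1} v *\<^sub>R (g v + (v - x - 1/2) * g' v) \<partial>lborel) = (g x + g (x + 1)) / 2"
    by (subst integral_FTC_atLeastAtMost[where F = "\<lambda>v. (v - x - 1/2) * g v"])
       (auto intro!: derivative_eq_intros dg DERIV_subset[OF dg] continuous_intros c0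
         simp: field_simps simp flip: has_real_derivative_iff_has_vector_derivative)
  \<comment> \<open>The kernel \<open>v - x - 1/2\<close> has mean 0 on the cell, so the constant
    \<open>g' x\<close> may be subtracted from \<open>g'\<close>; only the variation of
    \<open>g'\<close>, hence \<open>g''\<close>, enters the error.\<close>
  have 2: "(\<integral>v. indicator {x..x+1} v *\<^sub>R ((v - x - 1/2) * g' x) \<partial>lborel) = 0"
    by (subst integral_FTC_atLeastAtMost[where F = "\<lambda>v. (v - x - 1/2)^2 / 2 * g' x"])
       (auto intro!: derivative_eq_intros continuous_intros simp: field_simps power2_eq_square
         simp flip: has_real_derivative_iff_has_vector_derivative)
  have ia: "integrable lborel (\<lambda>v. indicator {x..x+1} v *\<^sub>R (g v + (v - x - 1/2) * g' v))"
    and ib: "integrable lborel (\<lambda>v. indicator {x..x+1} v *\<^sub>R g v)"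
    and ic: "integrable lborel (\<lambda>v. indicator {x..x+1} v *\<^sub>R ((v - x - 1/2) * g' x))"
    by (intro i continuous_intros c0)+
  have 3: "\<bar>g' v - g' x\<bar> \<le> E" if v: "v \<in> {x..<x+1}" for v
  proof -
    have "ennreal \<bar>g' v - g' x\<bar> \<le> (\<integral>\<^sup>+v. indicator (unit_cell u) v * ennreal (norm (g'' v)) \<partial>lborel)"
      using C1L1_diff_le[OF g', of x v "unit_cell u"] v unfolding cell by fastforce
    also have "\<dots> = (\<integral>\<^sup>+v. ennreal (indicator (unit_cell u) v *\<^sub>R \<bar>g'' v\<bar>) \<partial>lborel)"
      by (intro nn_integral_cong) (auto simp: indicator_def)
    also have "\<dots> = ennreal E"
      unfolding E_def using C1L1_D(4)[OF g']
      by (intro nn_integral_eq_integral integrable_mult_indicator integrable_abs) auto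
    finally show ?thesis by (simp add: E_def)
  qed
  have "(g x + g (x + 1)) / 2 - (\<integral>v. indicator (unit_cell u) v *\<^sub>R g v \<partial>lborel) =
    (\<integral>v. indicator {x..x+1} v *\<^sub>R (g v + (v - x - 1/2) * g' v) \<partial>lborel)
    - (\<integral>v. indicator {x..x+1} v *\<^sub>R g v \<partial>lborel)
    - (\<integral>v. indicator {x..x+1} v *\<^sub>R ((v - x - 1/2) * g' x) \<partial>lborel)"
    unfolding 1 2 cell by (subst cl) auto
  also have "\<dots> = (\<integral>v. indicator {x..x+1} v *\<^sub>R (g v + (v - x - 1/2) * g' v) - indicator {x..x+1} v *\<^sub>R g v
       - indicator {x..x+1} v *\<^sub>R ((v - x - 1/2) * g' x) \<partial>lborel)"
    by (subst Bochner_Integration.integral_diff, intro Bochner_Integration.integrable_diff ia ib, rule ic,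
        subst Bochner_Integration.integral_diff, rule ia, rule ib, rule refl)
  also have "\<dots> = (\<integral>v. indicator {x..x+1} v *\<^sub>R ((v - x - 1/2) * (g' v - g' x)) \<partial>lborel)"
    by (intro Bochner_Integration.integral_cong) (auto simp: indicator_def right_diff_distrib)
  also have "\<dots> = (\<integral>v. indicator {x..<x+1} v *\<^sub>R ((v - x - 1/2) * (g' v - g' x)) \<partial>lborel)"
    by (rule cl[symmetric]) measurable
  finally have eq: "(g x + g (x + 1)) / 2 - (\<integral>v. indicator (unit_cell u) v *\<^sub>R g v \<partial>lborel) =
    (\<integral>v. indicator {x..<x+1} v *\<^sub>R ((v - x - 1/2) * (g' v - g' x)) \<partial>lborel)" .
  have "\<bar>\<integral>v. indicator {x..<x+1} v *\<^sub>R ((v - x - 1/2) * (g' v - g' x)) \<partial>lborel\<bar> \<le>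
    (\<integral>v. indicator {x..<x+1} v *\<^sub>R E \<partial>lborel)"
  proof (subst real_norm_def[symmetric], rule Bochner_Integration.integral_norm_bound_integral)
    have "integrable lborel (\<lambda>v. indicator {x..<x+1} v *\<^sub>R (indicator {x..x+1} v *\<^sub>R ((v - x - 1/2) * (g' v - g' x))))"
      by (intro integrable_mult_indicator i continuous_intros c0) auto
    moreover have "indicator {x..<x+1} v *\<^sub>R (indicator {x..x+1} v *\<^sub>R ((v - x - 1/2) * (g' v - g' x))) =
       indicator {x..<x+1} v *\<^sub>R ((v - x - 1/2) * (g' v - g' x))" for v
      by (auto simp: indicator_def)
    ultimately show "integrable lborel (\<lambda>v. indicator {x..<x+1} v *\<^sub>R ((v - x - 1/2) * (g' v - g' x)))"
      by (simp only:)
    show "integrable lborel (\<lambda>v. indicator {x..<x+1} v *\<^sub>R E)"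
      by (intro integrable_scaleR_left) auto
    fix v
    have "\<bar>(v - x - 1/2) * (g' v - g' x)\<bar> \<le> E" if "v \<in> {x..<x+1}"
    proof -
      have "\<bar>(v - x - 1/2) * (g' v - g' x)\<bar> \<le> 1 * \<bar>g' v - g' x\<bar>"
        unfolding abs_mult by (intro mult_right_mono) (use that in \<open>auto simp: abs_if\<close>)
      with 3[OF that] show ?thesis by simp
    qed
    then show "norm (indicator {x..<x+1} v *\<^sub>R ((v - x - 1/2) * (g' v - g' x))) \<le> indicator {x..<x+1} v *\<^sub>R E"
      by (auto simp: indicator_def)
  qed
  also have "\<dots> = E" by simp
  finally show ?thesis unfolding E_def[symmetric] x_def[symmetric] eq .
qed

lemma trapezoid_sum:
  fixes g g' g'' :: "real \<Rightarrow> real"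
  assumes g: "C1L1 g g'" and g': "C1L1 g' g''"
  shows "\<bar>(\<integral>x. g (of_int (x::int)) \<partial>count_space UNIV) - integral\<^sup>L lborel g\<bar> \<le> (\<integral>v. \<bar>g'' v\<bar> \<partial>lborel)"
proof -
  have i0: "integrable lborel (\<lambda>u. g (of_int \<lfloor>u::real\<rfloor>))"
    using sum_int_approx(1)[OF g] integral_lborel_floor(2)[of "\<lambda>x. g (of_int x)"] by simp
  have i1: "integrable lborel (\<lambda>u. g (of_int \<lfloor>u::real\<rfloor> + 1))"
    using lborel_integrable_real_affine[OF i0 one_neq_zero, of 1] by (simp add: add.commute)
  \<comment> \<open>Left and right end points give the same sum, so over the whole line the
    trapezoidal sum is the plain Riemann sum.\<close>
  have s: "(\<integral>u. g (of_int \<lfloor>u::real\<rfloor> + 1) \<partial>lborel) = (\<integral>u. g (of_int \<lfloor>u::real\<rfloor>) \<partial>lborel)"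
    using lborel_integral_shift[of "\<lambda>u. g (of_int \<lfloor>u::real\<rfloor>)" 1] by simp
  note c = integral_unit_cells[OF C1L1_D(3)[OF g]]
  note c2 = integral_unit_cells[OF integrable_abs[OF C1L1_D(4)[OF g']]]
  have "(\<integral>x. g (of_int (x::int)) \<partial>count_space UNIV) - integral\<^sup>L lborel g =
    (\<integral>u. (g (of_int \<lfloor>u::real\<rfloor>) + g (of_int \<lfloor>u\<rfloor> + 1)) / 2 - (\<integral>v. indicator (unit_cell u) v *\<^sub>R g v \<partial>lborel) \<partial>lborel)" (is "_ = ?X")
    unfolding integral_lborel_floor(1) using i0 i1 c s
    by (subst Bochner_Integration.integral_diff) auto
  also have "norm ?X \<le> (\<integral>u. (\<integral>v. indicator (unit_cell u) v *\<^sub>R \<bar>g'' v\<bar> \<partial>lborel) \<partial>lborel)"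
    by (rule Bochner_Integration.integral_norm_bound_integral)
       (use i0 i1 c(1) c2(1) trapezoid_cell[OF g g'] in \<open>auto\<close>)
  finally show ?thesis using c2(2) by simp
qed

lemma C1L1_scaleR: "C1L1 g g' \<Longrightarrow> C1L1 (\<lambda>u. a *\<^sub>R g u) (\<lambda>u. a *\<^sub>R g' u)"
  unfolding C1L1_def
  by (auto intro!: continuous_on_scaleR has_vector_derivative_scaleR[THEN has_vector_derivative_eq_rhs])

text \<open>Two derivatives of the dilated function cost \<open>1 / r\<^sup>2\<close>, and
  integration gives back one factor \<open>r\<close>.\<close>

lemma trapezoid_sum_scaled:
  fixes f f' f'' :: "real \<Rightarrow> real"
  assumes f: "C1L1 f f'" and f': "C1L1 f' f''" and r: "r > 0"
  shows "\<bar>(\<integral>x. f (of_int (x::int) / r) \<partial>count_space UNIV) - r * integral\<^sup>L lborel f\<bar> \<le> (\<integral>v. \<bar>f'' v\<bar> \<partial>lborel) / r"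
proof -
  have "(\<integral>u. \<bar>(1/r) *\<^sub>R (1 / r) *\<^sub>R f'' (u / r)\<bar> \<partial>lborel) = (1/r) * (\<integral>u. \<bar>(1 / r) *\<^sub>R f'' (u / r)\<bar> \<partial>lborel)"
    using r by (simp add: abs_mult)
  also have "\<dots> = (1/r) * (\<integral>u. \<bar>f'' u\<bar> \<partial>lborel)"
    using C1L1_scale(4)[OF f' r] by simp
  finally show ?thesis
    using trapezoid_sum[OF C1L1_scale(1)[OF f r] C1L1_scaleR[OF C1L1_scale(1)[OF f' r]]]
    unfolding C1L1_scale(2)[OF f r] by simp
qed

section \<open>Increments of a smooth profile\<close>

text \<open>The size of an increment of a function that is both Lipschitz and bounded. Unlike
  \<open>\<bar>y\<bar>\<close> it is integrable under every noise law, and its square is comparable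
  to the weight \<open>y\<^sup>2 / (1 + y\<^sup>2)\<close>.\<close>

definition kap :: "real \<Rightarrow> real" where "kap y = min 1 \<bar>y\<bar>"

lemma kap_bounds: "0 \<le> kap y" "kap y \<le> 1" "kap y \<le> \<bar>y\<bar>"
  by (auto simp: kap_def)

lemma kap_measurable [measurable]: "kap \<in> borel_measurable borel"
  unfolding kap_def[abs_def] by measurable

lemma kap_square_le: "(kap y)\<^sup>2 \<le> 2 * (y\<^sup>2 / (1 + y\<^sup>2))"
proof (cases "\<bar>y\<bar> \<le> 1")
  case True
  then have "y\<^sup>2 \<le> 1" by (simp add: abs_square_le_1)
  then have "y\<^sup>2 * (1 + y\<^sup>2) \<le> y\<^sup>2 * 2" by (intro mult_left_mono) auto
  then show ?thesis using True by (simp add: kap_def field_simps add_pos_nonneg)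
next
  case False
  then have "1 \<le> y\<^sup>2" by (metis linorder_le_cases abs_square_le_1 order.trans order_refl one_le_power power2_abs)
  then show ?thesis using False by (simp add: kap_def field_simps add_pos_nonneg)
qed

lemma norm_exp_minus_1_le: "norm (exp w - 1) \<le> norm w * exp (norm w)" for w :: complex
proof -
  have "norm (exp w - 1) \<le> exp \<bar>Re w\<bar> * norm w"
    using Taylor_exp[of w 0] by simp
  also have "\<dots> \<le> exp (norm w) * norm w"
    by (intro mult_right_mono) (auto simp: abs_Re_le_cmod)
  finally show ?thesis by (simp add: mult.commute)
qed

lemma norm_exp_minus_2_le: "norm (exp w - 1 - w) \<le> (norm w)\<^sup>2 * exp (norm w)" for w :: complex
proof -
  have "norm (exp w - 1 - w) \<le> exp \<bar>Re w\<bar> * (norm w)\<^sup>2"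
    using Taylor_exp[of w 1] by (simp add: numeral_2_eq_2 algebra_simps)
  also have "\<dots> \<le> exp (norm w) * (norm w)\<^sup>2"
    by (intro mult_right_mono) (auto simp: abs_Re_le_cmod)
  finally show ?thesis by (simp add: mult.commute)
qed

locale C2_profile =
  fixes f f' f'' :: "real \<Rightarrow> real" and F :: real
  assumes f: "C1L1 f f'" and f': "C1L1 f' f''"
    and f_le: "\<And>u. \<bar>f u\<bar> \<le> F" and f'_le: "\<And>u. \<bar>f' u\<bar> \<le> F"
begin

lemma f_meas [measurable]: "f \<in> borel_measurable borel" "f' \<in> borel_measurable borel" "f'' \<in> borel_measurable borel"
  using C1L1_meas[OF f] C1L1_meas[OF f'] by auto

definition d :: "real \<Rightarrow> real \<Rightarrow> real" where "d y u = f (u + y) - f u"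
definition d' :: "real \<Rightarrow> real \<Rightarrow> real" where "d' y u = f' (u + y) - f' u"
text \<open>A single constant for all bounds on increments; the factor 2 is the triangle inequality
  for a difference of two values.\<close>

definition K :: real where
  "K = 2 * (F + (\<integral>u. \<bar>f u\<bar> \<partial>lborel) + (\<integral>u. \<bar>f' u\<bar> \<partial>lborel) + (\<integral>u. \<bar>f'' u\<bar> \<partial>lborel))"
text \<open>The constant in \<open>norm (exp w - 1) \<le> norm w * exp (norm w)\<close> for
  \<open>w = z * of_real (d y u)\<close>, since increments of \<open>f\<close> are at most
  \<open>2 * F\<close>.\<close>

definition E :: "complex \<Rightarrow> real" where "E z = norm z * exp (norm z * (2 * F))"
definition G :: "complex \<Rightarrow> real \<Rightarrow> real \<Rightarrow> complex" where "G z y u = exp (z * of_real (d y u)) - 1"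
definition H :: "complex \<Rightarrow> real \<Rightarrow> complex" where "H z y = integral\<^sup>L lborel (G z y)"

lemma profile_meas [measurable]:
  "d y \<in> borel_measurable borel" "d' y \<in> borel_measurable borel" "G z y \<in> borel_measurable borel"
  "(\<lambda>y. d y u) \<in> borel_measurable borel" "(\<lambda>y. G z y u) \<in> borel_measurable borel"
  "case_prod (G z) \<in> borel_measurable (borel \<Otimes>\<^sub>M borel)"
  unfolding d_def[abs_def] d'_def[abs_def] G_def[abs_def] by measurable

lemma F_nonneg: "0 \<le> F" using f_le[of 0] by linarith

lemma K_ge: "0 \<le> K" "2 * F \<le> K" "2 * (\<integral>u. \<bar>f u\<bar> \<partial>lborel) \<le> K" "2 * (\<integral>u. \<bar>f' u\<bar> \<partial>lborel) \<le> K"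
  "(\<integral>u. \<bar>f' u\<bar> \<partial>lborel) \<le> K" "(\<integral>u. \<bar>f'' u\<bar> \<partial>lborel) \<le> K" "F \<le> K"
proof -
  have "0 \<le> (\<integral>u. \<bar>f u\<bar> \<partial>lborel)" "0 \<le> (\<integral>u. \<bar>f' u\<bar> \<partial>lborel)" "0 \<le> (\<integral>u. \<bar>f'' u\<bar> \<partial>lborel)" by simp_all
  then show "0 \<le> K" "2 * F \<le> K" "2 * (\<integral>u. \<bar>f u\<bar> \<partial>lborel) \<le> K" "2 * (\<integral>u. \<bar>f' u\<bar> \<partial>lborel) \<le> K"
    "(\<integral>u. \<bar>f' u\<bar> \<partial>lborel) \<le> K" "(\<integral>u. \<bar>f'' u\<bar> \<partial>lborel) \<le> K" "F \<le> K"
    using F_nonneg unfolding K_def by (simp_all)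
qed

lemma le_kap: "x \<le> K \<Longrightarrow> x \<le> \<bar>y\<bar> * a \<Longrightarrow> a \<le> K \<Longrightarrow> x \<le> K * kap y"
  using mult_left_mono[of a K "\<bar>y\<bar>"] by (auto simp: kap_def min_def mult.commute)

lemma d_lipschitz: "\<bar>f v - f u\<bar> \<le> F * \<bar>v - u\<bar>"
proof -
  have "norm (f v - f u) \<le> F * norm (v - u)"
    using C1L1_D(1)[OF f] f'_le
    by (intro field_differentiable_bound[of UNIV f f'])
       (auto simp: has_real_derivative_iff_has_vector_derivative)
  then show ?thesis by simp
qed

lemma d_le: "\<bar>d y u\<bar> \<le> K * kap y" "\<bar>d y u\<bar> \<le> 2 * F"
proof -
  show *: "\<bar>d y u\<bar> \<le> 2 * F" using f_le[of "u + y"] f_le[of u] unfolding d_def by linarith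
  show "\<bar>d y u\<bar> \<le> K * kap y"
    using d_lipschitz[of "u + y" u] K_ge * by (intro le_kap[of _ _ F]) (auto simp: d_def mult.commute)
qed

lemma d_C1L1: "C1L1 (d y) (d' y)"
  unfolding d_def[abs_def] d'_def[abs_def] by (intro C1L1_diff C1L1_shift f)

lemma int_d_le:
  "(\<integral>u. \<bar>d y u\<bar> \<partial>lborel) \<le> K * kap y" "(\<integral>u. \<bar>d' y u\<bar> \<partial>lborel) \<le> K * kap y"
  using L1_modulus[OF f, of y] L1_modulus[OF f', of y] K_ge
  by (auto intro!: le_kap simp: d_def d'_def)

lemma int_d_eq_0: "integral\<^sup>L lborel (d y) = 0"
  using C1L1_D(3)[OF f] C1L1_D(3)[OF C1L1_shift[OF f, of y]] lborel_integral_shift[of f y]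
  by (simp add: d_def[abs_def])

lemma norm_zd_le: "norm (z * of_real (d y u)) \<le> norm z * (2 * F)" for z :: complex
  using mult_left_mono[OF d_le(2)[of y u], of "norm z"] by (simp add: norm_mult)

lemma E_nonneg: "0 \<le> E z" by (simp add: E_def)

lemma G_le: "norm (G z y u) \<le> E z * \<bar>d y u\<bar>"
proof -
  have "norm (G z y u) \<le> norm (z * of_real (d y u)) * exp (norm (z * of_real (d y u)))"
    unfolding G_def by (rule norm_exp_minus_1_le)
  also have "\<dots> \<le> (norm z * \<bar>d y u\<bar>) * exp (norm z * (2 * F))"
    using norm_zd_le[of z y u] by (intro mult_mono) (auto simp: norm_mult)
  finally show ?thesis by (simp add: E_def mult_ac)
qed

lemma G_le_kap: "norm (G z y u) \<le> E z * K * kap y"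
  using G_le[of z y u] mult_left_mono[OF d_le(1)[of y u] E_nonneg[of z]] by (simp add: mult.assoc)

lemma G_second_order: "norm (G z y u - z * of_real (d y u)) \<le> norm z * E z * (d y u)\<^sup>2"
proof -
  have "norm (G z y u - z * of_real (d y u)) \<le> (norm (z * of_real (d y u)))\<^sup>2 * exp (norm (z * of_real (d y u)))"
    unfolding G_def by (rule norm_exp_minus_2_le)
  also have "\<dots> \<le> ((norm z)\<^sup>2 * (d y u)\<^sup>2) * exp (norm z * (2 * F))"
    using norm_zd_le[of z y u] by (intro mult_mono) (auto simp: norm_mult power_mult_distrib)
  finally show ?thesis by (simp add: E_def mult_ac power2_eq_square)
qed

lemma G_C1L1: "C1L1 (G z y) (\<lambda>u. z * of_real (d' y u) * exp (z * of_real (d y u)))"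
  and G'_le: "norm (z * of_real (d' y u) * exp (z * of_real (d y u))) \<le> E z * \<bar>d' y u\<bar>"
proof -
  show le: "norm (z * of_real (d' y u) * exp (z * of_real (d y u))) \<le> E z * \<bar>d' y u\<bar>" for u
  proof -
    have "norm (exp (z * of_real (d y u))) \<le> exp (norm (z * of_real (d y u)))" by (rule norm_exp)
    also have "\<dots> \<le> exp (norm z * (2 * F))" using norm_zd_le[of z y u] by simp
    finally show ?thesis
      by (simp add: E_def norm_mult mult_left_mono mult_ac)
  qed
  note D = d_C1L1[of y]
  have der: "(G z y has_vector_derivative z * of_real (d' y u) * exp (z * of_real (d y u))) (at u)" for u
  proof -
    have "((\<lambda>w. exp (z * w) - 1) has_field_derivative z * exp (z * of_real (d y u))) (at (of_real (d y u)))"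
      by (auto intro!: derivative_eq_intros)
    from field_vector_diff_chain_at[OF has_vector_derivative_of_real[OF C1L1_D(1)[OF D, folded has_real_derivative_iff_has_vector_derivative]] this]
    show ?thesis by (simp add: G_def[abs_def] o_def mult_ac)
  qed
  have cont: "continuous_on UNIV (\<lambda>u. z * of_real (d' y u) * exp (z * of_real (d y u)))"
    using C1L1_cont[OF D] C1L1_D(2)[OF D] by (intro continuous_intros)
  have i: "integrable lborel (\<lambda>u. E z * \<bar>d y u\<bar>)" "integrable lborel (\<lambda>u. E z * \<bar>d' y u\<bar>)"
    using C1L1_D(3,4)[OF D] by auto
  have "integrable lborel (G z y)"
    by (rule Bochner_Integration.integrable_bound[OF i(1)]) (simp, use G_le[of z y] E_nonneg[of z] in simp)
  moreover have "integrable lborel (\<lambda>u. z * of_real (d' y u) * exp (z * of_real (d y u)))"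
    by (rule Bochner_Integration.integrable_bound[OF i(2)]) (simp, use le E_nonneg[of z] in simp)
  ultimately show "C1L1 (G z y) (\<lambda>u. z * of_real (d' y u) * exp (z * of_real (d y u)))"
    using der cont unfolding C1L1_def by blast
qed

lemma int_G_le: "(\<integral>u. norm (G z y u) \<partial>lborel) \<le> E z * K * kap y"
  and int_G'_le: "(\<integral>u. norm (z * of_real (d' y u) * exp (z * of_real (d y u))) \<partial>lborel) \<le> E z * K * kap y"
proof -
  have "(\<integral>u. norm (G z y u) \<partial>lborel) \<le> (\<integral>u. E z * \<bar>d y u\<bar> \<partial>lborel)"
    using C1L1_D(3)[OF G_C1L1[of z y]] C1L1_D(3)[OF d_C1L1[of y]] G_le[of z y] by (intro integral_mono) auto
  also have "\<dots> \<le> E z * (K * kap y)" using int_d_le(1)[of y] E_nonneg[of z] by (simp add: mult_left_mono)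
  finally show "(\<integral>u. norm (G z y u) \<partial>lborel) \<le> E z * K * kap y" by (simp add: mult.assoc)
  have "(\<integral>u. norm (z * of_real (d' y u) * exp (z * of_real (d y u))) \<partial>lborel) \<le> (\<integral>u. E z * \<bar>d' y u\<bar> \<partial>lborel)"
    using C1L1_D(4)[OF G_C1L1[of z y]] C1L1_D(4)[OF d_C1L1[of y]] G'_le[of z y] by (intro integral_mono) auto
  also have "\<dots> \<le> E z * (K * kap y)" using int_d_le(2)[of y] E_nonneg[of z] by (simp add: mult_left_mono)
  finally show "(\<integral>u. norm (z * of_real (d' y u) * exp (z * of_real (d y u))) \<partial>lborel) \<le> E z * K * kap y"
    by (simp add: mult.assoc)
qed

text \<open>Quadratic in \<open>y\<close> near 0, because the linear term integrates to 0 by translation invariance.\<close>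

lemma H_le: "norm (H z y) \<le> norm z * E z * K\<^sup>2 * (kap y)\<^sup>2"
proof -
  note D = d_C1L1[of y]
  have i: "integrable lborel (\<lambda>u. z * of_real (d y u))" using C1L1_D(3)[OF D] by simp
  have "H z y = (\<integral>u. G z y u - z * of_real (d y u) \<partial>lborel)"
    using C1L1_D(3)[OF G_C1L1] i int_d_eq_0[of y] by (simp add: H_def)
  also have "norm \<dots> \<le> (\<integral>u. norm z * E z * (K * kap y) * \<bar>d y u\<bar> \<partial>lborel)"
  proof (rule Bochner_Integration.integral_norm_bound_integral)
    show "integrable lborel (\<lambda>u. G z y u - z * of_real (d y u))" using C1L1_D(3)[OF G_C1L1] i by simp
    show "integrable lborel (\<lambda>u. norm z * E z * (K * kap y) * \<bar>d y u\<bar>)" using C1L1_D(3)[OF D] by simp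
    fix u
    have "norm z * E z * (d y u)\<^sup>2 = norm z * E z * (\<bar>d y u\<bar> * \<bar>d y u\<bar>)" by (simp add: power2_eq_square)
    also have "\<dots> \<le> norm z * E z * ((K * kap y) * \<bar>d y u\<bar>)"
      using d_le(1)[of y u] E_nonneg[of z] by (intro mult_left_mono mult_right_mono) auto
    finally show "norm (G z y u - z * of_real (d y u)) \<le> norm z * E z * (K * kap y) * \<bar>d y u\<bar>"
      using G_second_order[of z y u] by (simp add: mult.assoc)
  qed
  also have "\<dots> = norm z * E z * (K * kap y) * (\<integral>u. \<bar>d y u\<bar> \<partial>lborel)" by simp
  also have "\<dots> \<le> norm z * E z * (K * kap y) * (K * kap y)"
    using int_d_le(1)[of y] E_nonneg[of z] K_ge(1) kap_bounds(1)[of y] by (intro mult_left_mono) auto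
  finally show ?thesis by (simp add: power2_eq_square mult_ac)
qed

text \<open>Increments are additive: moving by \<open>y\<close> is moving by \<open>y'\<close> and
  then by \<open>y - y'\<close>. The exponential factorizes accordingly, which reduces the
  difference to one increment by \<open>y - y'\<close>. The resulting continuity of
  \<open>H z\<close> is what weak convergence requires.\<close>

lemma H_lipschitz: "norm (H z y - H z y') \<le> E z * exp (norm z * (2 * F)) * K * \<bar>y - y'\<bar>"
proof -
  define c where "c = exp (norm z * (2 * F))"
  have le: "norm (G z y u - G z y' u) \<le> E z * c * \<bar>d (y - y') (u + y')\<bar>" for u
  proof -
    have "d y u = d (y - y') (u + y') + d y' u" by (simp add: d_def)
    then have "exp (z * of_real (d y u)) = exp (z * of_real (d (y - y') (u + y'))) * exp (z * of_real (d y' u))"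
      by (simp add: ring_distribs exp_add)
    then have "G z y u - G z y' u = G z (y - y') (u + y') * exp (z * of_real (d y' u))"
      by (simp add: G_def algebra_simps)
    moreover have "norm (exp (z * of_real (d y' u))) \<le> c"
      unfolding c_def by (rule order_trans[OF norm_exp]) (use norm_zd_le[of z y' u] in simp)
    ultimately show ?thesis
      using G_le[of z "y - y'" "u + y'"] mult_mono[of "norm (G z (y - y') (u + y'))" "E z * \<bar>d (y - y') (u + y')\<bar>" "norm (exp (z * of_real (d y' u)))" c] E_nonneg[of z]
      by (simp add: norm_mult mult_ac)
  qed
  have i: "integrable lborel (\<lambda>u. d (y - y') (u + y'))"
    using C1L1_D(3)[OF C1L1_shift[OF d_C1L1]] .
  have "H z y - H z y' = (\<integral>u. G z y u - G z y' u \<partial>lborel)"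
    using C1L1_D(3)[OF G_C1L1] by (simp add: H_def)
  also have "norm \<dots> \<le> (\<integral>u. E z * c * \<bar>d (y - y') (u + y')\<bar> \<partial>lborel)"
    using C1L1_D(3)[OF G_C1L1[of z y]] C1L1_D(3)[OF G_C1L1[of z y']] i le by (intro Bochner_Integration.integral_norm_bound_integral) auto
  also have "\<dots> = E z * c * (\<integral>u. \<bar>d (y - y') u\<bar> \<partial>lborel)"
    using lborel_integral_shift[of "\<lambda>u. \<bar>d (y - y') u\<bar>" y'] by simp
  also have "\<dots> \<le> E z * c * (K * \<bar>y - y'\<bar>)"
    using order_trans[OF int_d_le(1)[of "y - y'"] mult_left_mono[OF kap_bounds(3)[of "y - y'"] K_ge(1)]] E_nonneg[of z]
    by (intro mult_left_mono) (simp_all add: c_def)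
  finally show ?thesis by (simp add: c_def mult_ac)
qed

lemma H_cont: "continuous_on UNIV (H z)"
proof -
  have "(E z * exp (norm z * (2 * F)) * K)-lipschitz_on UNIV (H z)"
    using H_lipschitz[of z] E_nonneg[of z] K_ge(1) by (intro lipschitz_onI) (simp_all add: dist_norm)
  then show ?thesis by (rule lipschitz_on_continuous_on)
qed

lemma H_meas [measurable]: "H z \<in> borel_measurable borel"
  using H_cont by (rule borel_measurable_continuous_onI)

text \<open>The Riemann error does not grow with \<open>r\<close> and keeps the factor
  \<open>kap y\<close>, so it disappears once averaged over the noise. The condition
  \<open>r \<ge> 1\<close> absorbs the bounded error of the third estimate into its main
  term.\<close>

lemma sum_G:
  assumes r: "r \<ge> 1"
  shows "integrable (count_space UNIV) (\<lambda>x::int. G z y (of_int x / r))"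
    and "norm ((\<integral>x. G z y (of_int (x::int) / r) \<partial>count_space UNIV) - r *\<^sub>R H z y) \<le> E z * K * kap y"
    and "(\<integral>x. norm (G z y (of_int (x::int) / r)) \<partial>count_space UNIV) \<le> 2 * E z * K * r * kap y"
proof -
  have r0: "r > 0" using r by simp
  note R = riemann_sum[OF G_C1L1[of z y] r0]
  show "integrable (count_space UNIV) (\<lambda>x::int. G z y (of_int x / r))" by (rule R)
  show "norm ((\<integral>x. G z y (of_int (x::int) / r) \<partial>count_space UNIV) - r *\<^sub>R H z y) \<le> E z * K * kap y"
    using R(2) int_G'_le[of z y] unfolding H_def by linarith
  have "(\<integral>x. norm (G z y (of_int (x::int) / r)) \<partial>count_space UNIV) \<le> r * (E z * K * kap y) + E z * K * kap y"
    using R(3) int_G'_le[of z y] mult_left_mono[OF int_G_le[of z y], of r] r0 by linarith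
  also have "\<dots> \<le> r * (E z * K * kap y) + r * (E z * K * kap y)"
  proof -
    have "0 \<le> E z * K * kap y" by (intro mult_nonneg_nonneg E_nonneg K_ge(1) kap_bounds(1))
    from mult_right_mono[OF r this] show ?thesis by linarith
  qed
  finally show "(\<integral>x. norm (G z y (of_int (x::int) / r)) \<partial>count_space UNIV) \<le> 2 * E z * K * r * kap y"
    by (simp add: mult_ac)
qed

end

section \<open>The Cauchy distribution\<close>

definition cauchy_density :: "real \<Rightarrow> real" where "cauchy_density x = 1 / (pi * (1 + x\<^sup>2))"

definition cauchy :: "real measure" where "cauchy = density lborel cauchy_density"

lemma cauchy_density_meas [measurable]: "cauchy_density \<in> borel_measurable borel"
  unfolding cauchy_density_def[abs_def] by measurable

lemma cauchy_density_pos: "0 < cauchy_density x"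
  by (simp add: cauchy_density_def add_pos_nonneg)

lemma integrable_inverse_1_plus_square': "integrable lborel (\<lambda>x::real. 1 / (1 + x\<^sup>2))"
  and integral_cauchy_density: "integral\<^sup>L lborel cauchy_density = 1"
proof -
  show "integrable lborel (\<lambda>x::real. 1 / (1 + x\<^sup>2))"
    using integrable_inverse_1_plus_square by (simp add: set_integrable_def inverse_eq_divide)
  have "(\<integral>x. 1 / (1 + x\<^sup>2) \<partial>lborel) = pi"
    using LBINT_inverse_1_plus_square
    by (simp add: interval_lebesgue_integral_def set_lebesgue_integral_def inverse_eq_divide)
  moreover have "integral\<^sup>L lborel cauchy_density = (\<integral>x. (1 / pi) * (1 / (1 + x\<^sup>2)) \<partial>lborel)"
    by (intro Bochner_Integration.integral_cong) (auto simp: cauchy_density_def)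
  ultimately show "integral\<^sup>L lborel cauchy_density = 1"
    unfolding integral_mult_right_zero by simp
qed

lemma integrable_cauchy_density: "integrable lborel cauchy_density"
  using integral_cauchy_density not_integrable_integral_eq by fastforce

lemma real_distribution_cauchy: "real_distribution cauchy"
proof -
  have "emeasure cauchy UNIV = (\<integral>\<^sup>+x. cauchy_density x \<partial>lborel)"
    by (simp add: cauchy_def emeasure_density)
  also have "\<dots> = 1"
    using integrable_cauchy_density less_imp_le[OF cauchy_density_pos] integral_cauchy_density
    by (subst nn_integral_eq_integral) auto
  finally have "emeasure cauchy UNIV = 1" .
  then show ?thesis
    unfolding real_distribution_def real_distribution_axioms_def
    by (auto intro!: prob_spaceI simp: cauchy_def)
qed

section \<open>Fourier analysis of the Laplace density\<close>

lemma has_bochner_integral_FTC_atLeast_0: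
  fixes f F :: "real \<Rightarrow> real"
  assumes [measurable]: "f \<in> borel_measurable borel"
    and f: "\<And>x. 0 \<le> x \<Longrightarrow> DERIV F x :> f x" and nonneg: "\<And>x. 0 \<le> x \<Longrightarrow> 0 \<le> f x"
    and lim: "(F \<longlongrightarrow> T) at_top"
  shows "has_bochner_integral lborel (\<lambda>x. indicator {0..} x *\<^sub>R f x) (T - F 0)"
proof (rule has_bochner_integral_nn_integral)
  have "F 0 \<le> T"
  proof (rule tendsto_lowerbound[OF lim])
    show "\<forall>\<^sub>F x in at_top. F 0 \<le> F x"
      using eventually_ge_at_top[of 0]
    proof eventually_elim
      case (elim x)
      then show ?case using f nonneg by (intro DERIV_nonneg_imp_nondecreasing[of 0 x F]) blast+
    qed
  qed simp
  then show "0 \<le> T - F 0" by simp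
  have "(\<integral>\<^sup>+x. ennreal (indicator {0..} x *\<^sub>R f x) \<partial>lborel) = (\<integral>\<^sup>+x. ennreal (f x) * indicator {0..} x \<partial>lborel)"
    by (intro nn_integral_cong) (auto simp: indicator_def)
  also have "\<dots> = ennreal (T - F 0)"
    by (rule nn_integral_FTC_atLeast[OF assms(1) f nonneg lim])
  finally show "(\<integral>\<^sup>+x. ennreal (indicator {0..} x *\<^sub>R f x) \<partial>lborel) = ennreal (T - F 0)" .
qed (auto simp: nonneg indicator_def)

text \<open>Its Fourier transform is \<open>1 / (1 + y\<^sup>2)\<close>. Inversion of this gives the
  characteristic function of the Cauchy distribution, and averaging \<open>1 - iexp (w * y)\<close>
  against the density gives the weight \<open>y\<^sup>2 / (1 + y\<^sup>2)\<close>.\<close>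

definition laplace_density :: "real \<Rightarrow> real" where "laplace_density w = exp (- \<bar>w\<bar>) / 2"

lemma laplace_density_meas [measurable]: "laplace_density \<in> borel_measurable borel"
  unfolding laplace_density_def[abs_def] by measurable

lemma tendsto_exp_neg_at_top: "((\<lambda>x::real. exp (- x)) \<longlongrightarrow> 0) at_top"
  by (rule filterlim_compose[OF exp_at_bot filterlim_uminus_at_bot_at_top])

lemma laplace_moment_0: "has_bochner_integral lborel laplace_density 1"
proof -
  have "has_bochner_integral lborel (\<lambda>x::real. indicator {0..} x *\<^sub>R (exp (-x) / 2)) (0 - (- exp (-0) / 2))"
  proof (rule has_bochner_integral_FTC_atLeast_0)
    show "((\<lambda>x::real. - exp (-x) / 2) \<longlongrightarrow> 0) at_top"
      using tendsto_divide[OF tendsto_minus[OF tendsto_exp_neg_at_top] tendsto_const[of 2]] by simp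
    show "DERIV (\<lambda>x::real. - exp (-x) / 2) x :> exp (-x) / 2" for x
      by (auto intro!: derivative_eq_intros)
  qed auto
  also have "(\<lambda>x::real. indicator {0..} x *\<^sub>R (exp (-x) / 2)) = (\<lambda>x. indicator {0..} x *\<^sub>R laplace_density x)"
    by (auto simp: fun_eq_iff indicator_def laplace_density_def)
  finally have "has_bochner_integral lborel laplace_density (2 *\<^sub>R (0 - (- exp (-0) / 2)))"
    by (rule has_bochner_integral_even_function) (simp add: laplace_density_def)
  then show ?thesis by simp
qed

lemma laplace_cos: "has_bochner_integral lborel (\<lambda>w. laplace_density w * cos (y * w)) (1 / (1 + y\<^sup>2))"
proof -
  \<comment> \<open>A primitive of \<open>exp (-w) / 2 * (1 + cos (y * w))\<close> that vanishes at
    infinity; the second term comes from integrating by parts twice.\<close>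
  define F where "F w = - exp (-w) / 2 + exp (-w) * (y * sin (y * w) - cos (y * w)) / (2 * (1 + y\<^sup>2))" for w
  have p: "1 + y\<^sup>2 > 0" by (simp add: add_pos_nonneg)
  have "((\<lambda>w. exp (-w) * (y * sin (y * w) - cos (y * w))) \<longlongrightarrow> 0) at_top"
  proof (rule Lim_null_comparison)
    show "((\<lambda>w. exp (-w) * (\<bar>y\<bar> + 1)) \<longlongrightarrow> 0) at_top"
      by (rule tendsto_mult_left_zero[OF tendsto_exp_neg_at_top])
    have "\<bar>y * sin (y * w) - cos (y * w)\<bar> \<le> \<bar>y\<bar> + 1" for w
    proof -
      have "\<bar>y * sin (y * w)\<bar> \<le> \<bar>y\<bar> * 1" unfolding abs_mult by (intro mult_left_mono) auto
      then show ?thesis using abs_cos_le_one[of "y * w"] by linarith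
    qed
    then show "\<forall>\<^sub>F w in at_top. norm (exp (-w) * (y * sin (y * w) - cos (y * w))) \<le> exp (-w) * (\<bar>y\<bar> + 1)"
      by (auto simp: abs_mult)
  qed
  then have "(F \<longlongrightarrow> - 0 / 2 + 0 / (2 * (1 + y\<^sup>2))) at_top"
    unfolding F_def by (intro tendsto_intros tendsto_exp_neg_at_top) (use p in auto)
  then have lim: "(F \<longlongrightarrow> 0) at_top" by simp
  have der: "DERIV F w :> exp (-w) / 2 * (1 + cos (y * w))" for w
  proof -
    have "((\<lambda>w. exp (-w) * (y * sin (y * w) - cos (y * w))) has_real_derivative
        (1 + y\<^sup>2) * (exp (-w) * cos (y * w))) (at w)"
      by (auto intro!: derivative_eq_intros simp: algebra_simps power2_eq_square)
    from DERIV_cdivide[OF this, of "2 * (1 + y\<^sup>2)"]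
    have "((\<lambda>w. exp (-w) * (y * sin (y * w) - cos (y * w)) / (2 * (1 + y\<^sup>2))) has_real_derivative
        exp (-w) * cos (y * w) / 2) (at w)"
      by (rule DERIV_cong) (use p in \<open>simp add: divide_simps\<close>)
    moreover have "((\<lambda>w. - exp (-w) / 2) has_real_derivative exp (-w) / 2) (at w)"
      by (auto intro!: derivative_eq_intros)
    ultimately have "(F has_real_derivative exp (-w) / 2 + exp (-w) * cos (y * w) / 2) (at w)"
      unfolding F_def by (rule DERIV_add[rotated])
    then show ?thesis by (simp add: ring_distribs)
  qed
  \<comment> \<open>\<open>1 + cos\<close> instead of \<open>cos\<close> keeps the integrand nonnegative\<close>
  have nn: "0 \<le> exp (-w) / 2 * (1 + cos (y * w))" for w
  proof (rule mult_nonneg_nonneg)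
    show "0 \<le> 1 + cos (y * w)" using cos_ge_minus_one[of "y * w"] by linarith
  qed simp
  have "has_bochner_integral lborel (\<lambda>w. indicator {0..} w *\<^sub>R (exp (-w) / 2 * (1 + cos (y * w)))) (0 - F 0)"
    by (rule has_bochner_integral_FTC_atLeast_0[OF _ der nn lim]) measurable
  also have "(\<lambda>w. indicator {0..} w *\<^sub>R (exp (-w) / 2 * (1 + cos (y * w)))) =
     (\<lambda>w. indicator {0..} w *\<^sub>R (laplace_density w * (1 + cos (y * w))))"
    by (auto simp: fun_eq_iff indicator_def laplace_density_def)
  finally have "has_bochner_integral lborel (\<lambda>w. laplace_density w * (1 + cos (y * w))) (2 *\<^sub>R (0 - F 0))"
    by (rule has_bochner_integral_even_function) (simp add: laplace_density_def)
  from has_bochner_integral_diff[OF this laplace_moment_0]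
  have "has_bochner_integral lborel (\<lambda>w. laplace_density w * cos (y * w)) (2 *\<^sub>R (0 - F 0) - 1)"
    by (simp add: ring_distribs)
  also have "2 *\<^sub>R (0 - F 0) - 1 = 1 / (1 + y\<^sup>2)" using p by (simp add: F_def field_simps)
  finally show ?thesis .
qed

lemma laplace_fourier:
  "has_bochner_integral lborel (\<lambda>w. laplace_density w *\<^sub>R iexp (y * w)) (of_real (1 / (1 + y\<^sup>2)))"
proof -
  have i: "integrable lborel laplace_density" using laplace_moment_0 by (simp add: has_bochner_integral_iff)
  have "integrable lborel (\<lambda>x. laplace_density x * sin (y * x))"
    by (rule Bochner_Integration.integrable_bound[OF i])
       (auto simp: abs_mult laplace_density_def intro!: mult_left_le)
  then have "integrable lborel (\<lambda>x. indicator {0..} x *\<^sub>R (laplace_density x * sin (y * x)))"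
    by (intro integrable_mult_indicator) auto
  then have s: "has_bochner_integral lborel (\<lambda>w. laplace_density w * sin (y * w)) 0"
    by (intro has_bochner_integral_odd_function[OF has_bochner_integral_integrable])
       (auto simp: laplace_density_def)
  have "(\<lambda>w. laplace_density w *\<^sub>R iexp (y * w)) =
    (\<lambda>w. of_real (laplace_density w * cos (y * w)) + \<i> * of_real (laplace_density w * sin (y * w)))"
    by (auto simp: fun_eq_iff complex_eq_iff Re_exp Im_exp)
  moreover have "has_bochner_integral lborel
    (\<lambda>w. complex_of_real (laplace_density w * cos (y * w)) + \<i> * of_real (laplace_density w * sin (y * w)))
    (of_real (1 / (1 + y\<^sup>2)) + \<i> * of_real 0)"
    by (intro has_bochner_integral_add has_bochner_integral_of_real has_bochner_integral_mult_right laplace_cos s)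
  ultimately show ?thesis by simp
qed

text \<open>This identity makes the Cauchy distribution appear: when the noise has a characteristic
  function linear in \<open>\<bar>t\<bar>\<close> near 0, averaging its increments with the Laplace
  weight produces \<open>exp (- \<bar>t\<bar>)\<close>. Symmetrizing in \<open>w\<close> replaces
  \<open>\<bar>t + w\<bar>\<close> by \<open>max \<bar>t\<bar> \<bar>w\<bar>\<close>, which has an
  explicit primitive on the half-line.\<close>

lemma laplace_abs: "has_bochner_integral lborel (\<lambda>w. laplace_density w * (\<bar>t + w\<bar> - \<bar>t\<bar>)) (exp (- \<bar>t\<bar>))"
proof -
  \<comment> \<open>The constant \<open>exp (- \<bar>t\<bar>)\<close> in the first branch makes the
    two primitives agree at \<open>w = \<bar>t\<bar>\<close>, so that they glue to a differentiable
    function.\<close>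
  define F where "F w = (if w \<in> {..\<bar>t\<bar>} then - (\<bar>t\<bar> * exp (-w) + exp (- \<bar>t\<bar>)) / 2 else - ((w + 1) * exp (-w)) / 2)" for w
  have der: "DERIV F w :> exp (-w) / 2 * max \<bar>t\<bar> w" for w
  proof -
    have 1: "((\<lambda>w. - (\<bar>t\<bar> * exp (-w) + exp (- \<bar>t\<bar>)) / 2) has_real_derivative exp (-w) / 2 * \<bar>t\<bar>) (at w within S)" for w S
      by (auto intro!: derivative_eq_intros)
    have 2: "((\<lambda>w. - ((w + 1) * exp (-w)) / 2) has_real_derivative exp (-w) / 2 * w) (at w within S)" for w S
      by (auto intro!: derivative_eq_intros simp: algebra_simps)
    have "((\<lambda>w. if w \<in> {..\<bar>t\<bar>} then - (\<bar>t\<bar> * exp (-w) + exp (- \<bar>t\<bar>)) / 2 else - ((w + 1) * exp (-w)) / 2)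
      has_vector_derivative (if w \<in> {..\<bar>t\<bar>} then exp (-w) / 2 * \<bar>t\<bar> else exp (-w) / 2 * w)) (at w within UNIV)"
      by (rule has_vector_derivative_If_within_closures[where T = "{\<bar>t\<bar>..}"])
         (use 1 2 in \<open>auto simp: has_real_derivative_iff_has_vector_derivative algebra_simps\<close>)
    moreover have "(\<lambda>w. if w \<in> {..\<bar>t\<bar>} then - (\<bar>t\<bar> * exp (-w) + exp (- \<bar>t\<bar>)) / 2 else - ((w + 1) * exp (-w)) / 2) = F"
      by (simp add: F_def fun_eq_iff)
    moreover have "(if w \<in> {..\<bar>t\<bar>} then exp (-w) / 2 * \<bar>t\<bar> else exp (-w) / 2 * w) = exp (-w) / 2 * max \<bar>t\<bar> w"
      by auto
    ultimately show ?thesis by (simp only: has_real_derivative_iff_has_vector_derivative)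
  qed
  have "((\<lambda>w::real. - ((w + 1) * exp (-w)) / 2) \<longlongrightarrow> 0) at_top"
  proof -
    have "((\<lambda>w::real. - (w ^ 1 / exp w + exp (-w)) / 2) \<longlongrightarrow> - (0 + 0) / 2) at_top"
      by (intro tendsto_intros tendsto_power_div_exp_0 tendsto_exp_neg_at_top) auto
    then show ?thesis by (simp add: field_simps exp_minus)
  qed
  moreover have "\<forall>\<^sub>F w in at_top. - ((w + 1) * exp (-w)) / 2 = F w"
    using eventually_gt_at_top[of "\<bar>t\<bar>"] by eventually_elim (auto simp: F_def)
  ultimately have lim: "(F \<longlongrightarrow> 0) at_top" by (rule Lim_transform_eventually)
  have "has_bochner_integral lborel (\<lambda>w. indicator {0..} w *\<^sub>R (exp (-w) / 2 * max \<bar>t\<bar> w)) (0 - F 0)"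
    by (rule has_bochner_integral_FTC_atLeast_0[OF _ der _ lim]) auto
  also have "(\<lambda>w. indicator {0..} w *\<^sub>R (exp (-w) / 2 * max \<bar>t\<bar> w)) =
     (\<lambda>w. indicator {0..} w *\<^sub>R (laplace_density w * max \<bar>t\<bar> \<bar>w\<bar>))"
    by (auto simp: fun_eq_iff indicator_def laplace_density_def)
  finally have m: "has_bochner_integral lborel (\<lambda>w. laplace_density w * max \<bar>t\<bar> \<bar>w\<bar>) (2 *\<^sub>R (0 - F 0))"
    by (rule has_bochner_integral_even_function) (simp add: laplace_density_def)
  have i: "integrable lborel (\<lambda>w. laplace_density w * \<bar>t + w\<bar>)"
  proof (rule Bochner_Integration.integrable_bound)
    show "integrable lborel (\<lambda>w. 2 * (laplace_density w * max \<bar>t\<bar> \<bar>w\<bar>))"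
      using m by (simp add: has_bochner_integral_iff)
    have "\<bar>t + w\<bar> \<le> 2 * max \<bar>t\<bar> \<bar>w\<bar>" for w by linarith
    then have "laplace_density w * \<bar>t + w\<bar> \<le> laplace_density w * (2 * max \<bar>t\<bar> \<bar>w\<bar>)" for w
      by (intro mult_left_mono) (auto simp: laplace_density_def)
    then show "AE w in lborel. norm (laplace_density w * \<bar>t + w\<bar>) \<le> norm (2 * (laplace_density w * max \<bar>t\<bar> \<bar>w\<bar>))"
      by (auto simp: abs_mult laplace_density_def)
  qed measurable
  have i': "integrable lborel (\<lambda>w. laplace_density w * \<bar>t - w\<bar>)"
    and e: "(\<integral>w. laplace_density w * \<bar>t - w\<bar> \<partial>lborel) = (\<integral>w. laplace_density w * \<bar>t + w\<bar> \<partial>lborel)"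
    using lborel_integrable_real_affine[OF i, of "-1" 0]
      lborel_integral_real_affine[of "-1" "\<lambda>w. laplace_density w * \<bar>t + w\<bar>" 0]
    by (simp_all add: laplace_density_def)
  have "(\<lambda>w. laplace_density w * max \<bar>t\<bar> \<bar>w\<bar>) = (\<lambda>w. (laplace_density w * \<bar>t + w\<bar> + laplace_density w * \<bar>t - w\<bar>) / 2)"
  proof
    fix w
    have "max \<bar>t\<bar> \<bar>w\<bar> = (\<bar>t + w\<bar> + \<bar>t - w\<bar>) / 2"
      by (cases "t \<ge> 0"; cases "w \<ge> 0"; cases "t + w \<ge> 0"; cases "t - w \<ge> 0"; simp add: max_def)
    then show "laplace_density w * max \<bar>t\<bar> \<bar>w\<bar> = (laplace_density w * \<bar>t + w\<bar> + laplace_density w * \<bar>t - w\<bar>) / 2"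
      by (simp only: distrib_left[symmetric] times_divide_eq_right)
  qed
  then have "2 *\<^sub>R (0 - F 0) = (\<integral>w. laplace_density w * \<bar>t + w\<bar> \<partial>lborel)"
    using m i i' e by (simp add: has_bochner_integral_iff)
  also have "2 *\<^sub>R (0 - F 0) = \<bar>t\<bar> + exp (- \<bar>t\<bar>)" by (simp add: F_def field_simps)
  finally have "has_bochner_integral lborel (\<lambda>w. laplace_density w * \<bar>t + w\<bar>) (\<bar>t\<bar> + exp (- \<bar>t\<bar>))"
    using i by (simp add: has_bochner_integral_iff)
  from has_bochner_integral_diff[OF this has_bochner_integral_mult_left[OF laplace_moment_0, of "\<bar>t\<bar>"]]
  show ?thesis by (simp add: right_diff_distrib)
qed

lemma gauss_fourier:
  fixes \<sigma> s :: real
  assumes \<sigma>: "\<sigma> > 0"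
  shows "has_bochner_integral lborel (\<lambda>y. exp (- (\<sigma> * y)\<^sup>2 / 2) *\<^sub>R iexp (s * y))
     (of_real (sqrt (2 * pi) / \<sigma> * exp (- (s / \<sigma>)\<^sup>2 / 2)))"
proof -
  have i: "integrable lborel (\<lambda>x. std_normal_density x *\<^sub>R iexp (u * x))" for u
    by (rule Bochner_Integration.integrable_bound[OF integrable_normal_moment[where k = 0, OF zero_less_one]])
       (auto simp: power_0)
  have "(\<integral>x. std_normal_density x *\<^sub>R iexp (u * x) \<partial>lborel) = of_real (exp (- u\<^sup>2 / 2))" for u
    using fun_cong[OF char_std_normal_distribution, of u]
    by (simp add: char_def integral_density)
  with i have h: "has_bochner_integral lborel (\<lambda>x. std_normal_density x *\<^sub>R iexp (u * x)) (of_real (exp (- u\<^sup>2 / 2)))" for u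
    by (simp add: has_bochner_integral_iff)
  have "has_bochner_integral lborel (\<lambda>x. std_normal_density (0 + \<sigma> * x) *\<^sub>R iexp ((s / \<sigma>) * (0 + \<sigma> * x)))
      (of_real (exp (- (s / \<sigma>)\<^sup>2 / 2)) /\<^sub>R \<bar>\<sigma>\<bar>)"
    using h[of "s / \<sigma>"] \<sigma> lborel_has_bochner_integral_real_affine_iff[of \<sigma>
      "\<lambda>x. std_normal_density x *\<^sub>R iexp ((s / \<sigma>) * x)" _ 0] by blast
  from has_bochner_integral_scaleR_right[OF this, of "sqrt (2 * pi)"]
  show ?thesis using \<sigma>
    by (simp add: normal_density_def scaleR_conv_of_real field_simps)
qed

text \<open>Gaussian regularization: with the damping factor
  \<open>exp (- (\<sigma> n * y)\<^sup>2 / 2)\<close> the double integral converges absolutely, and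
  swapping the integrals turns the damped inverse transform into an average of \<open>g\<close> over
  a normal law of standard deviation \<open>\<sigma> n\<close> centred at \<open>t\<close>.
  Dominated convergence on both sides removes the damping.\<close>

lemma fourier_inversion:
  fixes g :: "real \<Rightarrow> real" and h :: "real \<Rightarrow> complex"
  assumes g: "integrable lborel g" and cont: "continuous_on UNIV g" and bd: "\<And>x. \<bar>g x\<bar> \<le> B"
    and h: "\<And>y. h y = (\<integral>w. g w *\<^sub>R iexp (y * w) \<partial>lborel)" and hi: "integrable lborel h"
  shows "(\<integral>y. h y * iexp (- (y * t)) \<partial>lborel) = of_real (2 * pi * g t)"
proof -
  have [measurable]: "g \<in> borel_measurable borel" "h \<in> borel_measurable borel"
    using cont borel_measurable_integrable[OF hi] by (auto intro: borel_measurable_continuous_onI)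
  define \<sigma> :: "nat \<Rightarrow> real" where "\<sigma> n = 1 / Suc n" for n
  have \<sigma>: "\<sigma> n > 0" for n by (simp add: \<sigma>_def)
  have \<sigma>0: "\<sigma> \<longlonglongrightarrow> 0" unfolding \<sigma>_def by (rule LIMSEQ_Suc[OF lim_1_over_n])
  define A where "A n = (\<integral>y. h y * iexp (- (y * t)) * of_real (exp (- (\<sigma> n * y)\<^sup>2 / 2)) \<partial>lborel)" for n
  have A1: "A \<longlonglongrightarrow> (\<integral>y. h y * iexp (- (y * t)) \<partial>lborel)"
    unfolding A_def
  proof (rule integral_dominated_convergence[where w = "\<lambda>y. norm (h y)"])
    show "AE y in lborel. (\<lambda>n. h y * iexp (- (y * t)) * of_real (exp (- (\<sigma> n * y)\<^sup>2 / 2))) \<longlonglongrightarrow> h y * iexp (- (y * t))"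
    proof (rule AE_I2)
      fix y
      have "(\<lambda>n. h y * iexp (- (y * t)) * of_real (exp (- (\<sigma> n * y)\<^sup>2 / 2))) \<longlonglongrightarrow>
        h y * iexp (- (y * t)) * of_real (exp (- (0 * y)\<^sup>2 / 2))"
        by (intro tendsto_intros \<sigma>0) auto
      then show "(\<lambda>n. h y * iexp (- (y * t)) * of_real (exp (- (\<sigma> n * y)\<^sup>2 / 2))) \<longlonglongrightarrow> h y * iexp (- (y * t))"
        by simp
    qed
  qed (use hi in \<open>auto simp: norm_mult intro!: mult_left_le\<close>)
  have A2: "A n = of_real (2 * pi) * complex_of_real (\<integral>x. (std_normal_density x * g (t + \<sigma> n * x)) \<partial>lborel)" for n
  proof -
    define \<Phi> where "\<Phi> w y = g w *\<^sub>R (exp (- (\<sigma> n * y)\<^sup>2 / 2) *\<^sub>R iexp ((w - t) * y))" for w y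
    have gi: "integrable lborel (\<lambda>y. exp (- (\<sigma> n * y)\<^sup>2 / 2))"
      using integrable_norm[OF integrable.intros[OF gauss_fourier[OF \<sigma>, of n 0]]] by simp
    have ip: "integrable (lborel \<Otimes>\<^sub>M lborel) (case_prod \<Phi>)"
    proof (rule lborel_pair.Fubini_integrable)
      show "case_prod \<Phi> \<in> borel_measurable (lborel \<Otimes>\<^sub>M lborel)"
        unfolding \<Phi>_def[abs_def] by measurable
      have "(\<integral>y. norm (\<Phi> w y) \<partial>lborel) = \<bar>g w\<bar> * (\<integral>y. exp (- (\<sigma> n * y)\<^sup>2 / 2) \<partial>lborel)" for w
        by (simp add: \<Phi>_def abs_mult)
      then show "integrable lborel (\<lambda>w. \<integral>y. norm (case (w, y) of (w, y) \<Rightarrow> \<Phi> w y) \<partial>lborel)"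
        using g by simp
      show "AE w in lborel. integrable lborel (\<lambda>y. case (w, y) of (w, y) \<Rightarrow> \<Phi> w y)"
      proof (rule AE_I2)
        fix w
        have "integrable lborel (\<lambda>y. exp (- (\<sigma> n * y)\<^sup>2 / 2) *\<^sub>R iexp ((w - t) * y))"
          using gauss_fourier[OF \<sigma>, of n "w - t"] by (simp add: has_bochner_integral_iff)
        then show "integrable lborel (\<lambda>y. case (w, y) of (w, y) \<Rightarrow> \<Phi> w y)"
          unfolding prod.case \<Phi>_def by (rule integrable_scaleR_right)
      qed
    qed
    have "A n = (\<integral>y. (\<integral>w. \<Phi> w y \<partial>lborel) \<partial>lborel)"
      unfolding A_def
    proof (rule Bochner_Integration.integral_cong[OF refl])
      fix y
      have "(\<integral>w. \<Phi> w y \<partial>lborel) = (\<integral>w. (g w *\<^sub>R iexp (y * w)) * (iexp (- (y * t)) * of_real (exp (- (\<sigma> n * y)\<^sup>2 / 2))) \<partial>lborel)"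
        by (intro Bochner_Integration.integral_cong)
           (auto simp: \<Phi>_def scaleR_conv_of_real algebra_simps simp flip: exp_add)
      also have "\<dots> = (\<integral>w. g w *\<^sub>R iexp (y * w) \<partial>lborel) * (iexp (- (y * t)) * of_real (exp (- (\<sigma> n * y)\<^sup>2 / 2)))"
        by (rule integral_mult_left_zero)
      finally show "h y * iexp (- (y * t)) * of_real (exp (- (\<sigma> n * y)\<^sup>2 / 2)) = (\<integral>w. \<Phi> w y \<partial>lborel)"
        by (simp add: h mult.assoc)
    qed
    also have "\<dots> = (\<integral>w. (\<integral>y. \<Phi> w y \<partial>lborel) \<partial>lborel)"
      by (rule lborel_pair.Fubini_integral[OF ip])
    also have "\<dots> = (\<integral>w. of_real (g w * (sqrt (2 * pi) / \<sigma> n * exp (- ((w - t) / \<sigma> n)\<^sup>2 / 2))) \<partial>lborel)"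
    proof (rule Bochner_Integration.integral_cong[OF refl])
      fix w
      have "(\<integral>y. \<Phi> w y \<partial>lborel) = g w *\<^sub>R (\<integral>y. exp (- (\<sigma> n * y)\<^sup>2 / 2) *\<^sub>R iexp ((w - t) * y) \<partial>lborel)"
        unfolding \<Phi>_def by (rule integral_scaleR_right)
      then show "(\<integral>y. \<Phi> w y \<partial>lborel) = of_real (g w * (sqrt (2 * pi) / \<sigma> n * exp (- ((w - t) / \<sigma> n)\<^sup>2 / 2)))"
        using gauss_fourier[OF \<sigma>, of n "w - t"] by (simp add: has_bochner_integral_iff scaleR_conv_of_real)
    qed
    also have "\<dots> = of_real (\<integral>w. g w * (sqrt (2 * pi) / \<sigma> n * exp (- ((w - t) / \<sigma> n)\<^sup>2 / 2)) \<partial>lborel)"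
      by (rule integral_complex_of_real)
    also have "(\<integral>w. g w * (sqrt (2 * pi) / \<sigma> n * exp (- ((w - t) / \<sigma> n)\<^sup>2 / 2)) \<partial>lborel) =
      (\<integral>x. 2 * pi * (std_normal_density x * g (t + \<sigma> n * x)) \<partial>lborel)"
    proof -
      have "\<sigma> n * (g (t + \<sigma> n * x) * (sqrt (2 * pi) / \<sigma> n * exp (- ((t + \<sigma> n * x - t) / \<sigma> n)\<^sup>2 / 2))) =
          2 * pi * (std_normal_density x * g (t + \<sigma> n * x))" for x
      proof -
        have "(t + \<sigma> n * x - t) / \<sigma> n = x" using \<sigma>[of n] by simp
        moreover have "2 * pi / sqrt (2 * pi) = sqrt (2 * pi)" by (simp add: real_div_sqrt)
        ultimately show ?thesis using \<sigma>[of n]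
          by (simp add: std_normal_density_def field_simps)
      qed
      note E = this
      define k where "k w = g w * (sqrt (2 * pi) / \<sigma> n * exp (- ((w - t) / \<sigma> n)\<^sup>2 / 2))" for w
      have "integral\<^sup>L lborel k = \<bar>\<sigma> n\<bar> *\<^sub>R (\<integral>x. k (t + \<sigma> n * x) \<partial>lborel)"
        using \<sigma>[of n] by (intro lborel_integral_real_affine) simp
      also have "\<dots> = (\<integral>x. \<sigma> n * k (t + \<sigma> n * x) \<partial>lborel)"
        by (simp only: abs_of_pos[OF \<sigma>] real_scaleR_def integral_mult_right_zero)
      also have "\<dots> = (\<integral>x. 2 * pi * (std_normal_density x * g (t + \<sigma> n * x)) \<partial>lborel)"
        by (simp only: k_def E)
      finally show ?thesis unfolding k_def .
    qed
    also have "\<dots> = 2 * pi * (\<integral>x. (std_normal_density x * g (t + \<sigma> n * x)) \<partial>lborel)"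
      by (rule integral_mult_right_zero)
    finally show ?thesis by simp
  qed
  have "A \<longlonglongrightarrow> of_real (2 * pi) * of_real (\<integral>x. std_normal_density x * g t \<partial>lborel)"
    unfolding A2
  proof (intro tendsto_intros integral_dominated_convergence[where w = "\<lambda>x. std_normal_density x * B"])
    show "integrable lborel (\<lambda>x. std_normal_density x * B)"
      using integrable_normal_moment[where k = 0, OF zero_less_one] by simp
    show "AE x in lborel. (\<lambda>n. std_normal_density x * g (t + \<sigma> n * x)) \<longlonglongrightarrow> std_normal_density x * g t"
    proof (rule AE_I2)
      fix x
      have "(\<lambda>n. t + \<sigma> n * x) \<longlonglongrightarrow> t + 0 * x" by (intro tendsto_intros \<sigma>0)
      then have "(\<lambda>n. g (t + \<sigma> n * x)) \<longlonglongrightarrow> g t"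
        using cont by (intro isCont_tendsto_compose[of t g]) (auto simp: continuous_on_eq_continuous_at)
      then show "(\<lambda>n. std_normal_density x * g (t + \<sigma> n * x)) \<longlonglongrightarrow> std_normal_density x * g t"
        by (intro tendsto_intros)
    qed
    show "AE x in lborel. norm (std_normal_density x * g (t + \<sigma> n * x)) \<le> std_normal_density x * B" for n
      using bd by (auto simp: abs_mult intro!: mult_left_mono)
  qed measurable
  from LIMSEQ_unique[OF A1 this]
  have "(\<integral>y. h y * iexp (- (y * t)) \<partial>lborel) = of_real (2 * pi) * of_real (\<integral>x. std_normal_density x * g t \<partial>lborel)" .
  then show ?thesis
    by simp
qed

lemma char_cauchy: "char cauchy t = of_real (exp (- \<bar>t\<bar>))"
proof -
  have L: "integrable lborel laplace_density" using laplace_moment_0 by (simp add: has_bochner_integral_iff)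
  have "(\<integral>y. of_real (1 / (1 + y\<^sup>2)) * iexp (- (y * (- t))) \<partial>lborel) = complex_of_real (2 * pi * laplace_density (- t))"
  proof (rule fourier_inversion[OF L])
    show "continuous_on UNIV laplace_density"
      unfolding laplace_density_def[abs_def] by (intro continuous_intros) auto
    show "\<bar>laplace_density x\<bar> \<le> 1" for x
    proof -
      have "exp (- \<bar>x\<bar>) \<le> 1" by simp
      then have "exp (- \<bar>x\<bar>) \<le> 2" by linarith
      then show ?thesis by (simp add: laplace_density_def)
    qed
    show "complex_of_real (1 / (1 + y\<^sup>2)) = (\<integral>w. laplace_density w *\<^sub>R iexp (y * w) \<partial>lborel)" for y
      using laplace_fourier[of y] by (simp add: has_bochner_integral_iff)
    show "integrable lborel (\<lambda>y. complex_of_real (1 / (1 + y\<^sup>2)))"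
      using integrable_inverse_1_plus_square' by (intro integrable_of_real)
  qed
  moreover have "char cauchy t = (\<integral>y. (1 / pi) *\<^sub>R (of_real (1 / (1 + y\<^sup>2)) * iexp (- (y * (- t)))) \<partial>lborel)"
    unfolding char_def cauchy_def
    by (subst integral_density)
       (auto simp: less_imp_le[OF cauchy_density_pos] cauchy_density_def scaleR_conv_of_real mult_ac intro!: Bochner_Integration.integral_cong)
  ultimately have "char cauchy t = (1 / pi) *\<^sub>R complex_of_real (2 * pi * laplace_density (- t))"
    by (simp only: integral_scaleR_right)
  then show ?thesis
    by (simp add: laplace_density_def scaleR_conv_of_real)
qed

section \<open>Small jumps of a law with Cauchy tails\<close>

text \<open>With a weight of order \<open>y\<^sup>2\<close> at 0, the convergence of \<open>r\<close> times the law of \<open>X / r\<close> to a Levy measure becomes weak convergence of probability measures. For the weight \<open>y\<^sup>2 / (1 + y\<^sup>2)\<close> the limit is the Cauchy distribution.\<close>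

definition sq_weight :: "real \<Rightarrow> real" where "sq_weight y = y\<^sup>2 / (1 + y\<^sup>2)"

lemma sq_weight_meas [measurable]: "sq_weight \<in> borel_measurable borel"
  unfolding sq_weight_def[abs_def] by measurable

lemma sq_weight_bounds: "0 \<le> sq_weight y" "sq_weight y \<le> 1" "sq_weight y = 1 - 1 / (1 + y\<^sup>2)"
proof -
  have "1 + y\<^sup>2 > 0" by (simp add: add_pos_nonneg)
  then show "0 \<le> sq_weight y" "sq_weight y \<le> 1" "sq_weight y = 1 - 1 / (1 + y\<^sup>2)"
    by (auto simp: sq_weight_def field_simps)
qed

text \<open>Multiplication by the weight is an average of differences of exponentials. Integrated
  over the noise, it expresses the weighted characteristic function through increments of the
  unweighted one.\<close>

lemma sq_weight_iexp:
  "(\<integral>w. laplace_density w *\<^sub>R (iexp (t * y) - iexp ((t + w) * y)) \<partial>lborel) = sq_weight y *\<^sub>R iexp (t * y)"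
proof -
  have a: "has_bochner_integral lborel (\<lambda>w. laplace_density w *\<^sub>R iexp (t * y)) (1 *\<^sub>R iexp (t * y))"
    by (rule has_bochner_integral_scaleR_left[OF laplace_moment_0])
  have b: "has_bochner_integral lborel (\<lambda>w. (laplace_density w *\<^sub>R iexp (y * w)) * iexp (t * y)) (of_real (1 / (1 + y\<^sup>2)) * iexp (t * y))"
    by (rule has_bochner_integral_mult_left[OF laplace_fourier])
  have "(\<lambda>w. laplace_density w *\<^sub>R iexp (t * y) - (laplace_density w *\<^sub>R iexp (y * w)) * iexp (t * y)) =
    (\<lambda>w. laplace_density w *\<^sub>R (iexp (t * y) - iexp ((t + w) * y)))"
    by (auto simp: fun_eq_iff algebra_simps simp flip: exp_add)
  with has_bochner_integral_diff[OF a b] show ?thesis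
    by (simp add: has_bochner_integral_iff sq_weight_bounds(3) scaleR_conv_of_real algebra_simps)
qed

locale cauchy_tail = L: real_distribution L for L :: "real measure" +
  fixes \<gamma> :: real
  assumes \<gamma>: "\<gamma> > 0"
    and char_lim: "((\<lambda>t. (1 - char L t) / of_real \<bar>t\<bar>) \<longlongrightarrow> of_real \<gamma>) (at 0)"
begin

text \<open>Turns the asymptotics at 0 into a bound on the whole line, as dominated convergence
  needs. Near 0 the constant \<open>\<gamma> + 1\<close> suffices; for
  \<open>\<bar>t\<bar> \<ge> \<delta>\<close> the trivial bound 2 is at most
  \<open>2 / \<delta> * \<bar>t\<bar>\<close>.\<close>

lemma char_linear_bound: "\<exists>B\<ge>0. \<forall>t. norm (1 - char L t) \<le> B * \<bar>t\<bar>"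
proof -
  have "\<forall>\<^sub>F t in at 0. dist ((1 - char L t) / of_real \<bar>t\<bar>) (of_real \<gamma>) < 1"
    using char_lim by (rule tendstoD) simp
  then obtain \<delta> where \<delta>: "\<delta> > 0"
    and b: "\<And>t. t \<noteq> 0 \<Longrightarrow> \<bar>t\<bar> < \<delta> \<Longrightarrow> dist ((1 - char L t) / of_real \<bar>t\<bar>) (of_real \<gamma>) < 1"
    by (auto simp: eventually_at dist_real_def)
  show ?thesis
  proof (intro exI[of _ "\<gamma> + 1 + 2 / \<delta>"] conjI allI)
    show "0 \<le> \<gamma> + 1 + 2 / \<delta>" using \<gamma> \<delta> by simp
    fix t
    consider "t = 0" | "t \<noteq> 0" "\<bar>t\<bar> < \<delta>" | "\<bar>t\<bar> \<ge> \<delta>" by linarith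
    then show "norm (1 - char L t) \<le> (\<gamma> + 1 + 2 / \<delta>) * \<bar>t\<bar>"
    proof cases
      case 1
      then show ?thesis by (simp add: L.char_zero)
    next
      case 2
      have "norm ((1 - char L t) / of_real \<bar>t\<bar>) \<le> norm (complex_of_real \<gamma>) + dist ((1 - char L t) / of_real \<bar>t\<bar>) (of_real \<gamma>)"
        unfolding dist_norm by (rule norm_triangle_sub)
      also have "\<dots> \<le> \<gamma> + 1" using b[OF 2] \<gamma> by simp
      also have "\<dots> \<le> \<gamma> + 1 + 2 / \<delta>" using \<delta> by simp
      finally show ?thesis using 2 by (simp add: norm_divide field_simps)
    next
      case 3
      have "norm (1 - char L t) \<le> 1 + 1"
        using norm_triangle_ineq4[of 1 "char L t"] L.cmod_char_le_1[of t] by simp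
      also have "\<dots> \<le> 2 / \<delta> * \<bar>t\<bar>" using 3 \<delta> by (simp add: field_simps)
      also have "\<dots> \<le> (\<gamma> + 1 + 2 / \<delta>) * \<bar>t\<bar>" using \<gamma> by (intro mult_right_mono) auto
      finally show ?thesis .
    qed
  qed
qed

lemma char_scaled_lim: "((\<lambda>r. r *\<^sub>R (1 - char L (a / r))) \<longlongrightarrow> of_real (\<gamma> * \<bar>a\<bar>)) at_top"
proof (cases "a = 0")
  case True
  then show ?thesis by (simp add: L.char_zero)
next
  case False
  have 0: "((\<lambda>r. a / r) \<longlongrightarrow> 0) at_top"
    by (rule real_tendsto_divide_at_top[OF tendsto_const filterlim_ident])
  have "filterlim (\<lambda>r. a / r) (at 0) at_top"
    unfolding filterlim_at using 0 False eventually_gt_at_top[of 0]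
    by (auto elim: eventually_mono)
  from filterlim_compose[OF char_lim this]
  have "((\<lambda>r. (1 - char L (a / r)) / of_real \<bar>a / r\<bar> * of_real \<bar>a\<bar>) \<longlongrightarrow> of_real \<gamma> * of_real \<bar>a\<bar>) at_top"
    by (intro tendsto_intros)
  moreover have "\<forall>\<^sub>F r in at_top. (1 - char L (a / r)) / of_real \<bar>a / r\<bar> * of_real \<bar>a\<bar> = r *\<^sub>R (1 - char L (a / r))"
    using eventually_gt_at_top[of 0]
    by eventually_elim (use False in \<open>simp add: scaleR_conv_of_real field_simps\<close>)
  ultimately show ?thesis by (simp add: tendsto_cong)
qed

text \<open>The characteristic function, before normalization, of the law of \<open>x / r\<close>
  tilted by the weight.\<close>

definition J :: "real \<Rightarrow> real \<Rightarrow> complex" where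
  "J r t = (\<integral>x. sq_weight (x / r) *\<^sub>R iexp (t * (x / r)) \<partial>L)"

lemma J_eq:
  "J r t = (\<integral>w. laplace_density w *\<^sub>R (char L (t / r) - char L ((t + w) / r)) \<partial>lborel)"
proof -
  interpret P: pair_sigma_finite L lborel ..
  have li: "integrable lborel laplace_density" using laplace_moment_0 by (simp add: has_bochner_integral_iff)
  define \<Phi> where "\<Phi> x w = laplace_density w *\<^sub>R (iexp (t * (x / r)) - iexp ((t + w) * (x / r)))" for x w
  have \<Phi>m [measurable]: "case_prod \<Phi> \<in> borel_measurable (L \<Otimes>\<^sub>M lborel)"
    unfolding \<Phi>_def[abs_def] by measurable
  have \<Phi>le: "norm (\<Phi> x w) \<le> 2 * laplace_density w" for x w
  proof -
    have "norm (iexp (t * (x / r)) - iexp ((t + w) * (x / r))) \<le> 1 + 1"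
      by (rule order_trans[OF norm_triangle_ineq4]) simp
    then have "laplace_density w * norm (iexp (t * (x / r)) - iexp ((t + w) * (x / r))) \<le> laplace_density w * 2"
      by (intro mult_left_mono) (auto simp: laplace_density_def)
    then show ?thesis by (simp add: \<Phi>_def laplace_density_def)
  qed
  have \<Phi>i: "integrable lborel (\<Phi> x)" for x
  proof (rule Bochner_Integration.integrable_bound)
    show "integrable lborel (\<lambda>w. 2 * laplace_density w)" using li by simp
    show "\<Phi> x \<in> borel_measurable lborel" unfolding \<Phi>_def[abs_def] by measurable
    show "AE w in lborel. norm (\<Phi> x w) \<le> norm (2 * laplace_density w)"
    proof (rule AE_I2)
      fix w
      have eq: "norm (2 * laplace_density w) = 2 * laplace_density w" by (simp add: laplace_density_def)
      show "norm (\<Phi> x w) \<le> norm (2 * laplace_density w)" unfolding eq by (rule \<Phi>le)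
    qed
  qed
  have ip: "integrable (L \<Otimes>\<^sub>M lborel) (case_prod \<Phi>)"
  proof (rule P.Fubini_integrable)
    have "(\<integral>w. norm (\<Phi> x w) \<partial>lborel) \<le> (\<integral>w. 2 * laplace_density w \<partial>lborel)" for x
      using \<Phi>i[of x] li \<Phi>le by (intro integral_mono) auto
    then have "(\<integral>w. norm (\<Phi> x w) \<partial>lborel) \<le> 2" for x
      using laplace_moment_0 by (simp add: has_bochner_integral_iff)
    then show "integrable L (\<lambda>x. \<integral>w. norm (case (x, w) of (x, w) \<Rightarrow> \<Phi> x w) \<partial>lborel)"
      by (intro L.integrable_const_bound[of _ 2]) auto
  qed (auto simp: \<Phi>i)
  have "J r t = (\<integral>x. (\<integral>w. \<Phi> x w \<partial>lborel) \<partial>L)"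
    unfolding J_def \<Phi>_def by (simp only: sq_weight_iexp)
  also have "\<dots> = (\<integral>w. (\<integral>x. \<Phi> x w \<partial>L) \<partial>lborel)"
    by (rule P.Fubini_integral[OF ip, symmetric])
  also have "\<dots> = (\<integral>w. laplace_density w *\<^sub>R (char L (t / r) - char L ((t + w) / r)) \<partial>lborel)"
  proof (rule Bochner_Integration.integral_cong[OF refl])
    fix w
    have i: "integrable L (\<lambda>x. iexp (u * (x / r)))" for u by (intro L.integrable_iexp) auto
    have c: "char L (u / r) = (\<integral>x. iexp (u * (x / r)) \<partial>L)" for u by (simp add: char_def)
    show "(\<integral>x. \<Phi> x w \<partial>L) = laplace_density w *\<^sub>R (char L (t / r) - char L ((t + w) / r))"
      unfolding \<Phi>_def c by (simp only: integral_scaleR_right Bochner_Integration.integral_diff[OF i i])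
  qed
  finally show ?thesis .
qed

lemma J_lim: "((\<lambda>r. r *\<^sub>R J r t) \<longlongrightarrow> of_real (\<gamma> * exp (- \<bar>t\<bar>))) at_top"
proof -
  obtain B where B: "B \<ge> 0" "\<And>t. norm (1 - char L t) \<le> B * \<bar>t\<bar>" using char_linear_bound by blast
  have la: "integrable lborel (\<lambda>w. laplace_density w * (\<bar>t + w\<bar> - \<bar>t\<bar>))" "integrable lborel laplace_density"
    using laplace_abs[of t] laplace_moment_0 by (auto simp: has_bochner_integral_iff)
  have [measurable]: "char L \<in> borel_measurable borel" by (rule L.char_measurable)
  have "((\<lambda>r. \<integral>w. laplace_density w *\<^sub>R (r *\<^sub>R (char L (t / r) - char L ((t + w) / r))) \<partial>lborel) \<longlongrightarrow>
      (\<integral>w. of_real (laplace_density w * (\<gamma> * (\<bar>t + w\<bar> - \<bar>t\<bar>))) \<partial>lborel)) at_top"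
  proof (rule integral_dominated_convergence_at_top)
    \<comment> \<open>The natural bound \<open>B * (\<bar>t + w\<bar> + \<bar>t\<bar>)\<close> is
      rewritten with \<open>\<bar>t + w\<bar> - \<bar>t\<bar>\<close>, so that its integrability is
      part of \<open>laplace_abs\<close>.\<close>
    show "integrable lborel (\<lambda>w. B * (laplace_density w * (\<bar>t + w\<bar> - \<bar>t\<bar>)) + 2 * B * \<bar>t\<bar> * laplace_density w)"
      using la by auto
    show "\<forall>\<^sub>F r in at_top. AE w in lborel. norm (laplace_density w *\<^sub>R (r *\<^sub>R (char L (t / r) - char L ((t + w) / r))))
        \<le> B * (laplace_density w * (\<bar>t + w\<bar> - \<bar>t\<bar>)) + 2 * B * \<bar>t\<bar> * laplace_density w"
      using eventually_gt_at_top[of 0]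
    proof eventually_elim
      case (elim r)
      show ?case
      proof (rule AE_I2)
        fix w
        have "norm (char L (t / r) - char L ((t + w) / r)) = norm ((1 - char L ((t + w) / r)) - (1 - char L (t / r)))"
          by (simp add: norm_minus_commute)
        also have "\<dots> \<le> B * \<bar>(t + w) / r\<bar> + B * \<bar>t / r\<bar>"
          by (rule order_trans[OF norm_triangle_ineq4]) (intro add_mono B)
        finally have "r * norm (char L (t / r) - char L ((t + w) / r)) \<le> B * \<bar>t + w\<bar> + B * \<bar>t\<bar>"
          using elim by (simp add: field_simps)
        then have "laplace_density w * (r * norm (char L (t / r) - char L ((t + w) / r))) \<le> laplace_density w * (B * \<bar>t + w\<bar> + B * \<bar>t\<bar>)"
          by (intro mult_left_mono) (auto simp: laplace_density_def)
        also have "laplace_density w * (B * \<bar>t + w\<bar> + B * \<bar>t\<bar>) =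
            B * (laplace_density w * (\<bar>t + w\<bar> - \<bar>t\<bar>)) + 2 * B * \<bar>t\<bar> * laplace_density w"
          by (simp add: algebra_simps)
        finally show "norm (laplace_density w *\<^sub>R (r *\<^sub>R (char L (t / r) - char L ((t + w) / r))))
          \<le> B * (laplace_density w * (\<bar>t + w\<bar> - \<bar>t\<bar>)) + 2 * B * \<bar>t\<bar> * laplace_density w"
          using elim unfolding norm_scaleR by (simp add: laplace_density_def)
      qed
    qed
    show "AE w in lborel. ((\<lambda>r. laplace_density w *\<^sub>R (r *\<^sub>R (char L (t / r) - char L ((t + w) / r)))) \<longlongrightarrow>
       of_real (laplace_density w * (\<gamma> * (\<bar>t + w\<bar> - \<bar>t\<bar>)))) at_top"
    proof (rule AE_I2)
      fix w
      have "((\<lambda>r. laplace_density w *\<^sub>R (r *\<^sub>R (1 - char L ((t + w) / r)) - r *\<^sub>R (1 - char L (t / r)))) \<longlongrightarrow>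
         laplace_density w *\<^sub>R (of_real (\<gamma> * \<bar>t + w\<bar>) - of_real (\<gamma> * \<bar>t\<bar>))) at_top"
        by (intro tendsto_intros char_scaled_lim)
      then show "((\<lambda>r. laplace_density w *\<^sub>R (r *\<^sub>R (char L (t / r) - char L ((t + w) / r)))) \<longlongrightarrow>
       of_real (laplace_density w * (\<gamma> * (\<bar>t + w\<bar> - \<bar>t\<bar>)))) at_top"
        by (simp add: scaleR_conv_of_real algebra_simps)
    qed
  qed measurable
  moreover have "(\<integral>w. laplace_density w *\<^sub>R (r *\<^sub>R (char L (t / r) - char L ((t + w) / r))) \<partial>lborel) = r *\<^sub>R J r t" for r
    unfolding J_eq by (subst integral_scaleR_right[symmetric]) (simp add: mult.commute)
  moreover have "(\<integral>w. complex_of_real (laplace_density w * (\<gamma> * (\<bar>t + w\<bar> - \<bar>t\<bar>))) \<partial>lborel) = of_real (\<gamma> * exp (- \<bar>t\<bar>))"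
  proof -
    have "(\<integral>w. laplace_density w * (\<gamma> * (\<bar>t + w\<bar> - \<bar>t\<bar>)) \<partial>lborel) = (\<integral>w. \<gamma> * (laplace_density w * (\<bar>t + w\<bar> - \<bar>t\<bar>)) \<partial>lborel)"
      by (simp add: mult_ac)
    also have "\<dots> = \<gamma> * exp (- \<bar>t\<bar>)"
      using laplace_abs[of t] unfolding integral_mult_right_zero by (simp add: has_bochner_integral_iff)
    finally show ?thesis unfolding integral_complex_of_real by simp
  qed
  ultimately show ?thesis by simp
qed

definition mass :: "real \<Rightarrow> real" where "mass r = (\<integral>x. sq_weight (x / r) \<partial>L)"

lemma J_0: "J r 0 = of_real (mass r)"
  by (simp add: J_def mass_def scaleR_conv_of_real)

lemma mass_lim: "((\<lambda>r. r * mass r) \<longlongrightarrow> \<gamma>) at_top"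
proof -
  have "((\<lambda>r. Re (r *\<^sub>R J r 0)) \<longlongrightarrow> Re (of_real (\<gamma> * exp (- \<bar>0\<bar>)))) at_top"
    by (intro tendsto_Re J_lim)
  then show ?thesis by (simp add: J_0)
qed

lemma sq_weight_integrable: "integrable L (\<lambda>x. sq_weight (x / r))"
  using sq_weight_bounds by (intro L.integrable_const_bound[of _ 1]) auto

definition tilt :: "real \<Rightarrow> real measure" where
  "tilt r = distr (density L (\<lambda>x. ennreal (sq_weight (x / r) / mass r))) borel (\<lambda>x. x / r)"

lemma tilt:
  assumes m: "mass r > 0"
  shows "real_distribution (tilt r)"
    and "\<And>g :: real \<Rightarrow> complex. g \<in> borel_measurable borel \<Longrightarrow>
      integral\<^sup>L (tilt r) g = (\<integral>x. sq_weight (x / r) *\<^sub>R g (x / r) \<partial>L) /\<^sub>R mass r"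
proof -
  have nn: "0 \<le> sq_weight (x / r) / mass r" for x using m sq_weight_bounds(1) by simp
  have "emeasure (density L (\<lambda>x. ennreal (sq_weight (x / r) / mass r))) UNIV = (\<integral>\<^sup>+x. ennreal (sq_weight (x / r) / mass r) \<partial>L)"
    by (subst emeasure_density) auto
  also have "\<dots> = ennreal (\<integral>x. sq_weight (x / r) / mass r \<partial>L)"
    using sq_weight_integrable nn by (intro nn_integral_eq_integral) auto
  also have "(\<integral>x. sq_weight (x / r) / mass r \<partial>L) = 1" using m by (simp add: mass_def)
  finally have "prob_space (density L (\<lambda>x. ennreal (sq_weight (x / r) / mass r)))"
    by (intro prob_spaceI) simp
  then interpret D: prob_space "density L (\<lambda>x. ennreal (sq_weight (x / r) / mass r))" .
  show "real_distribution (tilt r)"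
    unfolding tilt_def by (rule D.real_distribution_distr) simp
  fix g :: "real \<Rightarrow> complex" assume [measurable]: "g \<in> borel_measurable borel"
  show "integral\<^sup>L (tilt r) g = (\<integral>x. sq_weight (x / r) *\<^sub>R g (x / r) \<partial>L) /\<^sub>R mass r"
    unfolding tilt_def using nn
    by (simp add: integral_distr integral_density divide_inverse mult.commute[of _ "inverse (mass r)"]
        flip: scaleR_scaleR)
qed

text \<open>In the quotient of \<open>J_lim\<close> and \<open>mass_lim\<close> both
  \<open>r\<close> and \<open>\<gamma>\<close> cancel, which leaves
  \<open>exp (- \<bar>t\<bar>)\<close>, the characteristic function of the Cauchy
  distribution.\<close>

lemma tilt_weak_conv:
  assumes X: "filterlim X at_top sequentially" and m: "\<And>n. mass (X n) > 0"
  shows "weak_conv_m (\<lambda>n. tilt (X n)) cauchy"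
proof (rule levy_continuity)
  fix t
  have "(\<lambda>n. (X n *\<^sub>R J (X n) t) /\<^sub>R (X n * mass (X n))) \<longlonglongrightarrow> of_real (\<gamma> * exp (- \<bar>t\<bar>)) /\<^sub>R \<gamma>"
    by (intro tendsto_intros filterlim_compose[OF J_lim X] filterlim_compose[OF mass_lim X]) (use \<gamma> in simp)
  moreover have "\<forall>\<^sub>F n in sequentially. (X n *\<^sub>R J (X n) t) /\<^sub>R (X n * mass (X n)) = char (tilt (X n)) t"
    using filterlim_at_top_dense[THEN iffD1, OF X, rule_format, of 0]
  proof eventually_elim
    case (elim n)
    then show ?case using m[of n]
      by (simp add: char_def tilt(2) J_def)
  qed
  ultimately have "(\<lambda>n. char (tilt (X n)) t) \<longlonglongrightarrow> of_real (\<gamma> * exp (- \<bar>t\<bar>)) /\<^sub>R \<gamma>"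
    by (rule Lim_transform_eventually)
  also have "of_real (\<gamma> * exp (- \<bar>t\<bar>)) /\<^sub>R \<gamma> = char cauchy t"
    using \<gamma> by (simp add: char_cauchy scaleR_conv_of_real)
  finally show "(\<lambda>n. char (tilt (X n)) t) \<longlonglongrightarrow> char cauchy t" .
qed (use tilt(1) m real_distribution_cauchy in auto)

text \<open>Up to a constant, the density of the Levy measure \<open>dy / y\<^sup>2\<close> with respect to the Cauchy distribution. Its junk value at 0 is irrelevant, since the Cauchy distribution has no atoms.\<close>

definition W :: "real \<Rightarrow> real" where "W y = (1 + y\<^sup>2) / y\<^sup>2"

text \<open>The tilt inserts the weight and \<open>W\<close> removes it. Although \<open>W\<close>
  is singular, \<open>W y *\<^sub>R H y\<close> is bounded, because \<open>H\<close> is of the order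
  of the weight, and it is continuous off 0, which the Cauchy distribution does not charge; so weak
  convergence applies to it.\<close>

lemma small_jumps_limit:
  fixes H :: "real \<Rightarrow> complex"
  assumes cont: "continuous_on UNIV H" and bd: "\<And>y. norm (H y) \<le> B * sq_weight y"
  shows "((\<lambda>r. r *\<^sub>R (\<integral>x. H (x / r) \<partial>L)) \<longlongrightarrow> \<gamma> *\<^sub>R (\<integral>y. W y *\<^sub>R H y \<partial>cauchy)) at_top"
proof (rule tendsto_at_topI_sequentially)
  fix X :: "nat \<Rightarrow> real" assume X: "filterlim X at_top sequentially"
  have [measurable]: "H \<in> borel_measurable borel" using cont by (rule borel_measurable_continuous_onI)
  have Wm: "(\<lambda>y. W y *\<^sub>R H y) \<in> borel_measurable borel" unfolding W_def by measurable
  interpret C: real_distribution cauchy by (rule real_distribution_cauchy)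
  have "\<forall>\<^sub>F n in sequentially. X n * mass (X n) > 0"
    using filterlim_compose[OF mass_lim X] \<gamma> by (rule order_tendstoD)
  moreover have "\<forall>\<^sub>F n in sequentially. X n > 0"
    using filterlim_at_top_dense[THEN iffD1, OF X] by blast
  ultimately have "\<forall>\<^sub>F n in sequentially. X n > 0 \<and> mass (X n) > 0"
    by eventually_elim (auto simp: zero_less_mult_iff)
  then obtain N where N: "\<And>n. n \<ge> N \<Longrightarrow> X n > 0 \<and> mass (X n) > 0"
    by (auto simp: eventually_sequentially)
  \<comment> \<open>The tail of the sequence, on which the mass is positive for every index and the
    tilted laws are probability measures.\<close>
  define Y where "Y n = X (n + N)" for n
  have Y: "filterlim Y at_top sequentially"
    unfolding Y_def using X by (rule filterlim_compose) (rule filterlim_add_const_nat_at_top)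
  have Ym: "mass (Y n) > 0" "Y n > 0" for n using N[of "n + N"] by (auto simp: Y_def)
  \<comment> \<open>At \<open>y = 0\<close> the left side is 0, and the bound on \<open>H\<close>
    forces \<open>H 0 = 0\<close> as well.\<close>
  have WH: "sq_weight y *\<^sub>R W y *\<^sub>R H y = H y" for y
  proof (cases "y = 0")
    case True
    then show ?thesis using bd[of 0] by (simp add: sq_weight_def)
  next
    case False
    have "1 + y\<^sup>2 > 0" by (simp add: add_pos_nonneg)
    then show ?thesis using False by (simp add: sq_weight_def W_def)
  qed
  have Hle: "norm (W y *\<^sub>R H y) \<le> \<bar>B\<bar>" for y
  proof (cases "y = 0")
    case False
    have "1 + y\<^sup>2 > 0" by (simp add: add_pos_nonneg)
    then have "W y * sq_weight y = 1" "W y \<ge> 0" using False by (simp_all add: sq_weight_def W_def)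
    then show ?thesis using mult_left_mono[OF bd[of y], of "W y"] by (simp add: mult.left_commute)
  qed (simp add: W_def)
  have "(\<lambda>n. integral\<^sup>L (tilt (Y n)) (\<lambda>y. W y *\<^sub>R H y)) \<longlonglongrightarrow> integral\<^sup>L cauchy (\<lambda>y. W y *\<^sub>R H y)"
  proof (rule weak_conv_imp_bdd_ae_continuous_conv[OF _ real_distribution_cauchy tilt_weak_conv[OF Y Ym(1)] _ Hle Wm])
    show "real_distribution (tilt (Y n))" for n using Ym by (intro tilt)
    have "isCont (\<lambda>y. W y *\<^sub>R H y) y" if "y \<noteq> 0" for y
      unfolding W_def using that cont
      by (intro continuous_intros) (auto simp: continuous_on_eq_continuous_at)
    then have "{y. \<not> isCont (\<lambda>y. W y *\<^sub>R H y) y} \<subseteq> {0}" by blast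
    then have sub: "{y. \<not> isCont (\<lambda>y. W y *\<^sub>R H y) y} = {} \<or> {y. \<not> isCont (\<lambda>y. W y *\<^sub>R H y) y} = {0}"
      by (rule subset_singletonD)
    have "emeasure cauchy {0} = 0"
      by (simp add: cauchy_def emeasure_density nn_integral_0_iff_AE AE_lborel_singleton cong: AE_cong_simp)
    with sub show "emeasure cauchy {y. \<not> isCont (\<lambda>y. W y *\<^sub>R H y) y} = 0"
      by (elim disjE) (simp_all only: emeasure_empty)
  qed
  then have "(\<lambda>n. (Y n * mass (Y n)) *\<^sub>R integral\<^sup>L (tilt (Y n)) (\<lambda>y. W y *\<^sub>R H y)) \<longlonglongrightarrow> \<gamma> *\<^sub>R integral\<^sup>L cauchy (\<lambda>y. W y *\<^sub>R H y)"
    by (intro tendsto_intros filterlim_compose[OF mass_lim Y])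
  moreover have "(Y n * mass (Y n)) *\<^sub>R integral\<^sup>L (tilt (Y n)) (\<lambda>y. W y *\<^sub>R H y) = Y n *\<^sub>R (\<integral>x. H (x / Y n) \<partial>L)" for n
    unfolding tilt(2)[OF Ym(1) Wm] WH using Ym[of n] by simp
  ultimately have "(\<lambda>n. Y n *\<^sub>R (\<integral>x. H (x / Y n) \<partial>L)) \<longlonglongrightarrow> \<gamma> *\<^sub>R (\<integral>y. W y *\<^sub>R H y \<partial>cauchy)"
    by simp
  then show "(\<lambda>n. X n *\<^sub>R (\<integral>x. H (x / X n) \<partial>L)) \<longlonglongrightarrow> \<gamma> *\<^sub>R (\<integral>y. W y *\<^sub>R H y \<partial>cauchy)"
    unfolding Y_def by (rule LIMSEQ_offset)
qed

section \<open>The first truncated moment of the noise\<close>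

definition k :: "real \<Rightarrow> real" where "k r = (\<integral>x. kap (x / r) \<partial>L)"

lemma kap_integrable: "integrable L (\<lambda>x. kap (x / r))" "integrable L (\<lambda>x. (kap (x / r))\<^sup>2)"
  using kap_bounds by (auto intro!: L.integrable_const_bound[of _ 1] simp: power_le_one)

lemma kap_square_bound: "\<forall>\<^sub>F r in at_top. r * (\<integral>x. (kap (x / r))\<^sup>2 \<partial>L) \<le> 2 * (\<gamma> + 1)"
proof -
  have "\<forall>\<^sub>F r in at_top. r * mass r < \<gamma> + 1"
    using mass_lim by (rule order_tendstoD) simp
  then show ?thesis using eventually_gt_at_top[of 0]
  proof eventually_elim
    case (elim r)
    have "(\<integral>x. (kap (x / r))\<^sup>2 \<partial>L) \<le> (\<integral>x. 2 * sq_weight (x / r) \<partial>L)"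
      using kap_integrable sq_weight_integrable kap_square_le[folded sq_weight_def]
      by (intro integral_mono) auto
    then have "r * (\<integral>x. (kap (x / r))\<^sup>2 \<partial>L) \<le> r * (2 * mass r)"
      using elim by (intro mult_left_mono) (auto simp: mass_def)
    also have "r * (2 * mass r) = 2 * (r * mass r)" by simp
    also have "\<dots> \<le> 2 * (\<gamma> + 1)" using elim(1) by simp
    finally show ?case .
  qed
qed

lemma k_nonneg: "0 \<le> k r"
  unfolding k_def by (intro Bochner_Integration.integral_nonneg kap_bounds)

text \<open>The Cauchy-Schwarz inequality and \<open>kap_square_bound\<close> only give boundedness. The improvement comes from splitting off the part where \<open>sqrt r * kap (x / r)\<close> is at most \<open>1 / \<delta>\<close>, to which dominated convergence applies.\<close>

lemma sqrt_k_lim: "((\<lambda>r. sqrt r * k r) \<longlongrightarrow> 0) at_top"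
proof (rule tendstoI)
  fix \<epsilon> :: real assume \<epsilon>: "\<epsilon> > 0"
  \<comment> \<open>Here \<open>2 * (\<gamma> + 1)\<close> is the bound of
    \<open>kap_square_bound\<close>, so the large values contribute at most
    \<open>\<epsilon> / 2\<close>.\<close>
  define \<delta> where "\<delta> = \<epsilon> / (4 * (\<gamma> + 1))"
  have \<delta>: "\<delta> > 0" "\<delta> * (2 * (\<gamma> + 1)) = \<epsilon> / 2" using \<epsilon> \<gamma> by (auto simp: \<delta>_def field_simps)
  have "((\<lambda>r. \<integral>x. min (1 / \<delta>) (sqrt r * kap (x / r)) \<partial>L) \<longlongrightarrow> (\<integral>x. 0 \<partial>L)) at_top"
  proof (rule integral_dominated_convergence_at_top[where w = "\<lambda>_. 1 / \<delta>"])
    show "\<forall>\<^sub>F r in at_top. AE x in L. norm (min (1 / \<delta>) (sqrt r * kap (x / r))) \<le> 1 / \<delta>"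
      using eventually_gt_at_top[of 0] by eventually_elim (use \<delta> kap_bounds(1) in auto)
    show "AE x in L. ((\<lambda>r. min (1 / \<delta>) (sqrt r * kap (x / r))) \<longlongrightarrow> 0) at_top"
    proof (rule AE_I2)
      fix x
      have "((\<lambda>r. \<bar>x\<bar> / sqrt r) \<longlongrightarrow> 0) at_top"
        by (rule real_tendsto_divide_at_top[OF tendsto_const sqrt_at_top])
      moreover have "\<forall>\<^sub>F r in at_top. norm (min (1 / \<delta>) (sqrt r * kap (x / r))) \<le> \<bar>x\<bar> / sqrt r"
        using eventually_gt_at_top[of 0]
      proof eventually_elim
        case (elim r)
        have "sqrt r * kap (x / r) \<le> sqrt r * (\<bar>x\<bar> / r)"
          using elim kap_bounds(3)[of "x / r"] by (intro mult_left_mono) auto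
        also have "\<dots> = \<bar>x\<bar> / sqrt r" using elim by (simp add: real_div_sqrt field_simps)
        finally show ?case using elim \<delta> kap_bounds(1)[of "x / r"] by auto
      qed
      ultimately show "((\<lambda>r. min (1 / \<delta>) (sqrt r * kap (x / r))) \<longlongrightarrow> 0) at_top"
        by (rule Lim_null_comparison[rotated])
    qed
  qed auto
  then have "\<forall>\<^sub>F r in at_top. (\<integral>x. min (1 / \<delta>) (sqrt r * kap (x / r)) \<partial>L) < \<epsilon> / 2"
    using \<epsilon> by (intro order_tendstoD) auto
  then show "\<forall>\<^sub>F r in at_top. dist (sqrt r * k r) 0 < \<epsilon>"
    using kap_square_bound eventually_gt_at_top[of 0]
  proof eventually_elim
    case (elim r)
    have pt: "sqrt r * kap (x / r) \<le> \<delta> * (r * (kap (x / r))\<^sup>2) + min (1 / \<delta>) (sqrt r * kap (x / r))" for x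
    proof (cases "sqrt r * kap (x / r) \<le> 1 / \<delta>")
      case True
      then show ?thesis using \<delta> elim by simp
    next
      case False
      then have "1 \<le> \<delta> * (sqrt r * kap (x / r))" using \<delta> by (simp add: field_simps)
      then have "sqrt r * kap (x / r) * 1 \<le> sqrt r * kap (x / r) * (\<delta> * (sqrt r * kap (x / r)))"
        using elim kap_bounds(1) by (intro mult_left_mono) auto
      also have "\<dots> = \<delta> * ((sqrt r)\<^sup>2 * (kap (x / r))\<^sup>2)" by (simp add: power2_eq_square)
      also have "(sqrt r)\<^sup>2 = r" using elim by simp
      finally show ?thesis using \<delta> False by (simp add: add_increasing2)
    qed
    have i: "integrable L (\<lambda>x. min (1 / \<delta>) (sqrt r * kap (x / r)))"
      using \<delta> elim kap_bounds(1) by (intro L.integrable_const_bound[of _ "1 / \<delta>"]) auto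
    have "sqrt r * k r = (\<integral>x. sqrt r * kap (x / r) \<partial>L)" by (simp add: k_def)
    also have "\<dots> \<le> (\<integral>x. \<delta> * (r * (kap (x / r))\<^sup>2) + min (1 / \<delta>) (sqrt r * kap (x / r)) \<partial>L)"
      using kap_integrable i pt by (intro integral_mono) auto
    also have "\<dots> = \<delta> * (r * (\<integral>x. (kap (x / r))\<^sup>2 \<partial>L)) + (\<integral>x. min (1 / \<delta>) (sqrt r * kap (x / r)) \<partial>L)"
      using kap_integrable i by simp
    also have "\<dots> < \<delta> * (2 * (\<gamma> + 1)) + \<epsilon> / 2"
      using elim \<delta> by (intro add_le_less_mono mult_left_mono) auto
    finally show ?case using \<delta>(2) k_nonneg[of r] elim by simp
  qed
qed

lemma k_square_lim: "((\<lambda>r. r * (k r)\<^sup>2) \<longlongrightarrow> 0) at_top"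
proof -
  have "((\<lambda>r. (sqrt r * k r)\<^sup>2) \<longlongrightarrow> 0\<^sup>2) at_top" by (intro tendsto_intros sqrt_k_lim)
  moreover have "\<forall>\<^sub>F r in at_top. (sqrt r * k r)\<^sup>2 = r * (k r)\<^sup>2"
    using eventually_gt_at_top[of 0] by eventually_elim (simp add: power_mult_distrib)
  ultimately show ?thesis by (simp add: tendsto_cong)
qed

lemma k_lim: "(k \<longlongrightarrow> 0) at_top"
proof (rule Lim_null_comparison[OF _ sqrt_k_lim])
  show "\<forall>\<^sub>F r in at_top. norm (k r) \<le> sqrt r * k r"
    using eventually_ge_at_top[of 1]
  proof eventually_elim
    case (elim r)
    then have "1 * k r \<le> sqrt r * k r" using k_nonneg by (intro mult_right_mono) auto
    then show ?case using k_nonneg[of r] by simp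
  qed
qed

end

section \<open>Contributions of the lattice sites\<close>

definition window :: "nat \<Rightarrow> int set" where "window n = {- int n..int n}"

lemma finite_window [simp]: "finite (window n)" by (simp add: window_def)

lemma count_space_window_limit:
  fixes g :: "int \<Rightarrow> 'b::{banach, second_countable_topology}"
  assumes g: "integrable (count_space UNIV) g"
  shows "(\<lambda>n. \<Sum>x\<in>window n. g x) \<longlonglongrightarrow> integral\<^sup>L (count_space UNIV) g"
proof -
  have "(\<lambda>n. \<integral>x. indicator (window n) x *\<^sub>R g x \<partial>count_space UNIV) \<longlonglongrightarrow> integral\<^sup>L (count_space UNIV) g"
  proof (rule integral_dominated_convergence[where w = "\<lambda>x. norm (g x)"])
    show "AE x in count_space UNIV. (\<lambda>n. indicator (window n) x *\<^sub>R g x) \<longlonglongrightarrow> g x"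
    proof (rule AE_I2)
      fix x
      have "\<forall>\<^sub>F n in sequentially. indicator (window n) x *\<^sub>R g x = g x"
        using eventually_ge_at_top[of "nat \<bar>x\<bar>"]
        by eventually_elim (auto simp: window_def indicator_def)
      then show "(\<lambda>n. indicator (window n) x *\<^sub>R g x) \<longlonglongrightarrow> g x"
        by (rule tendsto_eventually)
    qed
  qed (use g in \<open>auto simp: indicator_def\<close>)
  moreover have "(\<integral>x. indicator (window n) x *\<^sub>R g x \<partial>count_space UNIV) = (\<Sum>x\<in>window n. g x)" for n
  proof -
    have "{x \<in> UNIV. indicator (window n) x *\<^sub>R g x \<noteq> 0} \<subseteq> window n" by (auto simp: indicator_def)
    then have "(\<integral>x. indicator (window n) x *\<^sub>R g x \<partial>count_space UNIV) =
      (\<Sum>x | x \<in> UNIV \<and> indicator (window n) x *\<^sub>R g x \<noteq> 0. indicator (window n) x *\<^sub>R g x)"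
      by (intro lebesgue_integral_count_space_finite_support finite_subset[OF _ finite_window]) auto
    also have "\<dots> = (\<Sum>x\<in>window n. g x)"
      by (rule sum.mono_neutral_cong_left) (auto simp: indicator_def)
    finally show ?thesis .
  qed
  ultimately show ?thesis by simp
qed

text \<open>No logarithm is taken. The factors \<open>1 + b x\<close> lie in the unit disc, which
  forces \<open>Re (b x) \<le> 0\<close> and puts \<open>exp (b x)\<close> there too; hence the
  difference of the products is at most the sum of the differences of the factors. The constant
  \<open>exp 2\<close> comes from \<open>norm (b x) \<le> 2\<close>.\<close>

lemma prod_exp_approx:
  fixes b :: "'i \<Rightarrow> complex"
  assumes "\<And>x. x \<in> A \<Longrightarrow> norm (1 + b x) \<le> 1"
  shows "norm ((\<Prod>x\<in>A. 1 + b x) - exp (\<Sum>x\<in>A. b x)) \<le> exp 2 * (\<Sum>x\<in>A. (norm (b x))\<^sup>2)"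
proof (cases "finite A")
  case True
  have "norm ((\<Prod>x\<in>A. 1 + b x) - (\<Prod>x\<in>A. exp (b x))) \<le> (\<Sum>x\<in>A. norm ((1 + b x) - exp (b x)))"
  proof (rule norm_prod_diff)
    fix x assume x: "x \<in> A"
    show "norm (1 + b x) \<le> 1" by (rule assms[OF x])
    have "Re (1 + b x) \<le> 1" using complex_Re_le_cmod[of "1 + b x"] assms[OF x] by linarith
    then show "norm (exp (b x)) \<le> 1" by (simp add: norm_exp_eq_Re)
  qed
  also have "\<dots> \<le> (\<Sum>x\<in>A. exp 2 * (norm (b x))\<^sup>2)"
  proof (rule sum_mono)
    fix x assume x: "x \<in> A"
    have "norm (b x) \<le> norm (1 + b x) + norm (1::complex)"
      using norm_triangle_ineq4[of "1 + b x" 1] by simp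
    then have le: "norm (b x) \<le> 2" using assms[OF x] by simp
    have "norm ((1 + b x) - exp (b x)) = norm (exp (b x) - 1 - b x)"
      by (simp add: norm_minus_commute algebra_simps)
    also have "\<dots> \<le> (norm (b x))\<^sup>2 * exp (norm (b x))" by (rule norm_exp_minus_2_le)
    also have "\<dots> \<le> (norm (b x))\<^sup>2 * exp 2" using le by (intro mult_left_mono) auto
    finally show "norm ((1 + b x) - exp (b x)) \<le> exp 2 * (norm (b x))\<^sup>2" by (simp add: mult.commute)
  qed
  finally show ?thesis using True by (simp add: exp_sum sum_distrib_left)
qed simp

locale noise_profile = C2_profile f f' f'' F + cauchy_tail L \<gamma>
  for f f' f'' :: "real \<Rightarrow> real" and F :: real and L :: "real measure" and \<gamma> :: real
begin

definition b :: "complex \<Rightarrow> real \<Rightarrow> int \<Rightarrow> complex" where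
  "b z r x = (\<integral>y. G z (y / r) (of_int x / r) \<partial>L)"

lemma EK_nonneg: "0 \<le> E z * K" by (intro mult_nonneg_nonneg E_nonneg K_ge)

lemma G_integrable: "integrable L (\<lambda>y. G z (y / r) u)"
proof (rule L.integrable_const_bound[of _ "E z * K"])
  show "AE y in L. norm (G z (y / r) u) \<le> E z * K"
  proof (rule AE_I2)
    fix y
    show "norm (G z (y / r) u) \<le> E z * K"
      using G_le_kap[of z "y / r" u] mult_left_mono[OF kap_bounds(2)[of "y / r"] EK_nonneg[of z]] by linarith
  qed
qed measurable

lemma b_le: "norm (b z r x) \<le> E z * K * k r"
proof -
  have "norm (b z r x) \<le> (\<integral>y. norm (G z (y / r) (of_int x / r)) \<partial>L)"
    unfolding b_def by (rule integral_norm_bound)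
  also have "\<dots> \<le> (\<integral>y. E z * K * kap (y / r) \<partial>L)"
    by (intro integral_mono integrable_norm G_integrable integrable_mult_right kap_integrable G_le_kap)
  also have "\<dots> = E z * K * k r" by (simp add: k_def)
  finally show ?thesis .
qed

lemma one_plus_b: "1 + b z r x = (\<integral>y. exp (z * of_real (d (y / r) (of_int x / r))) \<partial>L)"
proof -
  have "1 + b z r x = (\<integral>y. 1 + G z (y / r) (of_int x / r) \<partial>L)"
    using G_integrable[of z r "of_int x / r"] L.prob_space
    by (subst Bochner_Integration.integral_add) (auto simp: b_def)
  then show ?thesis by (simp add: G_def)
qed

context
  fixes r :: real
  assumes r: "r \<ge> 1"
begin

lemma G_meas_count: "(\<lambda>(y, x). G z (y / r) (of_int x / r)) \<in> borel_measurable (L \<Otimes>\<^sub>M count_space (UNIV :: int set))"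
proof -
  have 1: "(\<lambda>p. of_int (snd p) / r) \<in> borel_measurable (L \<Otimes>\<^sub>M count_space (UNIV :: int set))"
    by (rule measurable_compose[OF measurable_snd]) simp
  have 2: "(\<lambda>p. fst p / r) \<in> borel_measurable (L \<Otimes>\<^sub>M count_space (UNIV :: int set))"
    by (rule measurable_compose[OF measurable_fst]) simp
  show ?thesis
    using measurable_compose[OF measurable_Pair[OF 2 1] profile_meas(6)[of z]] by (simp add: case_prod_beta')
qed

lemma G_count_integrable: "integrable (L \<Otimes>\<^sub>M count_space (UNIV :: int set)) (\<lambda>(y, x). G z (y / r) (of_int x / r))"
proof -
  interpret P: pair_sigma_finite L "count_space (UNIV :: int set)"
    unfolding pair_sigma_finite_def by (auto intro: sigma_finite_measure_count_space L.sigma_finite_measure_axioms)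
  show ?thesis
  proof (rule P.Fubini_integrable)
    show "AE y in L. integrable (count_space UNIV) (\<lambda>x. case (y, x) of (y, x) \<Rightarrow> G z (y / r) (of_int x / r))"
      using sum_G(1)[OF r] by simp
    have le: "(\<integral>x. norm (G z (y / r) (of_int (x::int) / r)) \<partial>count_space UNIV) \<le> 2 * E z * K * r" for y
    proof -
      have "0 \<le> 2 * E z * K * r" using EK_nonneg[of z] r by simp
      from mult_left_mono[OF kap_bounds(2)[of "y / r"] this] sum_G(3)[OF r, of z "y / r"]
      show ?thesis by linarith
    qed
    have [measurable]: "(\<lambda>p. norm (G z (fst p / r) (of_int (snd p) / r))) \<in> borel_measurable (L \<Otimes>\<^sub>M count_space (UNIV :: int set))"
      using measurable_compose[OF G_meas_count borel_measurable_norm] by (simp add: case_prod_beta')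
    show "integrable L (\<lambda>y. \<integral>x. norm (case (y, x) of (y, x) \<Rightarrow> G z (y / r) (of_int x / r)) \<partial>count_space UNIV)"
    proof (rule L.integrable_const_bound[of _ "2 * E z * K * r"])
      show "AE y in L. norm (\<integral>x. norm (case (y, x) of (y, x) \<Rightarrow> G z (y / r) (of_int x / r)) \<partial>count_space UNIV) \<le> 2 * E z * K * r"
        using le by (auto intro!: AE_I2)
      show "(\<lambda>y. \<integral>x. norm (case (y, x) of (y, x) \<Rightarrow> G z (y / r) (of_int x / r)) \<partial>count_space UNIV) \<in> borel_measurable L"
        using P.M2.borel_measurable_lebesgue_integral[of "\<lambda>y x. norm (G z (y / r) (of_int x / r))" L]
          measurable_compose[OF G_meas_count borel_measurable_norm] by (simp add: case_prod_beta')
    qed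
  qed (rule G_meas_count)
qed

text \<open>Fubini exchanges the noise average with the sum over the sites; the bounds of
  \<open>sum_G\<close>, valid for each fixed displacement, are then averaged, which replaces
  \<open>kap\<close> by \<open>k r\<close>.\<close>

lemma b_integrable: "integrable (count_space UNIV) (b z r)"
    and b_norm_sum: "(\<integral>x. norm (b z r x) \<partial>count_space UNIV) \<le> 2 * E z * K * r * k r"
    and b_sum_approx: "norm (integral\<^sup>L (count_space UNIV) (b z r) - r *\<^sub>R (\<integral>y. H z (y / r) \<partial>L)) \<le> E z * K * k r"
proof -
  interpret P: pair_sigma_finite L "count_space (UNIV :: int set)"
    unfolding pair_sigma_finite_def by (auto intro: sigma_finite_measure_count_space L.sigma_finite_measure_axioms)
  note i = G_count_integrable[of z]
  show bi: "integrable (count_space UNIV) (b z r)"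
    unfolding b_def[abs_def] using P.integrable_snd[of "\<lambda>y x. G z (y / r) (of_int x / r)"] i by simp
  have ni: "integrable (L \<Otimes>\<^sub>M count_space (UNIV :: int set)) (\<lambda>(y, x). norm (G z (y / r) (of_int x / r)))"
    using integrable_norm[OF i] by (simp add: case_prod_beta')
  have "(\<integral>x. norm (b z r x) \<partial>count_space UNIV) \<le> (\<integral>x. (\<integral>y. norm (G z (y / r) (of_int x / r)) \<partial>L) \<partial>count_space UNIV)"
    using bi P.integrable_snd[OF ni] unfolding b_def by (intro integral_mono integral_norm_bound) auto
  also have "\<dots> = (\<integral>y. (\<integral>x. norm (G z (y / r) (of_int x / r)) \<partial>count_space UNIV) \<partial>L)"
    by (rule P.Fubini_integral[OF ni])
  also have "\<dots> \<le> (\<integral>y. 2 * E z * K * r * kap (y / r) \<partial>L)"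
    using P.integrable_fst[OF ni] kap_integrable sum_G(3)[OF r] by (intro integral_mono) auto
  finally show "(\<integral>x. norm (b z r x) \<partial>count_space UNIV) \<le> 2 * E z * K * r * k r" by (simp add: k_def)
  have Hi: "integrable L (\<lambda>y. H z (y / r))"
  proof (rule L.integrable_const_bound[of _ "norm z * E z * K\<^sup>2"])
    show "AE y in L. norm (H z (y / r)) \<le> norm z * E z * K\<^sup>2"
    proof (rule AE_I2)
      fix y
      have "(kap (y / r))\<^sup>2 \<le> 1" using kap_bounds by (simp add: power_le_one)
      moreover have "0 \<le> norm z * E z * K\<^sup>2" using E_nonneg[of z] by simp
      ultimately have "norm z * E z * K\<^sup>2 * (kap (y / r))\<^sup>2 \<le> norm z * E z * K\<^sup>2 * 1" by (rule mult_left_mono)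
      then show "norm (H z (y / r)) \<le> norm z * E z * K\<^sup>2" using H_le[of z "y / r"] by linarith
    qed
  qed measurable
  have si: "integrable L (\<lambda>y. \<integral>x. G z (y / r) (of_int (x::int) / r) \<partial>count_space UNIV)"
    using P.integrable_fst[OF i] .
  have e1: "integral\<^sup>L (count_space UNIV) (b z r) = (\<integral>y. (\<integral>x. G z (y / r) (of_int (x::int) / r) \<partial>count_space UNIV) \<partial>L)"
    unfolding b_def[abs_def] by (rule P.Fubini_integral[OF i])
  have e2: "(\<integral>y. (\<integral>x. G z (y / r) (of_int (x::int) / r) \<partial>count_space UNIV) \<partial>L) - r *\<^sub>R (\<integral>y. H z (y / r) \<partial>L) =
      (\<integral>y. (\<integral>x. G z (y / r) (of_int (x::int) / r) \<partial>count_space UNIV) - r *\<^sub>R H z (y / r) \<partial>L)"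
    by (subst Bochner_Integration.integral_diff[OF si integrable_scaleR_right[OF Hi]]) (simp only: integral_scaleR_right)
  have "norm (\<integral>y. (\<integral>x. G z (y / r) (of_int (x::int) / r) \<partial>count_space UNIV) - r *\<^sub>R H z (y / r) \<partial>L)
      \<le> (\<integral>y. E z * K * kap (y / r) \<partial>L)"
  proof (rule Bochner_Integration.integral_norm_bound_integral)
    show "integrable L (\<lambda>y. (\<integral>x. G z (y / r) (of_int (x::int) / r) \<partial>count_space UNIV) - r *\<^sub>R H z (y / r))"
      by (rule Bochner_Integration.integrable_diff[OF si integrable_scaleR_right[OF Hi]])
    show "integrable L (\<lambda>y. E z * K * kap (y / r))"
      by (rule integrable_mult_right[OF kap_integrable(1)])
  qed (rule sum_G(2)[OF r])
  also have "\<dots> = E z * K * k r" by (simp add: k_def)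
  finally show "norm (integral\<^sup>L (count_space UNIV) (b z r) - r *\<^sub>R (\<integral>y. H z (y / r) \<partial>L)) \<le> E z * K * k r"
    unfolding e1 e2 .
qed

text \<open>Largest term times sum of the norms: the former is of order \<open>k r\<close>, the
  latter of order \<open>r * k r\<close>. The bound is uniform in the window, so it survives the
  passage to all sites.\<close>

lemma b_square_sum: "(\<Sum>x\<in>window n. (norm (b z r x))\<^sup>2) \<le> 2 * (E z * K)\<^sup>2 * (r * (k r)\<^sup>2)"
proof -
  have "(\<Sum>x\<in>window n. (norm (b z r x))\<^sup>2) \<le> (\<Sum>x\<in>window n. (E z * K * k r) * norm (b z r x))"
    using b_le by (intro sum_mono) (simp add: power2_eq_square mult_right_mono)
  also have "\<dots> = (E z * K * k r) * (\<Sum>x\<in>window n. norm (b z r x))" by (simp add: sum_distrib_left)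
  also have "\<dots> \<le> (E z * K * k r) * (2 * E z * K * r * k r)"
  proof (rule mult_left_mono)
    have "(\<Sum>x\<in>window n. norm (b z r x)) = (\<integral>x. norm (b z r x) \<partial>count_space (window n))"
      by (simp add: lebesgue_integral_count_space_finite)
    also have "\<dots> = (\<integral>x. indicator (window n) x *\<^sub>R norm (b z r x) \<partial>count_space UNIV)"
      by (subst integral_restrict_space[symmetric]) (auto simp: restrict_count_space)
    also have "\<dots> \<le> (\<integral>x. norm (b z r x) \<partial>count_space UNIV)"
      using b_integrable by (intro integral_mono integrable_mult_indicator) (auto simp: indicator_def)
    finally show "(\<Sum>x\<in>window n. norm (b z r x)) \<le> 2 * E z * K * r * k r" using b_norm_sum by (rule order_trans)
    show "0 \<le> E z * K * k r" using EK_nonneg k_nonneg by simp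
  qed
  finally show ?thesis by (simp add: power2_eq_square mult_ac)
qed

end

text \<open>The Levy exponent. Since \<open>W y * cauchy_density y\<close> is
  \<open>1 / (pi * y\<^sup>2)\<close> for \<open>y \<noteq> 0\<close>, it integrates
  \<open>exp (z * of_real (f (u + y) - f u)) - 1\<close> against
  \<open>\<gamma> / (pi * y\<^sup>2)\<close>. The integral over \<open>u\<close> has to come first:
  its cancellation yields the quadratic bound at 0, whereas the norm of the integrand is controlled
  only linearly in \<open>y\<close>.\<close>

definition \<Lambda> :: "complex \<Rightarrow> complex" where "\<Lambda> z = \<gamma> *\<^sub>R (\<integral>y. W y *\<^sub>R H z y \<partial>cauchy)"

lemma H_sq_weight: "norm (H z y) \<le> (2 * norm z * E z * K\<^sup>2) * sq_weight y"
proof -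
  have "norm z * E z * K\<^sup>2 * (kap y)\<^sup>2 \<le> norm z * E z * K\<^sup>2 * (2 * sq_weight y)"
    using kap_square_le[of y] E_nonneg[of z] by (intro mult_left_mono) (auto simp: sq_weight_def)
  then show ?thesis using H_le[of z y] by (simp add: mult_ac)
qed

lemma b_sum_lim: "((\<lambda>r. integral\<^sup>L (count_space UNIV) (b z r)) \<longlongrightarrow> \<Lambda> z) at_top"
proof -
  have 1: "((\<lambda>r. r *\<^sub>R (\<integral>y. H z (y / r) \<partial>L)) \<longlongrightarrow> \<Lambda> z) at_top"
    unfolding \<Lambda>_def by (rule small_jumps_limit[OF H_cont H_sq_weight])
  have "((\<lambda>r. integral\<^sup>L (count_space UNIV) (b z r) - r *\<^sub>R (\<integral>y. H z (y / r) \<partial>L)) \<longlongrightarrow> 0) at_top"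
  proof (rule Lim_null_comparison)
    show "\<forall>\<^sub>F r in at_top. norm (integral\<^sup>L (count_space UNIV) (b z r) - r *\<^sub>R (\<integral>y. H z (y / r) \<partial>L)) \<le> E z * K * k r"
      using eventually_ge_at_top[of 1] by eventually_elim (rule b_sum_approx)
    show "((\<lambda>r. E z * K * k r) \<longlongrightarrow> 0) at_top"
      by (rule tendsto_mult_right_zero[OF k_lim])
  qed
  from tendsto_add[OF this 1] show ?thesis by simp
qed

end

section \<open>The perturbed lattice\<close>

locale perturbed_lattice = noise_profile f f' f'' F L \<gamma> + M: prob_space M
  for f f' f'' :: "real \<Rightarrow> real" and F :: real and L :: "real measure" and \<gamma> :: real
    and M :: "'a measure" +
  fixes \<xi> :: "int \<Rightarrow> 'a \<Rightarrow> real"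
  assumes indep: "M.indep_vars (\<lambda>_. borel) \<xi> UNIV"
    and ident: "\<And>x. distr M borel (\<xi> x) = L"
begin

lemma \<xi>_meas [measurable]: "\<xi> x \<in> borel_measurable M"
  using indep by (auto simp: M.indep_vars_def)

definition T :: "real \<Rightarrow> 'a \<Rightarrow> real" where
  "T r \<omega> = (\<integral>x. f ((of_int x + \<xi> x \<omega>) / r) \<partial>count_space UNIV)"
definition R :: "real \<Rightarrow> real" where
  "R r = (\<integral>x. f (of_int (x::int) / r) \<partial>count_space UNIV)"
text \<open>Finite windows, because independence is applied to finite products. Subtracting the
  lattice value at each site leaves increments of \<open>f\<close>, which \<open>kap\<close>
  controls.\<close>

definition D :: "real \<Rightarrow> nat \<Rightarrow> 'a \<Rightarrow> real" where
  "D r n \<omega> = (\<Sum>x\<in>window n. d (\<xi> x \<omega> / r) (of_int x / r))"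

lemma D_meas [measurable]: "D r n \<in> borel_measurable M"
  unfolding D_def[abs_def] d_def by measurable

lemma shifted_meas:
  "(\<lambda>p. f ((of_int (snd p) + \<xi> (snd p) (fst p)) / r)) \<in> borel_measurable (M \<Otimes>\<^sub>M count_space (UNIV :: int set))"
  by (rule measurable_compose_countable[of "\<lambda>i p. f ((of_int i + \<xi> i (fst p)) / r)", OF _ measurable_snd]) measurable

lemma T_meas [measurable]: "T r \<in> borel_measurable M"
proof -
  interpret Z: sigma_finite_measure "count_space (UNIV :: int set)"
    by (rule sigma_finite_measure_count_space)
  show ?thesis
    unfolding T_def[abs_def]
    by (rule Z.borel_measurable_lebesgue_integral) (use shifted_meas[of r] in \<open>simp add: case_prod_beta'\<close>)
qed

text \<open>\<open>T\<close> takes the default value 0 where the series is not absolutely summable,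
  so almost sure summability is what gives it meaning. The expected sum of the absolute values
  depends only on the common law of the sites, and for each fixed displacement \<open>y\<close> the
  lattice sum of \<open>\<bar>f\<bar>\<close> shifted by \<open>y / r\<close> is at most
  \<open>C\<close>; no moment of the noise enters.\<close>

lemma AE_summable:
  assumes r: "r \<ge> 1"
  shows "AE \<omega> in M. integrable (count_space UNIV) (\<lambda>x. f ((of_int x + \<xi> x \<omega>) / r))"
proof -
  have r0: "r > 0" using r by simp
  interpret PM: pair_sigma_finite M "count_space (UNIV :: int set)"
    unfolding pair_sigma_finite_def by (auto intro: sigma_finite_measure_count_space M.sigma_finite_measure_axioms)
  interpret PL: pair_sigma_finite L "count_space (UNIV :: int set)"
    unfolding pair_sigma_finite_def by (auto intro: sigma_finite_measure_count_space L.sigma_finite_measure_axioms)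
  define C where "C = r * (\<integral>u. \<bar>f u\<bar> \<partial>lborel) + (\<integral>u. \<bar>f' u\<bar> \<partial>lborel)"
  have mM: "(\<lambda>p. ennreal \<bar>f ((of_int (snd p) + \<xi> (snd p) (fst p)) / r)\<bar>) \<in> borel_measurable (M \<Otimes>\<^sub>M count_space (UNIV :: int set))"
    using shifted_meas[of r] by measurable
  have mL: "(\<lambda>p. ennreal \<bar>f ((of_int (snd p) + fst p) / r)\<bar>) \<in> borel_measurable (L \<Otimes>\<^sub>M count_space (UNIV :: int set))"
    by (rule measurable_compose_countable[of "\<lambda>i p. ennreal \<bar>f ((of_int i + fst p) / r)\<bar>", OF _ measurable_snd]) measurable
  have "(\<integral>\<^sup>+\<omega>. (\<integral>\<^sup>+x. ennreal \<bar>f ((of_int x + \<xi> x \<omega>) / r)\<bar> \<partial>count_space UNIV) \<partial>M) =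
    (\<integral>\<^sup>+x. (\<integral>\<^sup>+\<omega>. ennreal \<bar>f ((of_int x + \<xi> x \<omega>) / r)\<bar> \<partial>M) \<partial>count_space UNIV)"
    using PM.Fubini[OF mM] by simp
  also have "\<dots> = (\<integral>\<^sup>+x. (\<integral>\<^sup>+y. ennreal \<bar>f ((of_int x + y) / r)\<bar> \<partial>L) \<partial>count_space UNIV)"
  proof (rule nn_integral_cong)
    fix x :: int
    show "(\<integral>\<^sup>+\<omega>. ennreal \<bar>f ((of_int x + \<xi> x \<omega>) / r)\<bar> \<partial>M) = (\<integral>\<^sup>+y. ennreal \<bar>f ((of_int x + y) / r)\<bar> \<partial>L)"
      unfolding ident[of x, symmetric] by (subst nn_integral_distr) auto
  qed
  also have "\<dots> = (\<integral>\<^sup>+y. (\<integral>\<^sup>+x. ennreal \<bar>f ((of_int x + y) / r)\<bar> \<partial>count_space UNIV) \<partial>L)"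
    using PL.Fubini[OF mL] by simp
  also have "\<dots> \<le> (\<integral>\<^sup>+y. ennreal C \<partial>L)"
  proof (rule nn_integral_mono)
    fix y
    note g = C1L1_shift[OF f, of "y / r"]
    note rs = riemann_sum[OF g r0]
    have "(\<integral>\<^sup>+x. ennreal \<bar>f ((of_int x + y) / r)\<bar> \<partial>count_space UNIV) =
      (\<integral>\<^sup>+x. ennreal (norm (f (of_int x / r + y / r))) \<partial>count_space UNIV)"
      by (simp add: add_divide_distrib)
    also have "\<dots> = ennreal (\<integral>x. norm (f (of_int (x::int) / r + y / r)) \<partial>count_space UNIV)"
      by (rule nn_integral_norm_eq[OF rs(1)])
    also have "\<dots> \<le> ennreal C"
      using rs(3) lborel_integral_shift[of "\<lambda>u. \<bar>f u\<bar>" "y / r"] lborel_integral_shift[of "\<lambda>u. \<bar>f' u\<bar>" "y / r"]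
      unfolding C_def by (intro ennreal_leI) simp
    finally show "(\<integral>\<^sup>+x. ennreal \<bar>f ((of_int x + y) / r)\<bar> \<partial>count_space UNIV) \<le> ennreal C" .
  qed
  also have "\<dots> < \<infinity>" by (simp add: L.emeasure_space_1 del: L.space_eq_univ)
  finally have fin: "(\<integral>\<^sup>+\<omega>. (\<integral>\<^sup>+x. ennreal \<bar>f ((of_int x + \<xi> x \<omega>) / r)\<bar> \<partial>count_space UNIV) \<partial>M) \<noteq> \<infinity>" by simp
  have "AE \<omega> in M. (\<integral>\<^sup>+x. ennreal \<bar>f ((of_int x + \<xi> x \<omega>) / r)\<bar> \<partial>count_space UNIV) \<noteq> \<infinity>"
  proof (rule nn_integral_PInf_AE[OF _ fin])
    show "(\<lambda>\<omega>. \<integral>\<^sup>+x. ennreal \<bar>f ((of_int x + \<xi> x \<omega>) / r)\<bar> \<partial>count_space UNIV) \<in> borel_measurable M"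
      using PM.M2.borel_measurable_nn_integral_fst[OF mM] by simp
  qed
  then show ?thesis
    by eventually_elim (auto intro!: integrableI_bounded simp: less_top)
qed

lemma D_limit:
  assumes r: "r \<ge> 1"
  shows "AE \<omega> in M. (\<lambda>n. D r n \<omega>) \<longlonglongrightarrow> T r \<omega> - R r"
  using AE_summable[OF r]
proof eventually_elim
  case (elim \<omega>)
  have i: "integrable (count_space UNIV) (\<lambda>x::int. f (of_int x / r))"
    using riemann_sum(1)[OF f, of r] r by simp
  have "(\<lambda>n. \<Sum>x\<in>window n. f ((of_int x + \<xi> x \<omega>) / r) - f (of_int x / r)) \<longlonglongrightarrow>
     (\<integral>x. f ((of_int x + \<xi> x \<omega>) / r) - f (of_int x / r) \<partial>count_space UNIV)"
    by (rule count_space_window_limit[OF Bochner_Integration.integrable_diff[OF elim i]])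
  then show ?case
    using elim i by (simp add: D_def d_def T_def R_def add_divide_distrib)
qed

lemma one_plus_b_M: "1 + b z r x = (\<integral>\<omega>. exp (z * of_real (d (\<xi> x \<omega> / r) (of_int x / r))) \<partial>M)"
  unfolding one_plus_b
  using integral_distr[OF \<xi>_meas[of x], of "\<lambda>y. exp (z * of_real (d (y / r) (of_int x / r)))"]
  by (simp add: ident)

lemma exp_d_bound: "norm (exp (z * of_real (d y u))) \<le> exp (norm z * (2 * F))" for z :: complex
  using norm_zd_le[of z y u] by (intro order_trans[OF norm_exp]) simp

lemma exp_d_integrable: "integrable M (\<lambda>\<omega>. exp (z * of_real (d (\<xi> x \<omega> / r) u)))" for z :: complex
  by (rule M.integrable_const_bound[of _ "exp (norm z * (2 * F))"]) (rule AE_I2[OF exp_d_bound], measurable)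

lemma exp_D: "(\<integral>\<omega>. exp (z * of_real (D r n \<omega>)) \<partial>M) = (\<Prod>x\<in>window n. 1 + b z r x)"
proof -
  have "exp (z * of_real (D r n \<omega>)) = (\<Prod>x\<in>window n. exp (z * of_real (d (\<xi> x \<omega> / r) (of_int x / r))))" for \<omega>
    by (simp add: D_def sum_distrib_left exp_sum)
  moreover have "(\<integral>\<omega>. (\<Prod>x\<in>window n. exp (z * of_real (d (\<xi> x \<omega> / r) (of_int x / r)))) \<partial>M) =
      (\<Prod>x\<in>window n. \<integral>\<omega>. exp (z * of_real (d (\<xi> x \<omega> / r) (of_int x / r))) \<partial>M)"
  proof (rule M.indep_vars_lebesgue_integral)
    show "M.indep_vars (\<lambda>_. borel) (\<lambda>x \<omega>. exp (z * of_real (d (\<xi> x \<omega> / r) (of_int x / r)))) (window n)"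
      by (rule M.indep_vars_compose2[OF M.indep_vars_subset[OF indep subset_UNIV],
            where Y = "\<lambda>x y. exp (z * of_real (d (y / r) (of_int x / r)))"]) measurable
  qed (simp, rule exp_d_integrable)
  ultimately show ?thesis by (simp add: one_plus_b_M)
qed

text \<open>The comparison of product and exponential is made on finite windows, with an error
  independent of the window; dominated convergence then extends it to all sites.\<close>

lemma char_TR_approx:
  assumes r: "r \<ge> 1"
  shows "norm ((\<integral>\<omega>. iexp (s * (T r \<omega> - R r)) \<partial>M) - exp (integral\<^sup>L (count_space UNIV) (b (\<i> * of_real s) r)))
    \<le> exp 2 * (2 * (E (\<i> * of_real s) * K)\<^sup>2 * (r * (k r)\<^sup>2))"
proof -
  define z where "z = \<i> * complex_of_real s"
  have z: "z * of_real y = \<i> * of_real (s * y)" for y by (simp add: z_def)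
  \<comment> \<open>For imaginary \<open>z\<close> this factor is a value of the characteristic
    function of one site, hence in the unit disc.\<close>
  have le1: "norm (1 + b z r x) \<le> 1" for x
  proof -
    have "norm (1 + b z r x) \<le> (\<integral>\<omega>. norm (exp (z * of_real (d (\<xi> x \<omega> / r) (of_int x / r)))) \<partial>M)"
      unfolding one_plus_b_M by (rule integral_norm_bound)
    also have "\<dots> = 1" unfolding z by (simp add: M.prob_space del: of_real_mult)
    finally show ?thesis .
  qed
  have bd: "norm ((\<Prod>x\<in>window n. 1 + b z r x) - exp (\<Sum>x\<in>window n. b z r x)) \<le> exp 2 * (2 * (E z * K)\<^sup>2 * (r * (k r)\<^sup>2))" for n
    by (rule order_trans[OF prod_exp_approx mult_left_mono[OF b_square_sum[OF r]]]) (use le1 in auto)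
  have "(\<lambda>n. \<integral>\<omega>. exp (z * of_real (D r n \<omega>)) \<partial>M) \<longlonglongrightarrow> (\<integral>\<omega>. exp (z * of_real (T r \<omega> - R r)) \<partial>M)"
  proof (rule integral_dominated_convergence[where w = "\<lambda>_. 1"])
    show "AE \<omega> in M. (\<lambda>n. exp (z * of_real (D r n \<omega>))) \<longlonglongrightarrow> exp (z * of_real (T r \<omega> - R r))"
      using D_limit[OF r] by eventually_elim (intro tendsto_intros)
    show "AE \<omega> in M. norm (exp (z * of_real (D r n \<omega>))) \<le> 1" for n
      unfolding z by (simp del: of_real_mult)
  qed measurable
  moreover have "(\<lambda>n. exp (\<Sum>x\<in>window n. b z r x)) \<longlonglongrightarrow> exp (integral\<^sup>L (count_space UNIV) (b z r))"
    by (intro tendsto_exp count_space_window_limit b_integrable[OF r])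
  ultimately have "(\<lambda>n. norm ((\<integral>\<omega>. exp (z * of_real (D r n \<omega>)) \<partial>M) - exp (\<Sum>x\<in>window n. b z r x))) \<longlonglongrightarrow>
     norm ((\<integral>\<omega>. exp (z * of_real (T r \<omega> - R r)) \<partial>M) - exp (integral\<^sup>L (count_space UNIV) (b z r)))"
    by (intro tendsto_norm tendsto_diff)
  then have "norm ((\<integral>\<omega>. exp (z * of_real (T r \<omega> - R r)) \<partial>M) - exp (integral\<^sup>L (count_space UNIV) (b z r)))
     \<le> exp 2 * (2 * (E z * K)\<^sup>2 * (r * (k r)\<^sup>2))"
    by (rule LIMSEQ_le_const2) (use bd in \<open>auto simp: exp_D\<close>)
  then show ?thesis unfolding z unfolding z_def .
qed

definition S :: "real \<Rightarrow> 'a \<Rightarrow> real" where "S r \<omega> = T r \<omega> - r * integral\<^sup>L lborel f"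

lemma S_meas [measurable]: "S r \<in> borel_measurable M"
  unfolding S_def[abs_def] by measurable

lemma R_lim: "((\<lambda>r. R r - r * integral\<^sup>L lborel f) \<longlongrightarrow> 0) at_top"
proof (rule Lim_null_comparison)
  show "\<forall>\<^sub>F r in at_top. norm (R r - r * integral\<^sup>L lborel f) \<le> (\<integral>v. \<bar>f'' v\<bar> \<partial>lborel) / r"
    using eventually_gt_at_top[of 0]
    by eventually_elim (use trapezoid_sum_scaled[OF f f'] in \<open>simp add: R_def\<close>)
  show "((\<lambda>r. (\<integral>v. \<bar>f'' v\<bar> \<partial>lborel) / r) \<longlongrightarrow> 0) at_top"
    by (rule real_tendsto_divide_at_top[OF tendsto_const filterlim_ident])
qed

lemma char_S_lim: "((\<lambda>r. char (distr M borel (S r)) s) \<longlongrightarrow> exp (\<Lambda> (\<i> * of_real s))) at_top"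
proof -
  define A where "A r = (\<integral>\<omega>. iexp (s * (T r \<omega> - R r)) \<partial>M)" for r
  define B where "B r = exp (integral\<^sup>L (count_space UNIV) (b (\<i> * of_real s) r))" for r
  have "((\<lambda>r. A r - B r) \<longlongrightarrow> 0) at_top"
  proof (rule Lim_null_comparison)
    show "\<forall>\<^sub>F r in at_top. norm (A r - B r) \<le> exp 2 * (2 * (E (\<i> * of_real s) * K)\<^sup>2 * (r * (k r)\<^sup>2))"
      using eventually_ge_at_top[of 1]
      unfolding A_def B_def by eventually_elim (rule char_TR_approx)
    show "((\<lambda>r. exp 2 * (2 * (E (\<i> * of_real s) * K)\<^sup>2 * (r * (k r)\<^sup>2))) \<longlongrightarrow> 0) at_top"
      by (intro tendsto_mult_right_zero k_square_lim)
  qed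
  moreover have "(B \<longlongrightarrow> exp (\<Lambda> (\<i> * of_real s))) at_top"
    unfolding B_def by (intro tendsto_exp b_sum_lim)
  ultimately have "((\<lambda>r. (A r - B r) + B r) \<longlongrightarrow> 0 + exp (\<Lambda> (\<i> * of_real s))) at_top"
    by (rule tendsto_add)
  then have A: "(A \<longlongrightarrow> exp (\<Lambda> (\<i> * of_real s))) at_top" by simp
  have "((\<lambda>r. iexp (s * (R r - r * integral\<^sup>L lborel f)) * A r) \<longlongrightarrow> iexp (s * 0) * exp (\<Lambda> (\<i> * of_real s))) at_top"
    by (intro tendsto_intros A R_lim)
  moreover have "char (distr M borel (S r)) s = iexp (s * (R r - r * integral\<^sup>L lborel f)) * A r" for r
  proof -
    have "char (distr M borel (S r)) s = (\<integral>\<omega>. iexp (s * (R r - r * integral\<^sup>L lborel f)) * iexp (s * (T r \<omega> - R r)) \<partial>M)"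
      unfolding char_def
      by (subst integral_distr) (auto simp: S_def algebra_simps simp flip: exp_add intro!: Bochner_Integration.integral_cong)
    then show ?thesis unfolding A_def by (simp only: integral_mult_right_zero)
  qed
  ultimately show ?thesis by simp
qed

text \<open>For real exponents the factors \<open>1 + b\<close> are nonnegative reals, and
  \<open>1 + x \<le> exp x\<close> already bounds their product by the exponential of the sum; the
  squares of \<open>b\<close> are not involved. Fatou's lemma passes from windows to all
  sites.\<close>

lemma exp_TR_moment:
  assumes r: "r \<ge> 1"
  shows "(\<integral>\<^sup>+\<omega>. ennreal (exp (a * (T r \<omega> - R r))) \<partial>M) \<le>
    ennreal (exp (Re (integral\<^sup>L (count_space UNIV) (b (of_real a) r))))"
proof -
  define p where "p x = (\<integral>\<omega>. exp (a * d (\<xi> x \<omega> / r) (of_int x / r)) \<partial>M)" for x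
  have p: "1 + b (of_real a) r x = of_real (p x)" for x
    unfolding one_plus_b_M p_def integral_complex_of_real[symmetric] by (simp add: exp_of_real[symmetric])
  have p0: "0 \<le> p x" for x unfolding p_def by (intro Bochner_Integration.integral_nonneg) simp
  have p1: "p x \<le> exp (Re (b (of_real a) r x))" for x
  proof -
    have "p x = 1 + Re (b (of_real a) r x)" using arg_cong[OF p[of x], of Re] by simp
    then show ?thesis using exp_ge_add_one_self[of "Re (b (of_real a) r x)"] by simp
  qed
  have Dle: "\<bar>D r n \<omega>\<bar> \<le> (\<Sum>x\<in>window n. 2 * F)" for n \<omega>
    unfolding D_def by (rule order_trans[OF sum_abs sum_mono[OF d_le(2)]])
  have ei: "integrable M (\<lambda>\<omega>. exp (a * D r n \<omega>))" for n
  proof (rule M.integrable_const_bound[of _ "exp (\<bar>a\<bar> * (\<Sum>x\<in>window n. 2 * F))"])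
    have "a * D r n \<omega> \<le> \<bar>a\<bar> * (\<Sum>x\<in>window n. 2 * F)" for \<omega>
    proof -
      have "a * D r n \<omega> \<le> \<bar>a\<bar> * \<bar>D r n \<omega>\<bar>" unfolding abs_mult[symmetric] by (rule abs_ge_self)
      also have "\<dots> \<le> \<bar>a\<bar> * (\<Sum>x\<in>window n. 2 * F)" by (rule mult_left_mono[OF Dle]) simp
      finally show ?thesis .
    qed
    then show "AE \<omega> in M. norm (exp (a * D r n \<omega>)) \<le> exp (\<bar>a\<bar> * (\<Sum>x\<in>window n. 2 * F))"
      by (intro AE_I2) (simp only: real_norm_def abs_exp_cancel exp_le_cancel_iff)
  qed measurable
  have eD: "(\<integral>\<^sup>+\<omega>. ennreal (exp (a * D r n \<omega>)) \<partial>M) \<le> ennreal (exp (Re (\<Sum>x\<in>window n. b (of_real a) r x)))" for n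
  proof -
    have "of_real (\<integral>\<omega>. exp (a * D r n \<omega>) \<partial>M) = (\<integral>\<omega>. exp (complex_of_real a * of_real (D r n \<omega>)) \<partial>M)"
      unfolding integral_complex_of_real[symmetric] by (simp add: exp_of_real[symmetric])
    also have "\<dots> = of_real (\<Prod>x\<in>window n. p x)" by (simp add: exp_D p)
    finally have "(\<integral>\<omega>. exp (a * D r n \<omega>) \<partial>M) = (\<Prod>x\<in>window n. p x)" by (simp only: of_real_eq_iff)
    also have "\<dots> \<le> (\<Prod>x\<in>window n. exp (Re (b (of_real a) r x)))"
      using p0 p1 by (intro prod_mono) auto
    also have "\<dots> = exp (Re (\<Sum>x\<in>window n. b (of_real a) r x))" by (simp add: exp_sum)
    finally have le: "(\<integral>\<omega>. exp (a * D r n \<omega>) \<partial>M) \<le> exp (Re (\<Sum>x\<in>window n. b (of_real a) r x))" .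
    have "(\<integral>\<^sup>+\<omega>. ennreal (exp (a * D r n \<omega>)) \<partial>M) = ennreal (\<integral>\<omega>. exp (a * D r n \<omega>) \<partial>M)"
      by (rule nn_integral_eq_integral[OF ei]) simp
    also have "\<dots> \<le> ennreal (exp (Re (\<Sum>x\<in>window n. b (of_real a) r x)))" by (rule ennreal_leI[OF le])
    finally show ?thesis .
  qed
  have "(\<integral>\<^sup>+\<omega>. ennreal (exp (a * (T r \<omega> - R r))) \<partial>M) = (\<integral>\<^sup>+\<omega>. liminf (\<lambda>n. ennreal (exp (a * D r n \<omega>))) \<partial>M)"
  proof (rule nn_integral_cong_AE)
    show "AE \<omega> in M. ennreal (exp (a * (T r \<omega> - R r))) = liminf (\<lambda>n. ennreal (exp (a * D r n \<omega>)))"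
      using D_limit[OF r]
    proof eventually_elim
      case (elim \<omega>)
      have "(\<lambda>n. ennreal (exp (a * D r n \<omega>))) \<longlonglongrightarrow> ennreal (exp (a * (T r \<omega> - R r)))"
        by (intro tendsto_ennrealI tendsto_intros elim)
      then show ?case by (rule lim_imp_Liminf[OF sequentially_bot, symmetric])
    qed
  qed
  also have "\<dots> \<le> liminf (\<lambda>n. \<integral>\<^sup>+\<omega>. ennreal (exp (a * D r n \<omega>)) \<partial>M)"
    by (rule nn_integral_liminf) measurable
  also have "\<dots> \<le> liminf (\<lambda>n. ennreal (exp (Re (\<Sum>x\<in>window n. b (of_real a) r x))))"
    by (rule Liminf_mono) (use eD in auto)
  also have "\<dots> = ennreal (exp (Re (integral\<^sup>L (count_space UNIV) (b (of_real a) r))))"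
    by (intro lim_imp_Liminf[OF sequentially_bot] tendsto_ennrealI tendsto_exp tendsto_Re
        count_space_window_limit b_integrable[OF r])
  finally show ?thesis .
qed

lemma exp_S_moment: "\<exists>C. \<forall>\<^sub>F r in at_top. (\<integral>\<^sup>+\<omega>. ennreal (exp (a * S r \<omega>)) \<partial>M) \<le> ennreal C"
proof -
  define B where "B r = exp (a * (R r - r * integral\<^sup>L lborel f)) * exp (Re (integral\<^sup>L (count_space UNIV) (b (of_real a) r)))" for r
  have "(B \<longlongrightarrow> exp (a * 0) * exp (Re (\<Lambda> (of_real a)))) at_top"
    unfolding B_def by (intro tendsto_intros R_lim b_sum_lim)
  then have "\<forall>\<^sub>F r in at_top. B r < exp (a * 0) * exp (Re (\<Lambda> (of_real a))) + 1"
    by (rule order_tendstoD) simp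
  then have "\<forall>\<^sub>F r in at_top. (\<integral>\<^sup>+\<omega>. ennreal (exp (a * S r \<omega>)) \<partial>M) \<le> ennreal (exp (a * 0) * exp (Re (\<Lambda> (of_real a))) + 1)"
    using eventually_ge_at_top[of 1]
  proof eventually_elim
    case (elim r)
    have "ennreal (exp (a * S r \<omega>)) = ennreal (exp (a * (R r - r * integral\<^sup>L lborel f))) * ennreal (exp (a * (T r \<omega> - R r)))" for \<omega>
      by (simp add: S_def algebra_simps flip: ennreal_mult exp_add)
    then have "(\<integral>\<^sup>+\<omega>. ennreal (exp (a * S r \<omega>)) \<partial>M) =
       ennreal (exp (a * (R r - r * integral\<^sup>L lborel f))) * (\<integral>\<^sup>+\<omega>. ennreal (exp (a * (T r \<omega> - R r))) \<partial>M)"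
      by (simp add: nn_integral_cmult)
    also have "\<dots> \<le> ennreal (exp (a * (R r - r * integral\<^sup>L lborel f))) * ennreal (exp (Re (integral\<^sup>L (count_space UNIV) (b (of_real a) r))))"
      by (rule mult_left_mono[OF exp_TR_moment[OF elim(2)]]) simp
    also have "\<dots> = ennreal (B r)" by (simp add: B_def ennreal_mult)
    also have "\<dots> \<le> ennreal (exp (a * 0) * exp (Re (\<Lambda> (of_real a))) + 1)"
      using elim(1) by (intro ennreal_leI) simp
    finally show ?case .
  qed
  then show ?thesis by blast
qed

end

section \<open>Moments and the limit distribution\<close>

text \<open>Both sides are 0 if the family is not summable.\<close>

lemma infsum_eq_integral_count_space:
  fixes g :: "'i \<Rightarrow> real"
  shows "infsum g UNIV = integral\<^sup>L (count_space UNIV) g"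
proof (cases "integrable (count_space UNIV) g")
  case True
  then have "Infinite_Set_Sum.abs_summable_on g UNIV" by (simp add: abs_summable_on_def)
  from infsetsum_infsum[OF this] show ?thesis by (simp add: infsetsum_def)
next
  case False
  then have "\<not> Infinite_Set_Sum.abs_summable_on g UNIV" by (simp add: abs_summable_on_def)
  then have "\<not> g summable_on UNIV"
    using abs_summable_equivalent[of g UNIV] summable_on_iff_abs_summable_on_real[of g UNIV] by blast
  then show ?thesis using False by (simp add: infsum_not_exists not_integrable_integral_eq)
qed

lemma power_div_fact_le_exp: "x ^ n / fact n \<le> exp x" if "x \<ge> 0" for x :: real
proof -
  have "(\<Sum>k\<in>{n}. x ^ k /\<^sub>R fact k) \<le> (\<Sum>k. x ^ k /\<^sub>R fact k)"
    using that by (intro sum_le_suminf summable_exp_generic) auto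
  then show ?thesis by (simp add: exp_def divide_inverse mult.commute)
qed

lemma real_distributionI:
  assumes "prob_space \<mu>" "sets \<mu> = sets borel"
  shows "real_distribution \<mu>"
  using assms sets_eq_imp_space_eq[OF assms(2)]
  by (simp add: real_distribution_def real_distribution_axioms_def)

text \<open>The Taylor polynomials of the characteristic function, whose coefficients are the moments, converge to it on the whole line; only even degrees are used, so that the absolute moment in the error term is a moment.\<close>

lemma determined_by_moments_exp:
  assumes \<mu>: "real_distribution \<mu>"
    and fin: "\<And>a. (\<integral>\<^sup>+x. ennreal (exp (a * x)) \<partial>\<mu>) < \<infinity>"
  shows "determined_by_moments \<mu>"
proof -
  interpret \<mu>: real_distribution \<mu> by fact
  have ei: "integrable \<mu> (\<lambda>x. exp (a * x))" for a
    using fin[of a] by (intro integrableI_bounded) auto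
  have ea: "integrable \<mu> (\<lambda>x. exp (a * \<bar>x\<bar>))" for a
  proof (rule Bochner_Integration.integrable_bound)
    show "integrable \<mu> (\<lambda>x. exp (a * x) + exp (- a * x))" by (intro Bochner_Integration.integrable_add ei)
    show "AE x in \<mu>. norm (exp (a * \<bar>x\<bar>)) \<le> norm (exp (a * x) + exp (- a * x))"
    proof (rule AE_I2)
      fix x
      have "exp (a * \<bar>x\<bar>) \<le> exp (a * x) + exp (- a * x)" by (cases "x < 0") (simp_all add: abs_if)
      then show "norm (exp (a * \<bar>x\<bar>)) \<le> norm (exp (a * x) + exp (- a * x))" by (simp add: abs_of_pos add_pos_pos)
    qed
  qed measurable
  have am: "integrable \<mu> (\<lambda>x. \<bar>x\<bar> ^ n)" for n
  proof (rule Bochner_Integration.integrable_bound)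
    show "integrable \<mu> (\<lambda>x. fact n * exp (1 * \<bar>x\<bar>))" by (intro integrable_mult_right ea)
    show "AE x in \<mu>. norm (\<bar>x\<bar> ^ n) \<le> norm (fact n * exp (1 * \<bar>x\<bar>))"
      using power_div_fact_le_exp[OF abs_ge_zero, of _ n] by (intro AE_I2) (simp add: field_simps)
  qed measurable
  have m: "integrable \<mu> (\<lambda>x. x ^ n)" for n
    by (rule Bochner_Integration.integrable_bound[OF am[of n]]) (auto simp: power_abs)
  have small: "(\<lambda>n. 2 * \<bar>t\<bar> ^ n / fact n * (\<integral>x. \<bar>x\<bar> ^ n \<partial>\<mu>)) \<longlonglongrightarrow> 0" for t
  proof (rule Lim_null_comparison[OF always_eventually])
    \<comment> \<open>Bounding a single term of the exponential series at the doubled argument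
      \<open>2 * \<bar>t\<bar> * \<bar>x\<bar>\<close> leaves the geometric factor
      \<open>(1/2) ^ n\<close>; this works for every \<open>t\<close> because all exponential
      moments are finite.\<close>
    show "(\<lambda>n. 2 * ((1/2) ^ n * (\<integral>x. exp (2 * \<bar>t\<bar> * \<bar>x\<bar>) \<partial>\<mu>))) \<longlonglongrightarrow> 0"
      by (intro tendsto_mult_right_zero tendsto_mult_left_zero LIMSEQ_power_zero) simp
    show "\<forall>n. norm (2 * \<bar>t\<bar> ^ n / fact n * (\<integral>x. \<bar>x\<bar> ^ n \<partial>\<mu>)) \<le> 2 * ((1/2) ^ n * (\<integral>x. exp (2 * \<bar>t\<bar> * \<bar>x\<bar>) \<partial>\<mu>))"
    proof
      fix n
      have "\<bar>t\<bar> ^ n / fact n * (\<integral>x. \<bar>x\<bar> ^ n \<partial>\<mu>) = (\<integral>x. \<bar>t\<bar> ^ n / fact n * \<bar>x\<bar> ^ n \<partial>\<mu>)"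
        by (rule integral_mult_right_zero[symmetric])
      also have "\<dots> \<le> (\<integral>x. (1/2) ^ n * exp (2 * \<bar>t\<bar> * \<bar>x\<bar>) \<partial>\<mu>)"
      proof (rule integral_mono)
        show "integrable \<mu> (\<lambda>x. \<bar>t\<bar> ^ n / fact n * \<bar>x\<bar> ^ n)" by (intro integrable_mult_right am)
        show "integrable \<mu> (\<lambda>x. (1/2) ^ n * exp (2 * \<bar>t\<bar> * \<bar>x\<bar>))" by (intro integrable_mult_right ea)
        fix x
        have "(2 * \<bar>t\<bar> * \<bar>x\<bar>) ^ n / fact n \<le> exp (2 * \<bar>t\<bar> * \<bar>x\<bar>)" by (rule power_div_fact_le_exp) simp
        from mult_left_mono[OF this, of "(1/2) ^ n"]
        show "\<bar>t\<bar> ^ n / fact n * \<bar>x\<bar> ^ n \<le> (1/2) ^ n * exp (2 * \<bar>t\<bar> * \<bar>x\<bar>)"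
          by (simp add: power_mult_distrib power_divide)
      qed
      also have "\<dots> = (1/2) ^ n * (\<integral>x. exp (2 * \<bar>t\<bar> * \<bar>x\<bar>) \<partial>\<mu>)" by (rule integral_mult_right_zero)
      finally have "2 * (\<bar>t\<bar> ^ n / fact n * (\<integral>x. \<bar>x\<bar> ^ n \<partial>\<mu>)) \<le> 2 * ((1/2) ^ n * (\<integral>x. exp (2 * \<bar>t\<bar> * \<bar>x\<bar>) \<partial>\<mu>))"
        by (rule mult_left_mono) simp
      then show "norm (2 * \<bar>t\<bar> ^ n / fact n * (\<integral>x. \<bar>x\<bar> ^ n \<partial>\<mu>)) \<le> 2 * ((1/2) ^ n * (\<integral>x. exp (2 * \<bar>t\<bar> * \<bar>x\<bar>) \<partial>\<mu>))"
        by (simp add: Bochner_Integration.integral_nonneg)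
    qed
  qed
  have "\<nu> = \<mu>" if \<nu>: "prob_space \<nu>" "sets \<nu> = sets borel"
    and eq: "\<And>k::nat. integrable \<nu> (\<lambda>x. x ^ k)" "\<And>k::nat. integral\<^sup>L \<nu> (\<lambda>x. x ^ k) = integral\<^sup>L \<mu> (\<lambda>x. x ^ k)" for \<nu>
  proof -
    interpret \<nu>: real_distribution \<nu> using \<nu> by (rule real_distributionI)
    have "char \<nu> t = char \<mu> t" for t
    proof -
      define P where "P n = (\<Sum>k\<le>n. ((\<i> * t) ^ k / fact k) * (\<integral>x. x ^ k \<partial>\<mu>))" for n
      define \<epsilon> where "\<epsilon> j = 2 * \<bar>t\<bar> ^ (2 * j) / fact (2 * j) * (\<integral>x. \<bar>x\<bar> ^ (2 * j) \<partial>\<mu>)" for j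
      have "\<epsilon> \<longlonglongrightarrow> 0"
        unfolding \<epsilon>_def using LIMSEQ_subseq_LIMSEQ[OF small[of t], of "\<lambda>j. 2 * j"]
        by (simp add: o_def strict_mono_def)
      moreover have "norm (char \<mu> t - P (2 * j)) \<le> \<epsilon> j" for j
        unfolding P_def \<epsilon>_def by (rule \<mu>.char_approx1[OF m])
      moreover have "norm (char \<nu> t - P (2 * j)) \<le> \<epsilon> j" for j
      proof -
        have "(\<integral>x. \<bar>x\<bar> ^ (2 * j) \<partial>\<nu>) = (\<integral>x. \<bar>x\<bar> ^ (2 * j) \<partial>\<mu>)"
          using eq(2)[of "2 * j"] by (simp add: power_even_abs)
        then show ?thesis
          using \<nu>.char_approx1[of "2 * j" t] eq by (simp add: P_def \<epsilon>_def)
      qed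
      ultimately have "(\<lambda>j. char \<mu> t - P (2 * j)) \<longlonglongrightarrow> 0" "(\<lambda>j. char \<nu> t - P (2 * j)) \<longlonglongrightarrow> 0"
        by (auto intro: Lim_null_comparison[OF always_eventually])
      from tendsto_diff[OF this(2,1)] have "(\<lambda>j::nat. char \<nu> t - char \<mu> t) \<longlonglongrightarrow> 0" by simp
      then show ?thesis by (simp add: LIMSEQ_const_iff)
    qed
    then show ?thesis
      using Levy_uniqueness[OF \<nu>.real_distribution_axioms \<mu>] by blast
  qed
  then show ?thesis
    unfolding determined_by_moments_def using m \<mu>.prob_space_axioms by auto
qed

text \<open>Taking the modulus removes the mean, and \<open>\<sigma> = 0\<close> covers the point
  masses.\<close>

lemma gaussian_norm_char:
  assumes "gaussian \<mu>"
  shows "\<exists>\<sigma>. \<forall>t. norm (char \<mu> t) = exp (- (\<sigma> * t)\<^sup>2 / 2)"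
proof -
  consider m where "\<mu> = return borel m" | m \<sigma> where "\<sigma> > 0" "\<mu> = density lborel (normal_density m \<sigma>)"
    using assms by (auto simp: gaussian_def)
  then show ?thesis
  proof cases
    case 1
    have "char \<mu> t = iexp (t * m)" for t unfolding 1 char_def by (subst integral_return) auto
    then show ?thesis by (intro exI[of _ 0]) simp
  next
    case 2
    have "char \<mu> t = iexp (t * m) * of_real (exp (- (\<sigma> * t)\<^sup>2 / 2))" for t
    proof -
      have "char \<mu> t = (\<integral>x. normal_density m \<sigma> x *\<^sub>R iexp (t * x) \<partial>lborel)"
        unfolding char_def 2(2) by (subst integral_density) auto
      also have "\<dots> = \<bar>\<sigma>\<bar> *\<^sub>R (\<integral>x. normal_density m \<sigma> (m + \<sigma> * x) *\<^sub>R iexp (t * (m + \<sigma> * x)) \<partial>lborel)"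
        using 2(1) by (intro lborel_integral_real_affine) simp
      also have "\<dots> = (\<integral>x. \<bar>\<sigma>\<bar> *\<^sub>R (normal_density m \<sigma> (m + \<sigma> * x) *\<^sub>R iexp (t * (m + \<sigma> * x))) \<partial>lborel)"
        by (rule integral_scaleR_right[symmetric])
      also have "\<dots> = (\<integral>x. iexp (t * m) * (std_normal_density x *\<^sub>R iexp ((\<sigma> * t) * x)) \<partial>lborel)"
      proof (rule Bochner_Integration.integral_cong[OF refl])
        fix x
        have "\<bar>\<sigma>\<bar> * normal_density m \<sigma> (m + \<sigma> * x) = std_normal_density x"
          using 2(1) by (simp add: normal_density_def real_sqrt_mult power_mult_distrib field_simps)
        then have e1: "\<bar>\<sigma>\<bar> *\<^sub>R (normal_density m \<sigma> (m + \<sigma> * x) *\<^sub>R iexp (t * (m + \<sigma> * x))) = std_normal_density x *\<^sub>R iexp (t * (m + \<sigma> * x))"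
          by (simp only: scaleR_scaleR)
        have e2: "iexp (t * (m + \<sigma> * x)) = iexp (t * m) * iexp ((\<sigma> * t) * x)"
          by (simp add: algebra_simps flip: exp_add)
        show "\<bar>\<sigma>\<bar> *\<^sub>R (normal_density m \<sigma> (m + \<sigma> * x) *\<^sub>R iexp (t * (m + \<sigma> * x))) = iexp (t * m) * (std_normal_density x *\<^sub>R iexp ((\<sigma> * t) * x))"
          unfolding e1 unfolding e2 by (simp only: mult_scaleR_right)
      qed
      also have "\<dots> = iexp (t * m) * (\<integral>x. std_normal_density x *\<^sub>R iexp ((\<sigma> * t) * x) \<partial>lborel)"
        by (rule integral_mult_right_zero)
      also have "(\<integral>x. std_normal_density x *\<^sub>R iexp ((\<sigma> * t) * x) \<partial>lborel) = char std_normal_distribution (\<sigma> * t)"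
        unfolding char_def by (subst integral_density) auto
      finally show ?thesis unfolding char_std_normal_distribution .
    qed
    then show ?thesis by (intro exI[of _ \<sigma>]) (simp add: norm_mult del: of_real_mult)
  qed
qed

section \<open>Exclusion of a Gaussian limit\<close>

context noise_profile
begin

lemma WH_integrable: "integrable cauchy (\<lambda>y. W y *\<^sub>R H z y)"
proof -
  interpret C: real_distribution cauchy by (rule real_distribution_cauchy)
  have [measurable]: "W \<in> borel_measurable borel" unfolding W_def[abs_def] by measurable
  show ?thesis
  proof (rule C.integrable_const_bound[of _ "2 * norm z * E z * K\<^sup>2"])
    have "norm (W y *\<^sub>R H z y) \<le> 2 * norm z * E z * K\<^sup>2" for y
    proof (cases "y = 0")
      case True
      then show ?thesis using E_nonneg[of z] by (simp add: W_def)
    next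
      case False
      have "1 + y\<^sup>2 > 0" by (simp add: add_pos_nonneg)
      then have 1: "W y * sq_weight y = 1" "W y \<ge> 0" using False by (simp_all add: sq_weight_def W_def)
      have "W y * norm (H z y) \<le> W y * ((2 * norm z * E z * K\<^sup>2) * sq_weight y)"
        by (rule mult_left_mono[OF H_sq_weight 1(2)])
      also have "\<dots> = (2 * norm z * E z * K\<^sup>2) * (W y * sq_weight y)" by simp
      finally show ?thesis using 1 by simp
    qed
    then show "AE y in cauchy. norm (W y *\<^sub>R H z y) \<le> 2 * norm z * E z * K\<^sup>2" by simp
  qed measurable
qed

text \<open>The logarithm of the modulus of a Gaussian characteristic function is quadratic, so its values at 2 and at 1 have ratio 4. The defect is nonnegative because \<open>4 (1 - cos \<theta>) - (1 - cos (2 \<theta>)) = 2 (1 - cos \<theta>)\<^sup>2\<close>.\<close>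

lemma quartic_vanishes:
  assumes h: "\<And>s. Re (\<Lambda> (\<i> * of_real s)) = - (\<sigma> * s)\<^sup>2 / 2"
  shows "AE y in cauchy. y \<noteq> 0 \<longrightarrow> (AE u in lborel. cos (d y u) = 1)"
proof -
  define P where "P y = (\<integral>u. 2 * (1 - cos (d y u))\<^sup>2 \<partial>lborel)" for y
  have ReG: "Re (G (\<i> * of_real s) y u) = cos (s * d y u) - 1" for s y u
  proof -
    have "exp (\<i> * of_real s * of_real (d y u)) = cis (s * d y u)" by (simp add: cis_conv_exp mult.assoc)
    then show ?thesis by (simp add: G_def)
  qed
  have Gi: "integrable lborel (\<lambda>u. cos (s * d y u) - 1)" for s y
    using integrable_Re[OF C1L1_D(3)[OF G_C1L1[of "\<i> * of_real s" y]]] by (simp only: ReG)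
  have ReH: "Re (H (\<i> * of_real s) y) = (\<integral>u. cos (s * d y u) - 1 \<partial>lborel)" for s y
    unfolding H_def using integral_Re[OF C1L1_D(3)[OF G_C1L1[of "\<i> * of_real s" y]]] by (simp only: ReG)
  have quart: "Re (H (\<i> * of_real 2) y) - 4 * Re (H (\<i> * of_real 1) y) = P y"
    and Pi: "integrable lborel (\<lambda>u. 2 * (1 - cos (d y u))\<^sup>2)" for y
  proof -
    have eq: "(cos (2 * d y u) - 1) - 4 * (cos (1 * d y u) - 1) = 2 * (1 - cos (d y u))\<^sup>2" for u
      using cos_double_cos[of "d y u"] by (simp add: power2_eq_square algebra_simps)
    show "integrable lborel (\<lambda>u. 2 * (1 - cos (d y u))\<^sup>2)"
      unfolding eq[symmetric] by (intro Bochner_Integration.integrable_diff integrable_mult_right Gi)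
    have "P y = (\<integral>u. (cos (2 * d y u) - 1) - 4 * (cos (1 * d y u) - 1) \<partial>lborel)"
      unfolding P_def eq ..
    also have "\<dots> = (\<integral>u. cos (2 * d y u) - 1 \<partial>lborel) - (\<integral>u. 4 * (cos (1 * d y u) - 1) \<partial>lborel)"
      by (intro Bochner_Integration.integral_diff integrable_mult_right Gi)
    also have "\<dots> = Re (H (\<i> * of_real 2) y) - 4 * Re (H (\<i> * of_real 1) y)"
      unfolding ReH integral_mult_right_zero ..
    finally show "Re (H (\<i> * of_real 2) y) - 4 * Re (H (\<i> * of_real 1) y) = P y" ..
  qed
  have P0: "0 \<le> P y" for y unfolding P_def by (intro Bochner_Integration.integral_nonneg) simp
  have W0: "0 \<le> W y" for y unfolding W_def by simp
  have Re\<Lambda>: "Re (\<Lambda> (\<i> * of_real s)) = \<gamma> * (\<integral>y. W y * Re (H (\<i> * of_real s) y) \<partial>cauchy)" for s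
    unfolding \<Lambda>_def using integral_Re[OF WH_integrable[of "\<i> * of_real s"]] by simp
  have Wi: "integrable cauchy (\<lambda>y. W y * Re (H (\<i> * of_real s) y))" for s
    using integrable_Re[OF WH_integrable[of "\<i> * of_real s"]] by simp
  have eqWP: "W y * P y = W y * Re (H (\<i> * of_real 2) y) - 4 * (W y * Re (H (\<i> * of_real 1) y))" for y
    unfolding quart[symmetric] by (simp add: right_diff_distrib)
  have WPi: "integrable cauchy (\<lambda>y. W y * P y)"
    unfolding eqWP by (intro Bochner_Integration.integrable_diff integrable_mult_right Wi)
  have "(\<integral>y. W y * P y \<partial>cauchy) = (\<integral>y. W y * Re (H (\<i> * of_real 2) y) \<partial>cauchy) - (\<integral>y. 4 * (W y * Re (H (\<i> * of_real 1) y)) \<partial>cauchy)"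
    unfolding eqWP by (intro Bochner_Integration.integral_diff integrable_mult_right Wi)
  also have "(\<integral>y. 4 * (W y * Re (H (\<i> * of_real 1) y)) \<partial>cauchy) = 4 * (\<integral>y. W y * Re (H (\<i> * of_real 1) y) \<partial>cauchy)"
    by (rule integral_mult_right_zero)
  finally have "\<gamma> * (\<integral>y. W y * P y \<partial>cauchy) = Re (\<Lambda> (\<i> * of_real 2)) - 4 * Re (\<Lambda> (\<i> * of_real 1))"
    unfolding Re\<Lambda> by (simp add: right_diff_distrib)
  also have "\<dots> = 0" unfolding h by (simp add: power2_eq_square)
  finally have "(\<integral>y. W y * P y \<partial>cauchy) = 0" using \<gamma> by simp
  then have "AE y in cauchy. W y * P y = 0"
    using integral_nonneg_eq_0_iff_AE[OF WPi] P0 W0 by (simp add: mult_nonneg_nonneg)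
  then show ?thesis
  proof eventually_elim
    case (elim y)
    show ?case
    proof
      assume "y \<noteq> 0"
      have "1 + y\<^sup>2 > 0" by (simp add: add_pos_nonneg)
      with \<open>y \<noteq> 0\<close> have "W y \<noteq> 0" by (simp add: W_def)
      with elim have "P y = 0" by simp
      then have "AE u in lborel. 2 * (1 - cos (d y u))\<^sup>2 = 0"
        unfolding P_def using integral_nonneg_eq_0_iff_AE[OF Pi[of y]] by simp
      then show "AE u in lborel. cos (d y u) = 1" by eventually_elim simp
    qed
  qed
qed

lemma AE_cauchy: "(AE y in cauchy. P y) \<longleftrightarrow> (AE y in lborel. P y)"
  unfolding cauchy_def by (subst AE_density) (auto simp: cauchy_density_pos)

text \<open>For this profile increments are at most 1 in absolute value, hence below
  \<open>2 * pi\<close>, so \<open>cos (d y u) = 1\<close> only if the increment is 0. As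
  \<open>f\<close> determines the square of its argument, that happens for
  \<open>y \<noteq> 0\<close> only at \<open>u = - y / 2\<close>, a null set; a statement holding
  for almost every \<open>u\<close> is then contradictory.\<close>

lemma not_gaussian:
  assumes f_eq: "f = (\<lambda>x. exp (- (x\<^sup>2)))"
    and c: "\<And>s. char \<mu> s = exp (\<Lambda> (\<i> * of_real s))"
  shows "\<not> gaussian \<mu>"
proof
  interpret C: real_distribution cauchy by (rule real_distribution_cauchy)
  assume "gaussian \<mu>"
  then obtain \<sigma> where \<sigma>: "\<And>t. norm (char \<mu> t) = exp (- (\<sigma> * t)\<^sup>2 / 2)"
    using gaussian_norm_char by blast
  have "Re (\<Lambda> (\<i> * of_real s)) = - (\<sigma> * s)\<^sup>2 / 2" for s
    using \<sigma>[of s] unfolding c norm_exp_eq_Re by simp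
  from quartic_vanishes[OF this]
  have "AE y in cauchy. y \<noteq> 0 \<longrightarrow> (AE u in lborel. cos (d y u) = 1)" .
  moreover have "AE y in cauchy. y \<noteq> (0::real)" unfolding AE_cauchy by (rule AE_lborel_singleton)
  ultimately have "AE y in cauchy. y \<noteq> 0 \<and> (AE u in lborel. cos (d y u) = 1)"
    by eventually_elim simp
  then have "AE y in cauchy. False"
  proof (rule eventually_mono)
    fix y :: real assume y: "y \<noteq> 0 \<and> (AE u in lborel. cos (d y u) = 1)"
    then have "AE u in lborel. cos (d y u) = 1" by simp
    moreover have "AE u in lborel. u \<noteq> - y / 2" by (rule AE_lborel_singleton)
    ultimately have "AE u in lborel. cos (d y u) = 1 \<and> u \<noteq> - y / 2" by eventually_elim simp
    then have "AE u in (lborel :: real measure). False"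
    proof (rule eventually_mono)
      fix u assume u: "cos (d y u) = 1 \<and> u \<noteq> - y / 2"
      have "0 < f v" "f v \<le> 1" for v by (simp_all add: f_eq)
      from this[of "u + y"] this[of u] have le: "\<bar>d y u\<bar> \<le> 1" unfolding d_def by linarith
      have "d y u = 0"
      proof (rule ccontr)
        assume "d y u \<noteq> 0"
        then have "cos (2 * (\<bar>d y u\<bar> / 2)) < 1" using le by (intro cos_double_less_one) auto
        then show False using u by (simp add: abs_if split: if_splits)
      qed
      then have "f (u + y) = f u" by (simp add: d_def)
      then have "(u + y)\<^sup>2 = u\<^sup>2" unfolding f_eq by simp
      then have "y * (2 * u + y) = 0" by (simp add: power2_eq_square algebra_simps)
      then have "2 * u + y = 0" using y by simp
      then show False using u by simp
    qed
    then have "AE u in cauchy. False" unfolding AE_cauchy .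
    then show False by simp
  qed
  then show False by simp
qed

end

section \<open>Existence of the limit law and weak convergence\<close>

context perturbed_lattice
begin

lemma S_dist: "real_distribution (distr M borel (S r))"
  by (rule M.real_distribution_distr) measurable

lemma nn_exp_distr: "(\<integral>\<^sup>+x. ennreal (exp (a * x)) \<partial>distr M borel (S r)) = (\<integral>\<^sup>+\<omega>. ennreal (exp (a * S r \<omega>)) \<partial>M)"
  by (subst nn_integral_distr) auto

text \<open>Exponential Chebyshev bounds for both signs. Since the moment bounds hold only for large
  \<open>r\<close>, the sequence starts at \<open>r0\<close>. Tightness yields a measure whose
  characteristic function is the limit, with no need to show separately that this limit is a
  characteristic function.\<close>

lemma tight_S: "\<exists>r0. tight (\<lambda>n. distr M borel (S (r0 + real n)))"
proof -
  obtain C1 C2 where "\<forall>\<^sub>F r in at_top. (\<integral>\<^sup>+\<omega>. ennreal (exp (1 * S r \<omega>)) \<partial>M) \<le> ennreal C1"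
    "\<forall>\<^sub>F r in at_top. (\<integral>\<^sup>+\<omega>. ennreal (exp (- 1 * S r \<omega>)) \<partial>M) \<le> ennreal C2"
    using exp_S_moment[of 1] exp_S_moment[of "-1"] by blast
  then have "\<forall>\<^sub>F r in at_top. (\<integral>\<^sup>+\<omega>. ennreal (exp (1 * S r \<omega>)) \<partial>M) \<le> ennreal C1 \<and>
     (\<integral>\<^sup>+\<omega>. ennreal (exp (- 1 * S r \<omega>)) \<partial>M) \<le> ennreal C2"
    by eventually_elim simp
  then obtain r0 where r0: "\<And>r. r \<ge> r0 \<Longrightarrow> (\<integral>\<^sup>+\<omega>. ennreal (exp (1 * S r \<omega>)) \<partial>M) \<le> ennreal C1"
     "\<And>r. r \<ge> r0 \<Longrightarrow> (\<integral>\<^sup>+\<omega>. ennreal (exp (- 1 * S r \<omega>)) \<partial>M) \<le> ennreal C2"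
    by (auto simp: eventually_at_top_linorder)
  \<comment> \<open>The constants \<open>C1\<close> and \<open>C2\<close> may be negative, in which
    case \<open>ennreal\<close> sends them to 0; the maxima make the sum valid for reals.\<close>
  define C where "C = max C1 0 + max C2 0"
  have tail: "measure (distr M borel (S r)) {-y<..y} \<ge> 1 - exp (- y) * C" if r: "r \<ge> r0" for r y
  proof -
    interpret N: real_distribution "distr M borel (S r)" by (rule S_dist)
    let ?N = "distr M borel (S r)"
    have "emeasure ?N (UNIV - {-y<..y}) = (\<integral>\<^sup>+x. indicator (UNIV - {-y<..y}) x \<partial>?N)"
      by (rule nn_integral_indicator[symmetric]) simp
    also have "\<dots> \<le> (\<integral>\<^sup>+x. ennreal (exp (- y)) * (ennreal (exp (1 * x)) + ennreal (exp (- 1 * x))) \<partial>?N)"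
    proof (rule nn_integral_mono)
      fix x
      show "indicator (UNIV - {-y<..y}) x \<le> ennreal (exp (- y)) * (ennreal (exp (1 * x)) + ennreal (exp (- 1 * x)))"
      proof (cases "x \<in> {-y<..y}")
        case False
        then have "0 \<le> - y + x \<or> 0 \<le> - y + - x" by auto
        then have "1 \<le> exp (- y + x) \<or> 1 \<le> exp (- y + - x)" by simp
        then have "1 \<le> exp (- y + x) + exp (- y + - x)"
          using exp_gt_zero[of "- y + x"] exp_gt_zero[of "- y + - x"] by linarith
        then have "1 \<le> exp (- y) * (exp x + exp (- x))" unfolding exp_add by (simp add: distrib_left)
        then show ?thesis
          using False ennreal_leI[of 1 "exp (- y) * (exp x + exp (- x))"]
          by (simp add: ennreal_mult flip: ennreal_plus)
      qed simp
    qed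
    also have "\<dots> = ennreal (exp (- y)) * ((\<integral>\<^sup>+x. ennreal (exp (1 * x)) \<partial>?N) + (\<integral>\<^sup>+x. ennreal (exp (- 1 * x)) \<partial>?N))"
      by (subst nn_integral_cmult, measurable, subst nn_integral_add, measurable)
    also have "\<dots> \<le> ennreal (exp (- y)) * (ennreal C1 + ennreal C2)"
      unfolding nn_exp_distr using r0[OF r] by (intro mult_left_mono add_mono) auto
    also have "ennreal C1 + ennreal C2 = ennreal C"
      unfolding C_def by (subst ennreal_plus) (auto simp: max_def ennreal_neg)
    also have "ennreal (exp (- y)) * ennreal C = ennreal (exp (- y) * C)" by (rule ennreal_mult[symmetric]) (auto simp: C_def)
    finally have "measure ?N (UNIV - {-y<..y}) \<le> exp (- y) * C"
      by (subst (asm) N.emeasure_eq_measure) (simp add: C_def)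
    moreover have "measure ?N (UNIV - {-y<..y}) = 1 - measure ?N {-y<..y}"
      using N.prob_compl[of "{-y<..y}"] by simp
    ultimately show ?thesis by linarith
  qed
  show ?thesis
  proof (intro exI[of _ r0], unfold tight_def, intro conjI allI impI)
    fix \<epsilon> :: real assume \<epsilon>: "\<epsilon> > 0"
    have "((\<lambda>y. exp (- y) * C) \<longlongrightarrow> 0) at_top" by (rule tendsto_mult_left_zero[OF tendsto_exp_neg_at_top])
    then have "\<forall>\<^sub>F y in at_top. exp (- y) * C < \<epsilon>" using \<epsilon> by (rule order_tendstoD)
    then have "\<forall>\<^sub>F y in at_top. exp (- y) * C < \<epsilon> \<and> y > 0"
      using eventually_gt_at_top[of 0] by eventually_elim simp
    then obtain y where y: "exp (- y) * C < \<epsilon>" "y > 0"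
      using eventually_happens'[OF trivial_limit_at_top_linorder] by blast
    show "\<exists>a b. a < b \<and> (\<forall>n. 1 - \<epsilon> < measure (distr M borel (S (r0 + real n))) {a<..b})"
    proof (rule exI[of _ "-y"], rule exI[of _ y], intro conjI allI)
      show "- y < y" using y by simp
      fix n
      show "1 - \<epsilon> < measure (distr M borel (S (r0 + real n))) {-y<..y}"
        using tail[of "r0 + real n" y] y by simp
    qed
  qed (rule S_dist)
qed

text \<open>A subsequential limit suffices, since \<open>char_S_lim\<close> identifies its
  characteristic function along every sequence. The exponential is unbounded, so weak convergence is
  applied to its truncations at \<open>m\<close>, which inherit a bound independent of
  \<open>m\<close>, and Fatou's lemma removes the truncation.\<close>

lemma limit_exists:
  "\<exists>\<mu>. real_distribution \<mu> \<and> (\<forall>s. char \<mu> s = exp (\<Lambda> (\<i> * of_real s))) \<and> (\<forall>a. (\<integral>\<^sup>+x. ennreal (exp (a * x)) \<partial>\<mu>) < \<infinity>)"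
proof -
  obtain r0 where t: "tight (\<lambda>n. distr M borel (S (r0 + real n)))" using tight_S by blast
  obtain h \<mu> where h: "strict_mono h" and \<mu>: "real_distribution \<mu>"
    and w: "weak_conv_m ((\<lambda>n. distr M borel (S (r0 + real n))) \<circ> (\<lambda>n. n) \<circ> h) \<mu>"
    using tight_imp_convergent_subsubsequence[OF t, of "\<lambda>n. n"] by (auto simp: strict_mono_def)
  define X where "X n = r0 + real (h n)" for n
  have "filterlim (\<lambda>n. real (h n)) at_top sequentially"
    by (rule filterlim_compose[OF filterlim_real_sequentially filterlim_subseq[OF h]])
  then have X: "filterlim X at_top sequentially"
    unfolding X_def by (rule filterlim_tendsto_add_at_top[OF tendsto_const])
  have w: "weak_conv_m (\<lambda>n. distr M borel (S (X n))) \<mu>" using w by (simp add: o_def X_def)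
  interpret \<mu>: real_distribution \<mu> by fact
  have "char \<mu> s = exp (\<Lambda> (\<i> * of_real s))" for s
    using LIMSEQ_unique[OF levy_continuity1[OF S_dist \<mu> w] filterlim_compose[OF char_S_lim X]] .
  moreover have "(\<integral>\<^sup>+x. ennreal (exp (a * x)) \<partial>\<mu>) < \<infinity>" for a
  proof -
    obtain C where C: "\<forall>\<^sub>F r in at_top. (\<integral>\<^sup>+\<omega>. ennreal (exp (a * S r \<omega>)) \<partial>M) \<le> ennreal C"
      using exp_S_moment by blast
    define C' where "C' = max C 0"
    have C': "\<forall>\<^sub>F n in sequentially. (\<integral>\<^sup>+\<omega>. ennreal (exp (a * S (X n) \<omega>)) \<partial>M) \<le> ennreal C'"
      using filterlim_iff[THEN iffD1, OF X, rule_format, OF C]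
      by eventually_elim (auto simp: C'_def max_def ennreal_neg)
    have b: "(\<integral>\<^sup>+x. ennreal (min (exp (a * x)) (real m)) \<partial>\<mu>) \<le> ennreal C'" for m
    proof -
      have lim: "(\<lambda>n. \<integral>x. min (exp (a * x)) (real m) \<partial>distr M borel (S (X n))) \<longlonglongrightarrow> (\<integral>x. min (exp (a * x)) (real m) \<partial>\<mu>)"
        by (rule weak_conv_imp_integral_bdd_continuous_conv[OF S_dist \<mu> w, of _ "real m"])
           (auto intro!: continuous_intros)
      have i: "integrable N (\<lambda>x. min (exp (a * x)) (real m))" if "real_distribution N" for N
      proof -
        interpret N: real_distribution N by fact
        show ?thesis by (rule N.integrable_const_bound[of _ "real m"]) auto
      qed
      have "\<forall>\<^sub>F n in sequentially. (\<integral>x. min (exp (a * x)) (real m) \<partial>distr M borel (S (X n))) \<le> C'"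
        using C'
      proof eventually_elim
        case (elim n)
        have "ennreal (\<integral>x. min (exp (a * x)) (real m) \<partial>distr M borel (S (X n))) =
          (\<integral>\<^sup>+x. ennreal (min (exp (a * x)) (real m)) \<partial>distr M borel (S (X n)))"
          by (rule nn_integral_eq_integral[OF i[OF S_dist], symmetric]) simp
        also have "\<dots> \<le> (\<integral>\<^sup>+x. ennreal (exp (a * x)) \<partial>distr M borel (S (X n)))"
          by (intro nn_integral_mono ennreal_leI) simp
        also have "\<dots> \<le> ennreal C'" unfolding nn_exp_distr by (rule elim)
        finally have "ennreal (\<integral>x. min (exp (a * x)) (real m) \<partial>distr M borel (S (X n))) \<le> ennreal C'" .
        moreover have "0 \<le> C'" by (simp add: C'_def)
        ultimately show ?case by (simp only: ennreal_le_iff)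
      qed
      then have "(\<integral>x. min (exp (a * x)) (real m) \<partial>\<mu>) \<le> C'"
        by (rule tendsto_upperbound[OF lim]) simp
      then show ?thesis
        by (subst nn_integral_eq_integral[OF i[OF \<mu>]]) (auto intro: ennreal_leI)
    qed
    have "(\<integral>\<^sup>+x. ennreal (exp (a * x)) \<partial>\<mu>) = (\<integral>\<^sup>+x. liminf (\<lambda>m. ennreal (min (exp (a * x)) (real m))) \<partial>\<mu>)"
    proof (rule nn_integral_cong)
      fix x
      have "\<forall>\<^sub>F m in sequentially. min (exp (a * x)) (real m) = exp (a * x)"
        using eventually_ge_at_top[of "nat \<lceil>exp (a * x)\<rceil>"]
        by eventually_elim (auto simp: min_def nat_le_iff ceiling_le_iff)
      then have "(\<lambda>m. ennreal (min (exp (a * x)) (real m))) \<longlonglongrightarrow> ennreal (exp (a * x))"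
        by (intro tendsto_ennrealI tendsto_eventually)
      then show "ennreal (exp (a * x)) = liminf (\<lambda>m. ennreal (min (exp (a * x)) (real m)))"
        by (rule lim_imp_Liminf[OF sequentially_bot, symmetric])
    qed
    also have "\<dots> \<le> liminf (\<lambda>m. \<integral>\<^sup>+x. ennreal (min (exp (a * x)) (real m)) \<partial>\<mu>)"
      by (rule nn_integral_liminf) measurable
    also have "\<dots> \<le> liminf (\<lambda>m::nat. ennreal C')"
      by (rule Liminf_mono) (use b in auto)
    also have "\<dots> < \<infinity>" by (simp add: Liminf_const)
    finally show ?thesis .
  qed
  ultimately show ?thesis using \<mu> by blast
qed

text \<open>Convergence along the real parameter is tested on arbitrary sequences tending to
  infinity, where the Levy continuity theorem applies.\<close>

lemma weak_limit:
  assumes \<mu>: "real_distribution \<mu>" and c: "\<And>s. char \<mu> s = exp (\<Lambda> (\<i> * of_real s))"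
  shows "weak_conv_filter (\<lambda>r. distr M borel (S r)) \<mu> at_top"
  unfolding weak_conv_filter_def
proof (intro allI impI)
  fix g :: "real \<Rightarrow> real" assume g: "continuous_on UNIV g \<and> bounded (range g)"
  then obtain B where B: "\<And>x. norm (g x) \<le> B" by (auto simp: bounded_iff)
  show "((\<lambda>r. integral\<^sup>L (distr M borel (S r)) g) \<longlongrightarrow> integral\<^sup>L \<mu> g) at_top"
  proof (rule tendsto_at_topI_sequentially)
    fix X :: "nat \<Rightarrow> real" assume X: "filterlim X at_top sequentially"
    have "weak_conv_m (\<lambda>n. distr M borel (S (X n))) \<mu>"
      by (rule levy_continuity[OF S_dist \<mu>]) (use filterlim_compose[OF char_S_lim X] c in simp)
    then show "(\<lambda>n. integral\<^sup>L (distr M borel (S (X n))) g) \<longlonglongrightarrow> integral\<^sup>L \<mu> g"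
      using g B by (intro weak_conv_imp_integral_bdd_continuous_conv[OF S_dist \<mu>])
        (auto simp: continuous_on_eq_continuous_at)
  qed
qed

end

section \<open>From the hypotheses of the theorem to the locale\<close>

lemma schwartz_C1L1:
  assumes "schwartz f"
  shows "C1L1 ((deriv ^^ n) f) ((deriv ^^ Suc n) f)" and "\<exists>B. \<forall>x. \<bar>(deriv ^^ n) f x\<bar> \<le> B"
proof -
  have der: "((deriv ^^ n) f has_vector_derivative (deriv ^^ Suc n) f x) (at x)" for n x
    using assms by (simp add: schwartz_def DERIV_deriv_iff_real_differentiable
        flip: has_real_derivative_iff_has_vector_derivative)
  then have cont: "continuous_on UNIV ((deriv ^^ n) f)" for n
    by (meson continuous_at_imp_continuous_on has_vector_derivative_continuous)
  have bd: "\<exists>B. \<forall>x. \<bar>x\<bar> ^ j * \<bar>(deriv ^^ n) f x\<bar> \<le> B" for n j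
    using assms unfolding schwartz_def bounded_iff by (force simp: abs_mult)
  have int: "integrable lborel ((deriv ^^ n) f)" for n
  proof -
    \<comment> \<open>Decay of orders 0 and 2 together bounds the derivative by a multiple of
      \<open>1 / (1 + x\<^sup>2)\<close>, which is integrable.\<close>
    obtain B0 B2 where B: "\<And>x. \<bar>x\<bar> ^ 0 * \<bar>(deriv ^^ n) f x\<bar> \<le> B0" "\<And>x. \<bar>x\<bar> ^ 2 * \<bar>(deriv ^^ n) f x\<bar> \<le> B2"
      using bd[of 0 n] bd[of 2 n] by blast
    show ?thesis
    proof (rule Bochner_Integration.integrable_bound)
      show "integrable lborel (\<lambda>x::real. (B0 + B2) * (1 / (1 + x\<^sup>2)))"
        by (intro integrable_mult_right integrable_inverse_1_plus_square')
      show "(deriv ^^ n) f \<in> borel_measurable lborel"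
        using borel_measurable_continuous_onI[OF cont] by simp
      have "\<bar>(deriv ^^ n) f x\<bar> \<le> (B0 + B2) * (1 / (1 + x\<^sup>2))" for x
      proof -
        have "1 + x\<^sup>2 > 0" by (simp add: add_pos_nonneg)
        moreover have "(1 + x\<^sup>2) * \<bar>(deriv ^^ n) f x\<bar> \<le> B0 + B2"
          using B(1)[of x] B(2)[of x] by (simp add: distrib_right)
        ultimately show ?thesis by (simp add: field_simps)
      qed
      then show "AE x in lborel. norm ((deriv ^^ n) f x) \<le> norm ((B0 + B2) * (1 / (1 + x\<^sup>2)))"
        by (intro AE_I2) (metis abs_ge_self order_trans real_norm_def)
    qed
  qed
  show "C1L1 ((deriv ^^ n) f) ((deriv ^^ Suc n) f)"
    unfolding C1L1_def using der cont int by blast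
  show "\<exists>B. \<forall>x. \<bar>(deriv ^^ n) f x\<bar> \<le> B" using bd[of 0 n] by simp
qed

text \<open>Passes from the convention with \<open>2 * pi\<close> in the exponent to that of
  \<open>char\<close>; rescaling \<open>t\<close> turns the constant \<open>c\<close> into
  \<open>c / (2 * pi)\<close>.\<close>

lemma char_tail_asymp:
  assumes "c > 0"
    and charf: "(\<lambda>t. 1 - (LINT \<omega>|M. cis (2 * pi * t * X \<omega>))) \<sim>[at 0] (\<lambda>t. complex_of_real (c * \<bar>t\<bar>))"
    and [measurable]: "X \<in> borel_measurable M"
  shows "((\<lambda>t. (1 - char (distr M borel X) t) / of_real \<bar>t\<bar>) \<longlongrightarrow> of_real (c / (2 * pi))) (at 0)"
proof -
  have c: "(LINT \<omega>|M. cis (2 * pi * t * X \<omega>)) = char (distr M borel X) (2 * pi * t)" for t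
    unfolding char_def by (subst integral_distr) (auto simp: cis_conv_exp)
  have "((\<lambda>t. if 1 - char (distr M borel X) (2 * pi * t) = 0 \<and> complex_of_real (c * \<bar>t\<bar>) = 0 then 1
      else (1 - char (distr M borel X) (2 * pi * t)) / complex_of_real (c * \<bar>t\<bar>)) \<longlongrightarrow> 1) (at 0)"
    using charf unfolding asymp_equiv_def c .
  \<comment> \<open>Asymptotic equivalence counts \<open>0 / 0\<close> as 1. This case does not
    occur for \<open>t \<noteq> 0\<close>, where \<open>c * \<bar>t\<bar>\<close> is
    nonzero.\<close>
  moreover have "\<forall>\<^sub>F t in at 0. (if 1 - char (distr M borel X) (2 * pi * t) = 0 \<and> complex_of_real (c * \<bar>t\<bar>) = 0 then 1
      else (1 - char (distr M borel X) (2 * pi * t)) / complex_of_real (c * \<bar>t\<bar>)) =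
      (1 - char (distr M borel X) (2 * pi * t)) / complex_of_real (c * \<bar>t\<bar>)"
    unfolding eventually_at using \<open>c > 0\<close> by (auto intro!: exI[of _ 1])
  ultimately have 1: "((\<lambda>t. (1 - char (distr M borel X) (2 * pi * t)) / complex_of_real (c * \<bar>t\<bar>)) \<longlongrightarrow> 1) (at 0)"
    by (rule Lim_transform_eventually)
  have "filterlim (\<lambda>t::real. t / (2 * pi)) (at 0) (at 0)"
    unfolding filterlim_at by (auto intro!: tendsto_eq_intros simp: eventually_at intro: exI[of _ 1])
  from filterlim_compose[OF 1 this]
  have "((\<lambda>t. (1 - char (distr M borel X) t) / complex_of_real (c * \<bar>t / (2 * pi)\<bar>) * of_real (c / (2 * pi))) \<longlongrightarrow> 1 * of_real (c / (2 * pi))) (at 0)"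
    by (intro tendsto_intros) simp_all
  moreover have "(1 - char (distr M borel X) t) / complex_of_real (c * \<bar>t / (2 * pi)\<bar>) * of_real (c / (2 * pi)) =
     (1 - char (distr M borel X) t) / of_real \<bar>t\<bar>" for t
  proof -
    have "complex_of_real (c * \<bar>t / (2 * pi)\<bar>) = of_real \<bar>t\<bar> * of_real (c / (2 * pi))" by (simp add: abs_divide)
    moreover have "complex_of_real (c / (2 * pi)) \<noteq> 0" using \<open>c > 0\<close> by simp
    ultimately show ?thesis by (simp del: of_real_divide of_real_mult)
  qed
  ultimately show ?thesis by simp
qed

theorem theorem4p1:
  fixes M :: "'a measure" and \<xi> :: "int \<Rightarrow> 'a \<Rightarrow> real"
    and f :: "real \<Rightarrow> real" and c :: real
  assumes f_S: "schwartz f"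
    and M: "prob_space M"
    and indep: "prob_space.indep_vars M (\<lambda>_. borel) \<xi> UNIV"
    and ident: "\<forall>x. distr M borel (\<xi> x) = distr M borel (\<xi> 0)"
    and c_pos: "c > 0"
    and charf: "(\<lambda>t. 1 - (LINT \<omega>|M. cis (2 * pi * t * \<xi> 0 \<omega>)))
                  \<sim>[at 0] (\<lambda>t. complex_of_real (c * \<bar>t\<bar>))"
  shows "\<exists>\<mu>. determined_by_moments \<mu> \<and>
           weak_conv_filter
             (\<lambda>r. distr M borel
                (\<lambda>\<omega>. (\<Sum>\<^sub>\<infinity>x::int. f ((real_of_int x + \<xi> x \<omega>) / r)) - r * integral\<^sup>L lborel f))
             \<mu> at_top \<and>
           (f = (\<lambda>x. exp (- (x\<^sup>2))) \<longrightarrow> \<not> gaussian \<mu>)"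
proof -
  interpret M: prob_space M by fact
  have rv: "\<xi> 0 \<in> borel_measurable M" using indep by (auto simp: M.indep_vars_def)
  obtain B0 B1 where B: "\<And>x. \<bar>f x\<bar> \<le> B0" "\<And>x. \<bar>deriv f x\<bar> \<le> B1"
    using schwartz_C1L1(2)[OF f_S, of 0] schwartz_C1L1(2)[OF f_S, of 1] by auto
  interpret perturbed_lattice f "deriv f" "deriv (deriv f)" "max B0 B1" "distr M borel (\<xi> 0)" "c / (2 * pi)" M \<xi>
  proof -
    interpret L: real_distribution "distr M borel (\<xi> 0)" by (rule M.real_distribution_distr[OF rv])
    show "perturbed_lattice f (deriv f) (deriv (deriv f)) (max B0 B1) (distr M borel (\<xi> 0)) (c / (2 * pi)) M \<xi>"
    proof unfold_locales
      show "C1L1 f (deriv f)" "C1L1 (deriv f) (deriv (deriv f))"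
        using schwartz_C1L1(1)[OF f_S, of 0] schwartz_C1L1(1)[OF f_S, of 1] by simp_all
      show "\<bar>f u\<bar> \<le> max B0 B1" "\<bar>deriv f u\<bar> \<le> max B0 B1" for u
        using B[of u] by auto
      show "0 < c / (2 * pi)" using c_pos by simp
      show "((\<lambda>t. (1 - char (distr M borel (\<xi> 0)) t) / of_real \<bar>t\<bar>) \<longlongrightarrow> of_real (c / (2 * pi))) (at 0)"
        by (rule char_tail_asymp[OF c_pos charf rv])
      show "distr M borel (\<xi> x) = distr M borel (\<xi> 0)" for x using ident by blast
    qed (rule indep)
  qed
  obtain \<mu> where \<mu>: "real_distribution \<mu>" "\<And>s. char \<mu> s = exp (\<Lambda> (\<i> * of_real s))"
    "\<And>a. (\<integral>\<^sup>+x. ennreal (exp (a * x)) \<partial>\<mu>) < \<infinity>"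
    using limit_exists by blast
  have S_eq: "(\<Sum>\<^sub>\<infinity>x::int. f ((real_of_int x + \<xi> x \<omega>) / r)) - r * integral\<^sup>L lborel f = S r \<omega>" for r \<omega>
    by (simp add: S_def T_def infsum_eq_integral_count_space)
  show ?thesis
    unfolding S_eq
    using determined_by_moments_exp[OF \<mu>(1,3)] weak_limit[OF \<mu>(1,2)] not_gaussian[OF _ \<mu>(2)] by blast
qed

end
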